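(* Let $(\mathfrak g,P)$ be an admissible pair, $\mathcal N$ a normalization condition for $(\mathfrak g,P)$ and $\widetilde{\mathcal N}\subset\mathcal N$ a negligible submodule. Then for a regular normal Cartan geometry $(p:\mathcal G\to M,\omega)$ of type $(\mathfrak g,P)$ (normal with respect to $\mathcal N$), the essential curvature function $\kappa_e:\mathcal G\to\mathcal N/\widetilde{\mathcal N}$ vanishes identically if and only if the curvature $K$ of $\omega$ vanishes identically.
   Context: All Lie algebras are real and finite dimensional. **Admissible pairs.** A filtered Lie algebra is a Lie algebra $\mathfrak g$ with linear subspaces $\mathfrak g=\mathfrak g^{-\mu}\supset\dots\supset\mathfrak g^{-1}\supset\mathfrak g^0\supset\mathfrak g^1\supset\dots\supset\mathfrak g^\nu$ such that $[\mathfrak g^i,\mathfrak g^j]\subset\mathfrak g^{i+j}$ for all $i,j$, where $\mathfrak g^\ell=\mathfrak g$ for $\ell<-\mu$ and $\mathfrak g^\ell=\{0\}$ for $\ell>\nu$. $\operatorname{Aut}_f(\mathfrak g)$ is the group of Lie algebra automorphisms preserving each $\mathfrak g^i$, and $\mathfrak{der}_f(\mathfrak g)$ the Lie algebra of derivations preserving each $\mathfrak g^i$. An admissible pair $(\mathfrak g,P)$ consists of (i) such a filtered Lie algebra $\mathfrak g$; (ii) a Lie group $P$ with Lie algebra $\mathfrak p:=\mathfrak g^0$; (iii) a (smooth) homomorphism $\operatorname{Ad}:P\to\operatorname{Aut}_f(\mathfrak g)$ with derivative $\operatorname{ad}|_{\mathfrak g^0}:\mathfrak g^0\to\mathfrak{der}_f(\mathfrak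 g)$; such that (A) there is no nonzero ideal of $\mathfrak g$ contained in $\mathfrak g^0$; (B) if $A\in\mathfrak g^0$ satisfies $\operatorname{ad}(A)(\mathfrak g^i)\subset\mathfrak g^{i+1}$ for all $i=-\mu,\dots,-1$, then $A\in\mathfrak g^1$. **Associated graded.** $\operatorname{gr}_i(\mathfrak g)=\mathfrak g^i/\mathfrak g^{i+1}$, $\operatorname{gr}(\mathfrak g)=\bigoplus_i\operatorname{gr}_i(\mathfrak g)$ with the induced graded Lie bracket, and $\mathfrak m=\bigoplus_{i=-\mu}^{-1}\operatorname{gr}_i(\mathfrak g)$ with $\mathfrak m_i=\operatorname{gr}_i(\mathfrak g)$. $C^k(\mathfrak m,\operatorname{gr}(\mathfrak g))=L(\Lambda^k\mathfrak m,\operatorname{gr}(\mathfrak g))$ is the space of alternating $k$-linear maps, and $C^k(\mathfrak m,\operatorname{gr}(\mathfrak g))_\ell$ the subspace of maps sending $\mathfrak m_{i_1}\times\dots\times\mathfrak m_{i_k}$ to $\operatorname{gr}_{i_1+\dots+i_k+\ell}(\mathfrak g)$. The differential $\partial:C^k(\mathfrak m,\operatorname{gr}(\mathfrak g))\to C^{k+1}(\mathfrak m,\operatorname{gr}(\mathfrak g))$, which preserves the degree $\ell$, is $$\partial\varphi(X_0,\dots,X_k)=\sum_{i}(-1)^i[X_i,\varphi(X_0,\dots,\widehat{X_i},\dots,X_k)]+\sum_{i<j}(-1)^{i+j}\varphi([X_i,X_j],X_0,\dots,\widehat{X_i},\dots,\widehat{X_j},\dots,X_k).$$ **Filtered multilinear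 maps.** $L(\Lambda^k(\mathfrak g/\mathfrak p),\mathfrak g)$ is the space of alternating $k$-linear maps $(\mathfrak g/\mathfrak p)^k\to\mathfrak g$, with its natural $P$-action induced by $\operatorname{Ad}$. $L(\Lambda^k(\mathfrak g/\mathfrak p),\mathfrak g)^\ell$ is the subspace of maps $\alpha$ homogeneous of degree $\ge\ell$, i.e. $\alpha(X_1+\mathfrak p,\dots,X_k+\mathfrak p)\in\mathfrak g^{i_1+\dots+i_k+\ell}$ for all $X_j\in\mathfrak g^{i_j}$, $i_j<0$. The linear map $\operatorname{gr}_\ell:L(\Lambda^k(\mathfrak g/\mathfrak p),\mathfrak g)^\ell\to C^k(\mathfrak m,\operatorname{gr}(\mathfrak g))_\ell$ sends $\alpha$ to the map taking the classes of $X_j\in\mathfrak g^{i_j}$ to the class of $\alpha(X_1+\mathfrak p,\dots,X_k+\mathfrak p)$ in $\operatorname{gr}_{i_1+\dots+i_k+\ell}(\mathfrak g)$. For a subspace $E\subset L(\Lambda^k(\mathfrak g/\mathfrak p),\mathfrak g)$ put $\operatorname{gr}_\ell(E):=\operatorname{gr}_\ell(E\cap L(\Lambda^k(\mathfrak g/\mathfrak p),\mathfrak g)^\ell)$. **Normalization condition:** a $P$-invariant linear subspace $\mathcal N\subset L(\Lambda^2(\mathfrak g/\mathfrak p),\mathfrak g)$ such that for each $\ell>0$ the subspace $\operatorname{gr}_\ell(\mathcal N)\subset C^2(\mathfrak m,\operatorname{gr}(\mathfrak g))_\ell$ is complementary to the image of $\partial:C^1(\mathfrak m,\operatorname{gr}(\mathfrak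 g))_\ell\to C^2(\mathfrak m,\operatorname{gr}(\mathfrak g))_\ell$. **Negligible submodule** in $\mathcal N$: a $P$-invariant subspace $\widetilde{\mathcal N}\subset\mathcal N$ such that for each $\ell>0$, $\operatorname{gr}_\ell(\widetilde{\mathcal N})\cap\ker(\partial)=\{0\}$ in $C^2(\mathfrak m,\operatorname{gr}(\mathfrak g))_\ell$. **Cartan geometries.** A Cartan geometry $(p:\mathcal G\to M,\omega)$ of type $(\mathfrak g,P)$ is a principal $P$-bundle $p:\mathcal G\to M$ over a smooth manifold with a Cartan connection $\omega\in\Omega^1(\mathcal G,\mathfrak g)$: $(r^g)^*\omega=\operatorname{Ad}(g^{-1})\circ\omega$ for all $g\in P$ ($r^g$ the principal right action of $g$), $\omega(\zeta_X)=X$ for the fundamental vector field $\zeta_X$ of any $X\in\mathfrak p$, and each $\omega_u:T_u\mathcal G\to\mathfrak g$ is a linear isomorphism. Its curvature is $K(\xi,\eta)=d\omega(\xi,\eta)+[\omega(\xi),\omega(\eta)]$. It is regular if $\omega_u(\xi)\in\mathfrak g^i$, $\omega_u(\eta)\in\mathfrak g^j$ always implies $K_u(\xi,\eta)\in\mathfrak g^{i+j+1}$. The curvature function of a regular geometry is the $P$-equivariant smooth function $\kappa:\mathcal G\to L(\Lambda^2(\mathfrak g/\mathfrak p),\mathfrak g)^1$, $\kappa(u)(A+\mathfrak p,B+\mathfrak p)=K_u(\omega_u^{-1}(A),\omega_u^{-1}(B))$ (well defined since $K$ is horizontal). A regular geometry is normal (of type $\mathcal N$) if $\kappa$ has values in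 $\mathcal N$. For a normal geometry and a negligible submodule $\widetilde{\mathcal N}\subset\mathcal N$, the essential curvature function $\kappa_e:\mathcal G\to\mathcal N/\widetilde{\mathcal N}$ is the composition of $\kappa$ with the projection $\mathcal N\to\mathcal N/\widetilde{\mathcal N}$. *)

theory Defs
  imports "HOL-Analysis.Analysis" "HOL-Algebra.Group"
begin

section \<open>Real vector spaces on explicit carriers\<close>

text \<open>
  Quotients such as \<open>\<gg>/\<pp>\<close> and \<open>gr\<^sub>i(\<gg>) = \<gg>\<^sup>i/\<gg>\<^bsup>i+1\<^esup>\<close> depend on the filtration, which is a
  variable, so they are not types. They are handled as real vector spaces with explicit carrier,
  whose elements are cosets.
\<close>

record 'v vsp =
  vcarrier :: "'v set"
  vadd :: "'v \<Rightarrow> 'v \<Rightarrow> 'v"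
  vscale :: "real \<Rightarrow> 'v \<Rightarrow> 'v"
  vzero :: 'v

definition lin :: "'v::real_vector set \<Rightarrow> 'v vsp" where
  "lin S = \<lparr>vcarrier = S, vadd = (+), vscale = (*\<^sub>R), vzero = 0\<rparr>"

definition vsubspace :: "'v vsp \<Rightarrow> 'v set \<Rightarrow> bool" where
  "vsubspace V W \<longleftrightarrow> W \<subseteq> vcarrier V \<and> vzero V \<in> W \<and>
     (\<forall>x\<in>W. \<forall>y\<in>W. vadd V x y \<in> W) \<and> (\<forall>c. \<forall>x\<in>W. vscale V c x \<in> W)"

definition vlinear :: "'v vsp \<Rightarrow> 'w vsp \<Rightarrow> ('v \<Rightarrow> 'w) \<Rightarrow> bool" where
  "vlinear V W f \<longleftrightarrow> (\<forall>x\<in>vcarrier V. f x \<in> vcarrier W) \<and>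
     (\<forall>x\<in>vcarrier V. \<forall>y\<in>vcarrier V. f (vadd V x y) = vadd W (f x) (f y)) \<and>
     (\<forall>c. \<forall>x\<in>vcarrier V. f (vscale V c x) = vscale W c (f x))"

definition vsum :: "'v vsp \<Rightarrow> 'v list \<Rightarrow> 'v" where
  "vsum V xs = foldr (vadd V) xs (vzero V)"

definition vcoset :: "'v vsp \<Rightarrow> 'v set \<Rightarrow> 'v \<Rightarrow> 'v set" where
  "vcoset V W x = vadd V x ` W"

definition vquot :: "'v vsp \<Rightarrow> 'v set \<Rightarrow> 'v set vsp" where
  "vquot V W = \<lparr>
     vcarrier = vcoset V W ` vcarrier V,
     vadd = (\<lambda>C D. {vadd V x y | x y. x \<in> C \<and> y \<in> D}),
     vscale = (\<lambda>c C. {vadd V (vscale V c x) w | x w. x \<in> C \<and> w \<in> W}),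
     vzero = W\<rparr>"

definition vprod :: "('i \<Rightarrow> 'v vsp) \<Rightarrow> ('i \<Rightarrow> 'v) vsp" where
  "vprod V = \<lparr>
     vcarrier = {x. \<forall>i. x i \<in> vcarrier (V i)},
     vadd = (\<lambda>x y i. vadd (V i) (x i) (y i)),
     vscale = (\<lambda>c x i. vscale (V i) c (x i)),
     vzero = (\<lambda>i. vzero (V i))\<rparr>"

definition tuples :: "nat \<Rightarrow> 'v vsp \<Rightarrow> 'v list set" where
  "tuples k V = {xs. length xs = k \<and> set xs \<subseteq> vcarrier V}"

text \<open>\<open>L(\<Lambda>\<^sup>kV, W)\<close>: a \<open>k\<close>-linear map takes the list of its \<open>k\<close> arguments and is \<open>undefined\<close>
  elsewhere, so that equality of maps is equality of functions.\<close>

definition alt_maps :: "nat \<Rightarrow> 'v vsp \<Rightarrow> 'w vsp \<Rightarrow> ('v list \<Rightarrow> 'w) vsp" where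
  "alt_maps k V W = \<lparr>
     vcarrier = {\<phi> \<in> extensional (tuples k V).
       (\<forall>xs\<in>tuples k V. \<forall>j<k. vlinear V W (\<lambda>x. \<phi> (xs[j := x]))) \<and>
       (\<forall>xs\<in>tuples k V. \<phi> xs \<in> vcarrier W \<and> (\<not> distinct xs \<longrightarrow> \<phi> xs = vzero W))},
     vadd = (\<lambda>\<phi> \<psi>. restrict (\<lambda>xs. vadd W (\<phi> xs) (\<psi> xs)) (tuples k V)),
     vscale = (\<lambda>c \<phi>. restrict (\<lambda>xs. vscale W c (\<phi> xs)) (tuples k V)),
     vzero = restrict (\<lambda>xs. vzero W) (tuples k V)\<rparr>"

definition vcomplementary :: "'v vsp \<Rightarrow> 'v set \<Rightarrow> 'v set \<Rightarrow> bool" where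
  "vcomplementary V A B \<longleftrightarrow> vsubspace V A \<and> vsubspace V B \<and> A \<inter> B = {vzero V} \<and>
     vcarrier V = {vadd V a b | a b. a \<in> A \<and> b \<in> B}"


section \<open>Smooth manifolds\<close>

text \<open>Model spaces are finite-dimensional normed spaces rather than members of class
  \<open>euclidean_space\<close>, as the latter excludes dimension 0 (discrete groups are allowed).\<close>

definition finite_dim :: "'v::real_vector itself \<Rightarrow> bool" where
  "finite_dim _ \<longleftrightarrow> (\<exists>B :: 'v set. finite B \<and> span B = UNIV)"

text \<open>Continuity of all iterated directional derivatives; in finite dimension and on open sets
  this is the usual notion of being \<open>n\<close> times continuously differentiable.\<close>

primrec Ck_on :: "nat \<Rightarrow> 'a::real_normed_vector set \<Rightarrow> ('a \<Rightarrow> 'b::real_normed_vector) \<Rightarrow> bool" where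
  "Ck_on 0 S f \<longleftrightarrow> continuous_on S f"
| "Ck_on (Suc n) S f \<longleftrightarrow> (\<forall>x\<in>S. f differentiable at x) \<and>
     (\<forall>v. Ck_on n S (\<lambda>x. frechet_derivative f (at x) v))"

definition smooth_on :: "'a::real_normed_vector set \<Rightarrow> ('a \<Rightarrow> 'b::real_normed_vector) \<Rightarrow> bool" where
  "smooth_on S f \<longleftrightarrow> (\<forall>n. Ck_on n S f)"

type_synonym ('m, 'e) chart = "'m set \<times> ('m \<Rightarrow> 'e)"

abbreviation cdom :: "('m, 'e) chart \<Rightarrow> 'm set" where "cdom \<equiv> fst"
abbreviation cmap :: "('m, 'e) chart \<Rightarrow> 'm \<Rightarrow> 'e" where "cmap \<equiv> snd"
abbreviation cinv :: "('m, 'e) chart \<Rightarrow> 'e \<Rightarrow> 'm" where "cinv c \<equiv> inv_into (cdom c) (cmap c)"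

definition charts_at :: "('m, 'e) chart set \<Rightarrow> 'm \<Rightarrow> ('m, 'e) chart set" where
  "charts_at A u = {c\<in>A. u \<in> cdom c}"

definition some_chart :: "('m, 'e) chart set \<Rightarrow> 'm \<Rightarrow> ('m, 'e) chart" where
  "some_chart A u = (SOME c. c \<in> charts_at A u)"

definition smooth_manifold ::
  "('m::{t2_space,second_countable_topology}, 'e::real_normed_vector) chart set \<Rightarrow> bool" where
  "smooth_manifold A \<longleftrightarrow> finite_dim TYPE('e) \<and> (\<Union>c\<in>A. cdom c) = UNIV \<and>
     (\<forall>c\<in>A. open (cdom c) \<and> open (cmap c ` cdom c) \<and>
            homeomorphism (cdom c) (cmap c ` cdom c) (cmap c) (cinv c)) \<and>
     (\<forall>c\<in>A. \<forall>d\<in>A. smooth_on (cmap c ` (cdom c \<inter> cdom d)) (cmap d \<circ> cinv c))"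

definition smooth_map_on ::
  "'m::topological_space set \<Rightarrow> ('m, 'e::real_normed_vector) chart set \<Rightarrow>
   ('n::topological_space, 'f::real_normed_vector) chart set \<Rightarrow> ('m \<Rightarrow> 'n) \<Rightarrow> bool" where
  "smooth_map_on S A B f \<longleftrightarrow> continuous_on S f \<and>
     (\<forall>c\<in>A. \<forall>d\<in>B. smooth_on (cmap c ` (S \<inter> cdom c \<inter> f -` cdom d)) (cmap d \<circ> f \<circ> cinv c))"

definition prod_atlas :: "('m, 'e) chart set \<Rightarrow> ('n, 'f) chart set \<Rightarrow> ('m \<times> 'n, 'e \<times> 'f) chart set" where
  "prod_atlas A B = {(cdom c \<times> cdom d, map_prod (cmap c) (cmap d)) | c d. c \<in> A \<and> d \<in> B}"

definition vec_chart :: "('v, 'v) chart" where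
  "vec_chart = (UNIV, id)"

text \<open>A tangent vector at \<open>u\<close> is the family of its coordinate vectors in all charts around \<open>u\<close>,
  subject to the transformation law (and \<open>0\<close> at all other charts).\<close>

type_synonym ('m, 'e) tvec = "('m, 'e) chart \<Rightarrow> 'e"

definition tangent_space ::
  "('m, 'e::real_normed_vector) chart set \<Rightarrow> 'm \<Rightarrow> ('m, 'e) tvec vsp" where
  "tangent_space A u = \<lparr>
     vcarrier = {v. (\<forall>c. c \<notin> charts_at A u \<longrightarrow> v c = 0) \<and>
       (\<forall>c\<in>charts_at A u. \<forall>d\<in>charts_at A u.
          v d = frechet_derivative (cmap d \<circ> cinv c) (at (cmap c u)) (v c))},
     vadd = (\<lambda>v w c. v c + w c),
     vscale = (\<lambda>r v c. r *\<^sub>R v c),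
     vzero = (\<lambda>c. 0)\<rparr>"

definition tvec_of ::
  "('m, 'e::real_normed_vector) chart set \<Rightarrow> 'm \<Rightarrow> ('m, 'e) chart \<Rightarrow> 'e \<Rightarrow> ('m, 'e) tvec" where
  "tvec_of A u c x = (\<lambda>d. if d \<in> charts_at A u
     then frechet_derivative (cmap d \<circ> cinv c) (at (cmap c u)) x else 0)"

definition tangent_map ::
  "('m, 'e::real_normed_vector) chart set \<Rightarrow> ('n, 'f::real_normed_vector) chart set \<Rightarrow>
   ('m \<Rightarrow> 'n) \<Rightarrow> 'm \<Rightarrow> ('m, 'e) tvec \<Rightarrow> ('n, 'f) tvec" where
  "tangent_map A B f u v = (\<lambda>d. if d \<in> charts_at B (f u)
     then frechet_derivative (cmap d \<circ> f \<circ> cinv (some_chart A u)) (at (cmap (some_chart A u) u))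
            (v (some_chart A u))
     else 0)"

definition local_form ::
  "('m, 'e::real_normed_vector) chart set \<Rightarrow> ('m \<Rightarrow> ('m, 'e) tvec \<Rightarrow> 'g) \<Rightarrow>
   ('m, 'e) chart \<Rightarrow> 'e \<Rightarrow> 'e \<Rightarrow> 'g" where
  "local_form A \<omega> c z x = \<omega> (cinv c z) (tvec_of A (cinv c z) c x)"

definition smooth_one_form ::
  "('m, 'e::real_normed_vector) chart set \<Rightarrow> ('m \<Rightarrow> ('m, 'e) tvec \<Rightarrow> 'g::real_normed_vector) \<Rightarrow> bool" where
  "smooth_one_form A \<omega> \<longleftrightarrow> (\<forall>u. vlinear (tangent_space A u) (lin UNIV) (\<omega> u)) \<and>
     (\<forall>c\<in>A. \<forall>x. smooth_on (cmap c ` cdom c) (\<lambda>z. local_form A \<omega> c z x))"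

text \<open>In a chart, \<open>d\<omega>(x, y) = x(\<omega>(y)) - y(\<omega>(x))\<close> for constant vector fields \<open>x, y\<close>
  (no factor 1/2); the result does not depend on the chart.\<close>

definition ext_deriv ::
  "('m, 'e::real_normed_vector) chart set \<Rightarrow> ('m \<Rightarrow> ('m, 'e) tvec \<Rightarrow> 'g::real_normed_vector) \<Rightarrow>
   'm \<Rightarrow> ('m, 'e) tvec \<Rightarrow> ('m, 'e) tvec \<Rightarrow> 'g" where
  "ext_deriv A \<omega> u \<xi> \<eta> = (let c = some_chart A u in
     frechet_derivative (\<lambda>z. local_form A \<omega> c z (\<eta> c)) (at (cmap c u)) (\<xi> c) -
     frechet_derivative (\<lambda>z. local_form A \<omega> c z (\<xi> c)) (at (cmap c u)) (\<eta> c))"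


section \<open>Lie groups\<close>

definition lie_group ::
  "('p::{t2_space,second_countable_topology}) monoid \<Rightarrow> ('p, 'h::real_normed_vector) chart set \<Rightarrow> bool" where
  "lie_group P A \<longleftrightarrow> group P \<and> carrier P = UNIV \<and> smooth_manifold A \<and>
     smooth_map_on UNIV (prod_atlas A A) A (\<lambda>(g, h). g \<otimes>\<^bsub>P\<^esub> h) \<and>
     smooth_map_on UNIV A A (\<lambda>g. m_inv P g)"

text \<open>Chart representation of the left invariant vector field generated by \<open>X \<in> T\<^sub>eP\<close>.\<close>

definition left_field ::
  "'p monoid \<Rightarrow> ('p, 'h::real_normed_vector) chart set \<Rightarrow> ('p, 'h) tvec \<Rightarrow> ('p, 'h) chart \<Rightarrow> 'h \<Rightarrow> 'h" where
  "left_field P A X c z = tangent_map A A (\<lambda>h. cinv c z \<otimes>\<^bsub>P\<^esub> h) \<one>\<^bsub>P\<^esub> X c"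

text \<open>The bracket on \<open>T\<^sub>eP\<close>: the value at \<open>e\<close> of the Lie bracket of left invariant vector fields,
  given in coordinates by \<open>[X, Y] = DY(X) - DX(Y)\<close>.\<close>

definition lie_bracket_at_one ::
  "'p monoid \<Rightarrow> ('p, 'h::real_normed_vector) chart set \<Rightarrow>
   ('p, 'h) tvec \<Rightarrow> ('p, 'h) tvec \<Rightarrow> ('p, 'h) tvec" where
  "lie_bracket_at_one P A X Y = (let c = some_chart A \<one>\<^bsub>P\<^esub>; z = cmap c \<one>\<^bsub>P\<^esub> in
     tvec_of A \<one>\<^bsub>P\<^esub> c
       (frechet_derivative (left_field P A Y c) (at z) (left_field P A X c z) -
        frechet_derivative (left_field P A X c) (at z) (left_field P A Y c z)))"


section \<open>Admissible pairs\<close>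

definition lie_algebra :: "('g::real_normed_vector \<Rightarrow> 'g \<Rightarrow> 'g) \<Rightarrow> bool" where
  "lie_algebra br \<longleftrightarrow> finite_dim TYPE('g) \<and> bilinear br \<and> (\<forall>x. br x x = 0) \<and>
     (\<forall>x y z. br x (br y z) + br y (br z x) + br z (br x y) = 0)"

definition lie_ideal :: "('g::real_vector \<Rightarrow> 'g \<Rightarrow> 'g) \<Rightarrow> 'g set \<Rightarrow> bool" where
  "lie_ideal br I \<longleftrightarrow> subspace I \<and> (\<forall>x. \<forall>y\<in>I. br x y \<in> I)"

text \<open>\<open>\<gg>\<^sup>i\<close> is \<open>filt i\<close>, with \<open>\<mu> = depth\<close> and \<open>\<nu> = height\<close>. The field \<open>lie_id\<close> identifies
  \<open>\<gg>\<^sup>0\<close> with the Lie algebra \<open>T\<^sub>eP\<close> of \<open>P\<close>.\<close>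

record ('g, 'p, 'h) pair =
  br :: "'g \<Rightarrow> 'g \<Rightarrow> 'g"
  filt :: "int \<Rightarrow> 'g set"
  depth :: nat
  height :: nat
  grp :: "'p monoid"
  grp_atlas :: "('p, 'h) chart set"
  lie_id :: "'g \<Rightarrow> ('p, 'h) tvec"
  Ad :: "'p \<Rightarrow> 'g \<Rightarrow> 'g"

definition filtered_lie_algebra :: "('g::real_normed_vector, 'p, 'h) pair \<Rightarrow> bool" where
  "filtered_lie_algebra \<P> \<longleftrightarrow> lie_algebra (br \<P>) \<and>
     (\<forall>i. subspace (filt \<P> i)) \<and> (\<forall>i. filt \<P> (i + 1) \<subseteq> filt \<P> i) \<and>
     (\<forall>i \<le> - int (depth \<P>). filt \<P> i = UNIV) \<and> (\<forall>i > int (height \<P>). filt \<P> i = {0}) \<and>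
     (\<forall>i j. \<forall>x\<in>filt \<P> i. \<forall>y\<in>filt \<P> j. br \<P> x y \<in> filt \<P> (i + j))"

definition Aut_f :: "('g::real_normed_vector, 'p, 'h) pair \<Rightarrow> ('g \<Rightarrow> 'g) set" where
  "Aut_f \<P> = {f. linear f \<and> bij f \<and> (\<forall>x y. f (br \<P> x y) = br \<P> (f x) (f y)) \<and>
     (\<forall>i. f ` filt \<P> i = filt \<P> i)}"

text \<open>Since \<open>\<gg>\<close> is finite dimensional, smoothness of \<open>Ad\<close> into the linear group and its derivative
  are expressed by evaluating at each \<open>X \<in> \<gg>\<close>.\<close>

definition admissible_pair ::
  "('g::real_normed_vector, 'p::{t2_space,second_countable_topology}, 'h::real_normed_vector) pair \<Rightarrow> bool" where
  "admissible_pair \<P> \<longleftrightarrow>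
     filtered_lie_algebra \<P> \<and>
     lie_group (grp \<P>) (grp_atlas \<P>) \<and>
     vlinear (lin (filt \<P> 0)) (tangent_space (grp_atlas \<P>) \<one>\<^bsub>grp \<P>\<^esub>) (lie_id \<P>) \<and>
     bij_betw (lie_id \<P>) (filt \<P> 0) (vcarrier (tangent_space (grp_atlas \<P>) \<one>\<^bsub>grp \<P>\<^esub>)) \<and>
     (\<forall>A\<in>filt \<P> 0. \<forall>B\<in>filt \<P> 0. lie_id \<P> (br \<P> A B) =
        lie_bracket_at_one (grp \<P>) (grp_atlas \<P>) (lie_id \<P> A) (lie_id \<P> B)) \<and>
     (\<forall>g. Ad \<P> g \<in> Aut_f \<P>) \<and>
     (\<forall>g h. Ad \<P> (g \<otimes>\<^bsub>grp \<P>\<^esub> h) = Ad \<P> g \<circ> Ad \<P> h) \<and>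
     (\<forall>X. smooth_map_on UNIV (grp_atlas \<P>) {vec_chart} (\<lambda>g. Ad \<P> g X)) \<and>
     (\<forall>A\<in>filt \<P> 0. \<forall>X. tangent_map (grp_atlas \<P>) {vec_chart} (\<lambda>g. Ad \<P> g X) \<one>\<^bsub>grp \<P>\<^esub>
        (lie_id \<P> A) vec_chart = br \<P> A X) \<and>
     (\<forall>I. lie_ideal (br \<P>) I \<and> I \<subseteq> filt \<P> 0 \<longrightarrow> I = {0}) \<and>
     (\<forall>A\<in>filt \<P> 0. (\<forall>i\<in>{- int (depth \<P>)..-1}. \<forall>X\<in>filt \<P> i. br \<P> A X \<in> filt \<P> (i + 1)) \<longrightarrow>
        A \<in> filt \<P> 1)"


section \<open>The associated graded Lie algebra and its cochains\<close>

definition gr_comp :: "('g::real_normed_vector, 'p, 'h) pair \<Rightarrow> int \<Rightarrow> 'g set vsp" where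
  "gr_comp \<P> i = vquot (lin (filt \<P> i)) (filt \<P> (i + 1))"

text \<open>The components of degree outside \<open>{-\<mu>..\<nu>}\<close> are trivial, so the product over all
  degrees is the direct sum.\<close>

definition gr :: "('g::real_normed_vector, 'p, 'h) pair \<Rightarrow> (int \<Rightarrow> 'g set) vsp" where
  "gr \<P> = vprod (gr_comp \<P>)"

definition gr_class :: "('g::real_normed_vector, 'p, 'h) pair \<Rightarrow> int \<Rightarrow> 'g \<Rightarrow> int \<Rightarrow> 'g set" where
  "gr_class \<P> i X = (vzero (gr \<P>))(i := vcoset (lin (filt \<P> i)) (filt \<P> (i + 1)) X)"

definition gr_homog :: "('g::real_normed_vector, 'p, 'h) pair \<Rightarrow> int \<Rightarrow> (int \<Rightarrow> 'g set) set" where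
  "gr_homog \<P> i = gr_class \<P> i ` filt \<P> i"

text \<open>The bracket of \<open>x\<close> and \<open>y\<close> has degree \<open>n\<close> component \<open>\<Sum>\<^sub>i [x\<^sub>i, y\<^sub>n\<^sub>-\<^sub>i]\<close>, computed by means
  of representatives \<open>a i\<close> of \<open>x\<^sub>i\<close> and \<open>b j\<close> of \<open>y\<^sub>j\<close>.\<close>

definition gr_bracket ::
  "('g::real_normed_vector, 'p, 'h) pair \<Rightarrow> (int \<Rightarrow> 'g set) \<Rightarrow> (int \<Rightarrow> 'g set) \<Rightarrow> int \<Rightarrow> 'g set" where
  "gr_bracket \<P> x y = (\<lambda>n.
     {(\<Sum>i\<in>{- int (depth \<P>)..int (height \<P>)}. br \<P> (a i) (b (n - i))) + w | a b w.
        (\<forall>i. a i \<in> x i) \<and> (\<forall>i. b i \<in> y i) \<and> w \<in> filt \<P> (n + 1)})"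

definition neg_part :: "('g::real_normed_vector, 'p, 'h) pair \<Rightarrow> (int \<Rightarrow> 'g set) vsp" where
  "neg_part \<P> = (gr \<P>)\<lparr>vcarrier := {x \<in> vcarrier (gr \<P>). \<forall>i\<ge>0. x i = vzero (gr_comp \<P> i)}\<rparr>"

definition cochains ::
  "('g::real_normed_vector, 'p, 'h) pair \<Rightarrow> nat \<Rightarrow> ((int \<Rightarrow> 'g set) list \<Rightarrow> int \<Rightarrow> 'g set) vsp" where
  "cochains \<P> k = alt_maps k (neg_part \<P>) (gr \<P>)"

definition cochains_deg ::
  "('g::real_normed_vector, 'p, 'h) pair \<Rightarrow> nat \<Rightarrow> int \<Rightarrow> ((int \<Rightarrow> 'g set) list \<Rightarrow> int \<Rightarrow> 'g set) vsp" where
  "cochains_deg \<P> k l = (cochains \<P> k)\<lparr>vcarrier := {\<phi> \<in> vcarrier (cochains \<P> k).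
     \<forall>is xs. length is = k \<and> length xs = k \<and> (\<forall>j<k. is ! j < 0 \<and> xs ! j \<in> gr_homog \<P> (is ! j)) \<longrightarrow>
       \<phi> xs \<in> gr_homog \<P> (sum_list is + l)}\<rparr>"

definition codiff ::
  "('g::real_normed_vector, 'p, 'h) pair \<Rightarrow> nat \<Rightarrow> ((int \<Rightarrow> 'g set) list \<Rightarrow> int \<Rightarrow> 'g set) \<Rightarrow>
   (int \<Rightarrow> 'g set) list \<Rightarrow> int \<Rightarrow> 'g set" where
  "codiff \<P> k \<phi> = restrict (\<lambda>xs. vadd (gr \<P>)
     (vsum (gr \<P>)
       [vscale (gr \<P>) ((-1) ^ i) (gr_bracket \<P> (xs ! i) (\<phi> (nths xs (- {i})))). i \<leftarrow> [0..<Suc k]])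
     (vsum (gr \<P>)
       [vscale (gr \<P>) ((-1) ^ (i + j)) (\<phi> (gr_bracket \<P> (xs ! i) (xs ! j) # nths xs (- {i, j}))).
          j \<leftarrow> [0..<Suc k], i \<leftarrow> [0..<j]]))
     (tuples (Suc k) (neg_part \<P>))"


section \<open>Filtered multilinear maps, normalization conditions, negligible submodules\<close>

definition gmodp :: "('g::real_normed_vector, 'p, 'h) pair \<Rightarrow> 'g set vsp" where
  "gmodp \<P> = vquot (lin UNIV) (filt \<P> 0)"

definition pcoset :: "('g::real_normed_vector, 'p, 'h) pair \<Rightarrow> 'g \<Rightarrow> 'g set" where
  "pcoset \<P> = vcoset (lin UNIV) (filt \<P> 0)"

definition alt_gp :: "('g::real_normed_vector, 'p, 'h) pair \<Rightarrow> nat \<Rightarrow> ('g set list \<Rightarrow> 'g) vsp" where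
  "alt_gp \<P> k = alt_maps k (gmodp \<P>) (lin UNIV)"

definition alt_gp_ge ::
  "('g::real_normed_vector, 'p, 'h) pair \<Rightarrow> nat \<Rightarrow> int \<Rightarrow> ('g set list \<Rightarrow> 'g) set" where
  "alt_gp_ge \<P> k l = {\<alpha> \<in> vcarrier (alt_gp \<P> k).
     \<forall>is Xs. length is = k \<and> length Xs = k \<and> (\<forall>j<k. is ! j < 0 \<and> Xs ! j \<in> filt \<P> (is ! j)) \<longrightarrow>
       \<alpha> (map (pcoset \<P>) Xs) \<in> filt \<P> (sum_list is + l)}"

definition gr_map ::
  "('g::real_normed_vector, 'p, 'h) pair \<Rightarrow> nat \<Rightarrow> int \<Rightarrow> ('g set list \<Rightarrow> 'g) \<Rightarrow>
   (int \<Rightarrow> 'g set) list \<Rightarrow> int \<Rightarrow> 'g set" where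
  "gr_map \<P> k l \<alpha> = (THE \<phi>. \<phi> \<in> vcarrier (cochains_deg \<P> k l) \<and>
     (\<forall>is Xs. length is = k \<and> length Xs = k \<and> (\<forall>j<k. is ! j < 0 \<and> Xs ! j \<in> filt \<P> (is ! j)) \<longrightarrow>
       \<phi> (map2 (gr_class \<P>) is Xs) = gr_class \<P> (sum_list is + l) (\<alpha> (map (pcoset \<P>) Xs))))"

definition gr_sub ::
  "('g::real_normed_vector, 'p, 'h) pair \<Rightarrow> nat \<Rightarrow> int \<Rightarrow> ('g set list \<Rightarrow> 'g) set \<Rightarrow>
   ((int \<Rightarrow> 'g set) list \<Rightarrow> int \<Rightarrow> 'g set) set" where
  "gr_sub \<P> k l E = gr_map \<P> k l ` (E \<inter> alt_gp_ge \<P> k l)"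

text \<open>\<open>Ad(g\<inverse>)\<close> preserves \<open>\<pp>\<close>, so it acts on \<open>\<gg>/\<pp>\<close> by taking images of cosets.\<close>

definition P_act ::
  "('g::real_normed_vector, 'p, 'h) pair \<Rightarrow> nat \<Rightarrow> 'p \<Rightarrow> ('g set list \<Rightarrow> 'g) \<Rightarrow> 'g set list \<Rightarrow> 'g" where
  "P_act \<P> k g \<alpha> = restrict
     (\<lambda>xs. Ad \<P> g (\<alpha> (map (image (Ad \<P> (m_inv (grp \<P>) g))) xs))) (tuples k (gmodp \<P>))"

definition P_submodule ::
  "('g::real_normed_vector, 'p, 'h) pair \<Rightarrow> nat \<Rightarrow> ('g set list \<Rightarrow> 'g) set \<Rightarrow> bool" where
  "P_submodule \<P> k E \<longleftrightarrow> vsubspace (alt_gp \<P> k) E \<and> (\<forall>g. \<forall>\<alpha>\<in>E. P_act \<P> k g \<alpha> \<in> E)"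

definition normalization_condition ::
  "('g::real_normed_vector, 'p, 'h) pair \<Rightarrow> ('g set list \<Rightarrow> 'g) set \<Rightarrow> bool" where
  "normalization_condition \<P> N \<longleftrightarrow> P_submodule \<P> 2 N \<and>
     (\<forall>l>0. vcomplementary (cochains_deg \<P> 2 l) (gr_sub \<P> 2 l N)
              (codiff \<P> 1 ` vcarrier (cochains_deg \<P> 1 l)))"

definition negligible_submodule ::
  "('g::real_normed_vector, 'p, 'h) pair \<Rightarrow> ('g set list \<Rightarrow> 'g) set \<Rightarrow> ('g set list \<Rightarrow> 'g) set \<Rightarrow> bool" where
  "negligible_submodule \<P> N N' \<longleftrightarrow> P_submodule \<P> 2 N' \<and> N' \<subseteq> N \<and>
     (\<forall>l>0. gr_sub \<P> 2 l N' \<inter>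
        {\<phi> \<in> vcarrier (cochains_deg \<P> 2 l). codiff \<P> 2 \<phi> = vzero (cochains \<P> 3)} =
        {vzero (cochains_deg \<P> 2 l)})"


section \<open>Cartan geometries\<close>

record ('u, 'e, 'm, 'f, 'g, 'p) geometry =
  tot_atlas :: "('u, 'e) chart set"
  base_atlas :: "('m, 'f) chart set"
  proj :: "'u \<Rightarrow> 'm"
  ract :: "'u \<Rightarrow> 'p \<Rightarrow> 'u"
  conn :: "'u \<Rightarrow> ('u, 'e) tvec \<Rightarrow> 'g"

definition principal_bundle ::
  "('p::{t2_space,second_countable_topology}) monoid \<Rightarrow> ('p, 'h::real_normed_vector) chart set \<Rightarrow>
   ('u::{t2_space,second_countable_topology}, 'e::real_normed_vector,
    'm::{t2_space,second_countable_topology}, 'f::real_normed_vector, 'g, 'p) geometry \<Rightarrow> bool" where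
  "principal_bundle P A \<G> \<longleftrightarrow>
     lie_group P A \<and> smooth_manifold (tot_atlas \<G>) \<and> smooth_manifold (base_atlas \<G>) \<and>
     smooth_map_on UNIV (tot_atlas \<G>) (base_atlas \<G>) (proj \<G>) \<and>
     smooth_map_on UNIV (prod_atlas (tot_atlas \<G>) A) (tot_atlas \<G>) (\<lambda>(u, g). ract \<G> u g) \<and>
     (\<forall>u. ract \<G> u \<one>\<^bsub>P\<^esub> = u) \<and>
     (\<forall>u g h. ract \<G> u (g \<otimes>\<^bsub>P\<^esub> h) = ract \<G> (ract \<G> u g) h) \<and>
     (\<forall>u g. proj \<G> (ract \<G> u g) = proj \<G> u) \<and>
     (\<forall>x. \<exists>U \<tau>. open U \<and> x \<in> U \<and>
        bij_betw (\<lambda>u. (proj \<G> u, \<tau> u)) (proj \<G> -` U) (U \<times> UNIV) \<and>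
        smooth_map_on (proj \<G> -` U) (tot_atlas \<G>) A \<tau> \<and>
        smooth_map_on (U \<times> UNIV) (prod_atlas (base_atlas \<G>) A) (tot_atlas \<G>)
          (inv_into (proj \<G> -` U) (\<lambda>u. (proj \<G> u, \<tau> u))) \<and>
        (\<forall>u\<in>proj \<G> -` U. \<forall>g. \<tau> (ract \<G> u g) = \<tau> u \<otimes>\<^bsub>P\<^esub> g))"

definition fundamental_field ::
  "('g, 'p, 'h::real_normed_vector) pair \<Rightarrow> ('u, 'e::real_normed_vector, 'm, 'f, 'g, 'p) geometry \<Rightarrow>
   'g \<Rightarrow> 'u \<Rightarrow> ('u, 'e) tvec" where
  "fundamental_field \<P> \<G> X u =
     tangent_map (grp_atlas \<P>) (tot_atlas \<G>) (\<lambda>g. ract \<G> u g) \<one>\<^bsub>grp \<P>\<^esub> (lie_id \<P> X)"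

definition cartan_geometry ::
  "('g::real_normed_vector, 'p::{t2_space,second_countable_topology}, 'h::real_normed_vector) pair \<Rightarrow>
   ('u::{t2_space,second_countable_topology}, 'e::real_normed_vector,
    'm::{t2_space,second_countable_topology}, 'f::real_normed_vector, 'g, 'p) geometry \<Rightarrow> bool" where
  "cartan_geometry \<P> \<G> \<longleftrightarrow>
     principal_bundle (grp \<P>) (grp_atlas \<P>) \<G> \<and>
     smooth_one_form (tot_atlas \<G>) (conn \<G>) \<and>
     (\<forall>u g. \<forall>\<xi>\<in>vcarrier (tangent_space (tot_atlas \<G>) u).
        conn \<G> (ract \<G> u g) (tangent_map (tot_atlas \<G>) (tot_atlas \<G>) (\<lambda>v. ract \<G> v g) u \<xi>) =
        Ad \<P> (m_inv (grp \<P>) g) (conn \<G> u \<xi>)) \<and>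
     (\<forall>X\<in>filt \<P> 0. \<forall>u. conn \<G> u (fundamental_field \<P> \<G> X u) = X) \<and>
     (\<forall>u. bij_betw (conn \<G> u) (vcarrier (tangent_space (tot_atlas \<G>) u)) UNIV)"

definition curvature ::
  "('g::real_normed_vector, 'p, 'h) pair \<Rightarrow> ('u, 'e::real_normed_vector, 'm, 'f, 'g, 'p) geometry \<Rightarrow>
   'u \<Rightarrow> ('u, 'e) tvec \<Rightarrow> ('u, 'e) tvec \<Rightarrow> 'g" where
  "curvature \<P> \<G> u \<xi> \<eta> =
     ext_deriv (tot_atlas \<G>) (conn \<G>) u \<xi> \<eta> + br \<P> (conn \<G> u \<xi>) (conn \<G> u \<eta>)"

definition regular ::
  "('g::real_normed_vector, 'p, 'h) pair \<Rightarrow> ('u, 'e::real_normed_vector, 'm, 'f, 'g, 'p) geometry \<Rightarrow> bool" where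
  "regular \<P> \<G> \<longleftrightarrow> (\<forall>u i j. \<forall>\<xi>\<in>vcarrier (tangent_space (tot_atlas \<G>) u).
     \<forall>\<eta>\<in>vcarrier (tangent_space (tot_atlas \<G>) u).
       conn \<G> u \<xi> \<in> filt \<P> i \<and> conn \<G> u \<eta> \<in> filt \<P> j \<longrightarrow>
       curvature \<P> \<G> u \<xi> \<eta> \<in> filt \<P> (i + j + 1))"

definition conn_inv ::
  "('u, 'e::real_normed_vector, 'm, 'f, 'g, 'p) geometry \<Rightarrow> 'u \<Rightarrow> 'g \<Rightarrow> ('u, 'e) tvec" where
  "conn_inv \<G> u = inv_into (vcarrier (tangent_space (tot_atlas \<G>) u)) (conn \<G> u)"

text \<open>The choice of representatives \<open>A\<close>, \<open>B\<close> of the two cosets is immaterial, since the curvature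
  is horizontal.\<close>

definition curvature_function ::
  "('g::real_normed_vector, 'p, 'h) pair \<Rightarrow> ('u, 'e::real_normed_vector, 'm, 'f, 'g, 'p) geometry \<Rightarrow>
   'u \<Rightarrow> 'g set list \<Rightarrow> 'g" where
  "curvature_function \<P> \<G> u = restrict
     (\<lambda>xs. curvature \<P> \<G> u (conn_inv \<G> u (SOME A. A \<in> xs ! 0)) (conn_inv \<G> u (SOME B. B \<in> xs ! 1)))
     (tuples 2 (gmodp \<P>))"

definition normal_geometry ::
  "('g::real_normed_vector, 'p, 'h) pair \<Rightarrow> ('g set list \<Rightarrow> 'g) set \<Rightarrow>
   ('u, 'e::real_normed_vector, 'm, 'f, 'g, 'p) geometry \<Rightarrow> bool" where
  "normal_geometry \<P> N \<G> \<longleftrightarrow> (\<forall>u. curvature_function \<P> \<G> u \<in> N)"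

definition ess_target ::
  "('g::real_normed_vector, 'p, 'h) pair \<Rightarrow> ('g set list \<Rightarrow> 'g) set \<Rightarrow> ('g set list \<Rightarrow> 'g) set \<Rightarrow>
   ('g set list \<Rightarrow> 'g) set vsp" where
  "ess_target \<P> N N' = vquot ((alt_gp \<P> 2)\<lparr>vcarrier := N\<rparr>) N'"

definition essential_curvature ::
  "('g::real_normed_vector, 'p, 'h) pair \<Rightarrow> ('g set list \<Rightarrow> 'g) set \<Rightarrow> ('g set list \<Rightarrow> 'g) set \<Rightarrow>
   ('u, 'e::real_normed_vector, 'm, 'f, 'g, 'p) geometry \<Rightarrow> 'u \<Rightarrow> ('g set list \<Rightarrow> 'g) set" where
  "essential_curvature \<P> N N' \<G> u =
     vcoset ((alt_gp \<P> 2)\<lparr>vcarrier := N\<rparr>) N' (curvature_function \<P> \<G> u)"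

end

theory Submission
  imports Defs
begin

text \<open>
  The essential curvature vanishes at \<open>u\<close> exactly if \<open>\<kappa>(u) \<in> N'\<close>, so one direction is clear. For the
  other one, suppose that \<open>\<kappa>\<close> has values in \<open>N'\<close>. It is shown by induction on \<open>l \<ge> 1\<close> that \<open>\<kappa>\<close> has
  homogeneity at least \<open>l\<close> everywhere (\<open>curv_degree\<close>); for \<open>l = 1\<close> this is regularity. Let \<open>\<kappa>\<close> be of
  homogeneity at least \<open>l\<close>. The Bianchi identity expresses the cyclic sum of
  \<open>[A, \<kappa>(B, C)] - \<kappa>([A, B], C)\<close> by the cyclic sums of \<open>\<kappa>(\<kappa>(A, B), C)\<close> and of the derivative of
  \<open>\<kappa>(B, C)\<close> along \<open>\<omega>\<^sup>-\<^sup>1(A)\<close>. For \<open>A\<close>, \<open>B\<close>, \<open>C\<close> of negative degree both are of higher homogeneity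
  (\<open>curv_cocycle\<close>), so \<open>gr\<^sub>l(\<kappa>(u))\<close> is a cocycle (\<open>codiff_graded_map_eq_zero\<close>). It also lies in
  \<open>gr\<^sub>l(N')\<close>, and negligibility of \<open>N'\<close> makes it zero: \<open>\<kappa>\<close> has homogeneity at least \<open>l + 1\<close>
  (\<open>curv_degree_Suc\<close>). For large \<open>l\<close> the only map of homogeneity at least \<open>l\<close> is zero.

  Three facts from differential geometry enter. The exterior derivative does not depend on the chart
  (\<open>ext_deriv_in_chart\<close>), so the curvature near a point may be computed in a single chart. The
  curvature is horizontal (\<open>curvature_vertical\<close>), so \<open>K\<close> vanishes if \<open>\<kappa>\<close> does. The Bianchi identity is
  needed only modulo a subspace in which the curvature components in question take values
  (\<open>bianchi_modulo_subspace\<close>, \<open>curv_bianchi\<close>), which makes its derivative terms disappear. All three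
  rest on the symmetry of second derivatives.

  On the algebraic side, the map \<open>gr\<^sub>l(\<alpha>)\<close> is first shown to exist (\<open>gr_map_eq_graded_map\<close>), and
  computations in the associated graded algebra are carried out on representatives (\<open>lift\<close>).
\<close>

section \<open>Finite-dimensional normed spaces\<close>

text \<open>The vector spaces are of class \<open>real_normed_vector\<close> with a finite spanning set, not of class
  \<open>euclidean_space\<close>, so continuity of linear maps has to be derived. The bound below is proved by
  adjoining one vector at a time: a new vector has positive distance from the span of the old
  ones, as that span is complete by the bound already obtained.\<close>

lemma independent_coefficient_bound:
  fixes B :: "'a::real_normed_vector set"
  assumes "finite B" "independent B"
  shows "\<exists>C\<ge>0. \<forall>c. \<forall>b\<in>B. \<bar>c b\<bar> \<le> C * norm (\<Sum>b\<in>B. c b *\<^sub>R b)"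
  using assms
proof (induction B rule: finite_induct)
  case empty
  show ?case by (intro exI[of _ 0]) auto
next
  case (insert a B)
  have indB: "independent B" and a: "a \<notin> span B"
    using insert.prems insert.hyps by (auto simp: independent_insert)
  obtain C where C: "C \<ge> 0" "\<And>c b. b \<in> B \<Longrightarrow> \<bar>c b\<bar> \<le> C * norm (\<Sum>b\<in>B. c b *\<^sub>R b)"
    using insert.IH[OF indB] by blast
  have "\<exists>d>0. \<forall>c. d \<le> norm (a + (\<Sum>b\<in>B. c b *\<^sub>R b))"
  proof (rule ccontr)
    assume "\<not> ?thesis"
    then have "\<exists>c. norm (a + (\<Sum>b\<in>B. c b *\<^sub>R b)) < inverse (real (Suc n))" for n
      by (meson inverse_positive_iff_positive not_le of_nat_0_less_iff zero_less_Suc)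
    then obtain c where c: "\<And>n. norm (a + (\<Sum>b\<in>B. c n b *\<^sub>R b)) < inverse (real (Suc n))"
      by metis
    define s where "s n = (\<Sum>b\<in>B. c n b *\<^sub>R b)" for n
    have "(\<lambda>n. a + s n) \<longlonglongrightarrow> 0"
      using c unfolding s_def
      by (intro Lim_null_comparison[OF _ LIMSEQ_inverse_real_of_nat]) (auto intro!: always_eventually less_imp_le)
    then have lim: "s \<longlonglongrightarrow> - a"
      using tendsto_add[OF _ tendsto_const[of "- a"], of "\<lambda>n. a + s n" 0] by simp
    have "Cauchy (\<lambda>n. c n b)" if "b \<in> B" for b
    proof (rule metric_CauchyI)
      fix e :: real assume "e > 0"
      then have "e / (C + 1) > 0" using C(1) by simp
      then obtain M where M: "\<And>m n. m \<ge> M \<Longrightarrow> n \<ge> M \<Longrightarrow> dist (s m) (s n) < e / (C + 1)"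
        using metric_CauchyD[OF LIMSEQ_imp_Cauchy[OF lim]] by blast
      show "\<exists>M. \<forall>m\<ge>M. \<forall>n\<ge>M. dist (c m b) (c n b) < e"
      proof (intro exI[of _ M] allI impI)
        fix m n assume mn: "M \<le> m" "M \<le> n"
        have "s m - s n = (\<Sum>b\<in>B. (c m b - c n b) *\<^sub>R b)"
          by (simp add: s_def sum_subtractf scaleR_left_diff_distrib)
        then have "\<bar>c m b - c n b\<bar> \<le> C * norm (s m - s n)"
          using C(2)[OF that, of "\<lambda>b. c m b - c n b"] by simp
        also have "\<dots> \<le> (C + 1) * norm (s m - s n)" by (simp add: mult_right_mono)
        also have "\<dots> < e"
          using M[OF mn] C(1) by (simp add: dist_norm field_simps)
        finally show "dist (c m b) (c n b) < e" by (simp add: dist_real_def)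
      qed
    qed
    then have "\<exists>l. (\<lambda>n. c n b) \<longlonglongrightarrow> l" if "b \<in> B" for b
      using Cauchy_convergent that unfolding convergent_def by blast
    then obtain l where l: "\<And>b. b \<in> B \<Longrightarrow> (\<lambda>n. c n b) \<longlonglongrightarrow> l b" by metis
    have "s \<longlonglongrightarrow> (\<Sum>b\<in>B. l b *\<^sub>R b)"
      unfolding s_def by (intro tendsto_sum tendsto_scaleR l tendsto_const)
    then have "- a = (\<Sum>b\<in>B. l b *\<^sub>R b)" using lim LIMSEQ_unique by blast
    then have "a = - (\<Sum>b\<in>B. l b *\<^sub>R b)" by (metis minus_minus)
    then have "a \<in> span B" by (simp add: span_neg span_sum span_scale span_base)
    with a show False by simp
  qed
  then obtain d where d: "d > 0" "\<And>c. d \<le> norm (a + (\<Sum>b\<in>B. c b *\<^sub>R b))" by blast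
  define D where "D = inverse d + C * (1 + inverse d * norm a)"
  have D0: "D \<ge> 0" using C(1) d(1) by (simp add: D_def)
  have "\<bar>c b\<bar> \<le> D * norm (\<Sum>b\<in>insert a B. c b *\<^sub>R b)" if b: "b \<in> insert a B" for c b
  proof -
    define x where "x = (\<Sum>b\<in>insert a B. c b *\<^sub>R b)"
    have x: "x = c a *\<^sub>R a + (\<Sum>b\<in>B. c b *\<^sub>R b)" using insert.hyps by (simp add: x_def)
    have ca: "\<bar>c a\<bar> \<le> inverse d * norm x"
    proof (cases "c a = 0")
      case False
      have "x = c a *\<^sub>R (a + (\<Sum>b\<in>B. (c b / c a) *\<^sub>R b))"
        using False by (simp add: x scaleR_add_right scaleR_sum_right)
      then have "norm x = \<bar>c a\<bar> * norm (a + (\<Sum>b\<in>B. (c b / c a) *\<^sub>R b))" by (metis norm_scaleR)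
      then have "\<bar>c a\<bar> * d \<le> norm x" using d(2)[of "\<lambda>b. c b / c a"] by (simp add: mult_left_mono)
      then show ?thesis using d(1) by (simp add: field_simps)
    qed (use d in simp)
    show ?thesis
    proof (cases "b = a")
      case True
      have "inverse d * norm x \<le> D * norm x"
        unfolding D_def using C(1) d(1) by (intro mult_right_mono) auto
      with ca True show ?thesis by (simp add: x_def)
    next
      case False
      then have "b \<in> B" using b by simp
      then have "\<bar>c b\<bar> \<le> C * norm (x - c a *\<^sub>R a)" using C(2)[of b c] x by simp
      also have "\<dots> \<le> C * (norm x + \<bar>c a\<bar> * norm a)"
        using C(1) by (intro mult_left_mono) (auto intro: norm_triangle_le_diff)
      also have "\<dots> \<le> C * (norm x + (inverse d * norm x) * norm a)"
        using C(1) ca by (intro mult_left_mono add_left_mono mult_right_mono) auto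
      also have "\<dots> = (C * (1 + inverse d * norm a)) * norm x" by (simp add: algebra_simps)
      also have "\<dots> \<le> D * norm x" unfolding D_def using d(1) by (intro mult_right_mono) auto
      finally show ?thesis by (simp add: x_def)
    qed
  qed
  with D0 show ?case by blast
qed

lemma finite_dim_coordinates:
  assumes "finite_dim TYPE('a::real_normed_vector)"
  obtains B :: "'a::real_normed_vector set" and r :: "'a \<Rightarrow> 'a \<Rightarrow> real"
  where "finite B" "\<And>b. b \<in> B \<Longrightarrow> bounded_linear (r b)" "\<And>x. (\<Sum>b\<in>B. r b x *\<^sub>R b) = x"
proof -
  obtain A :: "'a set" where A: "finite A" "span A = UNIV"
    using assms by (auto simp: finite_dim_def)
  obtain B where B: "B \<subseteq> A" "independent B" "span B = UNIV"
    using maximal_independent_subset[of A] A by (metis span_mono span_span top.extremum_uniqueI)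
  have fin: "finite B" using A B by (auto intro: finite_subset)
  obtain C where C: "C \<ge> 0" "\<And>c b. b \<in> B \<Longrightarrow> \<bar>c b\<bar> \<le> C * norm (\<Sum>b\<in>B. c b *\<^sub>R b)"
    using independent_coefficient_bound[OF fin B(2)] by blast
  define r where "r b x = representation B x b" for b x
  have sum: "(\<Sum>b\<in>B. r b x *\<^sub>R b) = x" for x
    unfolding r_def using sum_representation_eq[OF B(2), of x B] B(3) fin by auto
  have "bounded_linear (r b)" if "b \<in> B" for b
  proof (rule bounded_linear_intro)
    show "r b (x + y) = r b x + r b y" for x y
      using B by (simp add: r_def representation_add)
    show "r b (t *\<^sub>R x) = t *\<^sub>R r b x" for t x
      using B by (simp add: r_def representation_scale)
    show "norm (r b x) \<le> norm x * C" for x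
      using C(2)[OF that, of "\<lambda>b. r b x"] by (simp add: sum mult.commute)
  qed
  then show thesis
    using that[OF fin _ sum] by blast
qed

lemma finite_dim_linear_bounded:
  fixes f :: "'a::real_normed_vector \<Rightarrow> 'b::real_normed_vector"
  assumes "finite_dim TYPE('a)" "linear f"
  shows "bounded_linear f"
proof -
  obtain B :: "'a set" and r where B: "finite B" "\<And>b. b \<in> B \<Longrightarrow> bounded_linear (r b)"
    "\<And>x. (\<Sum>b\<in>B. r b x *\<^sub>R b) = x"
    using finite_dim_coordinates[OF assms(1)] by metis
  have "f = (\<lambda>x. \<Sum>b\<in>B. r b x *\<^sub>R f b)"
  proof
    fix x
    have "f x = f (\<Sum>b\<in>B. r b x *\<^sub>R b)" by (simp add: B(3))
    also have "\<dots> = (\<Sum>b\<in>B. r b x *\<^sub>R f b)"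
      by (simp add: linear_sum[OF assms(2)] linear_scale[OF assms(2)])
    finally show "f x = (\<Sum>b\<in>B. r b x *\<^sub>R f b)" .
  qed
  moreover have "bounded_linear (\<lambda>x. \<Sum>b\<in>B. r b x *\<^sub>R f b)"
    using B(2) by (intro bounded_linear_sum bounded_linear_scaleR_const) auto
  ultimately show ?thesis by simp
qed

lemma finite_dim_subspace_projection:
  fixes S :: "'a::real_normed_vector set"
  assumes "finite_dim TYPE('a)" "subspace S"
  obtains p where "bounded_linear p" "\<And>x. p x \<in> S" "\<And>x. x \<in> S \<Longrightarrow> p x = x"
proof -
  obtain A where A: "A \<subseteq> S" "independent A" "S \<subseteq> span A"
    using maximal_independent_subset[of S] by auto
  have sp: "span A = S" using A assms(2) by (simp add: span_minimal subset_antisym)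
  define p where "p = construct A (\<lambda>x. x :: 'a)"
  have lin: "linear p" unfolding p_def using A(2) by (rule linear_construct)
  have pA: "p b = b" if "b \<in> A" for b using A(2) that by (simp add: p_def construct_basis)
  have pS: "p x = x" if "x \<in> S" for x
    using linear_eq_on_span[OF lin linear_id, of A x] that sp pA by auto
  have "p x \<in> S" for x
    using construct_in_span[OF A(2), of "\<lambda>x. x" x] sp by (simp add: p_def)
  with pS that finite_dim_linear_bounded[OF assms(1) lin] show thesis by blast
qed

lemma has_derivative_in_subspace:
  fixes f :: "'a::real_normed_vector \<Rightarrow> 'b::real_normed_vector"
  assumes "finite_dim TYPE('b)" "subspace S" and f: "(f has_derivative f') (at x)"
    and U: "open U" "x \<in> U" "\<And>y. y \<in> U \<Longrightarrow> f y \<in> S"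
  shows "f' h \<in> S"
proof -
  obtain p where p: "bounded_linear p" "\<And>x. p x \<in> S" "\<And>x. x \<in> S \<Longrightarrow> p x = x"
    using finite_dim_subspace_projection[OF assms(1,2)] by blast
  have "((\<lambda>y. p (f y)) has_derivative (\<lambda>h. p (f' h))) (at x)"
    using p(1) f by (rule bounded_linear.has_derivative)
  then have "(f has_derivative (\<lambda>h. p (f' h))) (at x)"
    using U(1,2) by (rule has_derivative_transform_within_open) (use U(3) p(3) in auto)
  then have "f' = (\<lambda>h. p (f' h))" using has_derivative_unique[OF f] by blast
  then have "f' h = p (f' h)" by (rule fun_cong)
  also have "\<dots> \<in> S" by (rule p(2))
  finally show ?thesis .
qed

text \<open>Product rule for a family of linear maps applied to a moving vector. Because the source is
  finite dimensional, the family only has to be differentiable when evaluated at fixed vectors.\<close>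

lemma has_derivative_linear_family:
  fixes T :: "'c::real_normed_vector \<Rightarrow> 'a::real_normed_vector \<Rightarrow> 'b::real_normed_vector"
  assumes fd: "finite_dim TYPE('a)"
    and U: "open U" "z0 \<in> U" and lin: "\<And>z. z \<in> U \<Longrightarrow> linear (T z)"
    and T: "\<And>x. ((\<lambda>z. T z x) has_derivative (\<lambda>h. T' h x)) (at z0)"
    and y: "(y has_derivative y') (at z0)"
  shows "((\<lambda>z. T z (y z)) has_derivative (\<lambda>h. T' h (y z0) + T z0 (y' h))) (at z0)"
proof -
  obtain B :: "'a set" and r where B: "finite B" "\<And>b. b \<in> B \<Longrightarrow> bounded_linear (r b)"
    "\<And>x. (\<Sum>b\<in>B. r b x *\<^sub>R b) = x"
    using finite_dim_coordinates[OF fd] by metis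
  have T_sum: "T z x = (\<Sum>b\<in>B. r b x *\<^sub>R T z b)" if "z \<in> U" for z x
    using linear_sum[OF lin[OF that], of "\<lambda>b. r b x *\<^sub>R b" B]
    by (simp add: B(3) linear_scale[OF lin[OF that]])
  have T'_sum: "T' h x = (\<Sum>b\<in>B. r b x *\<^sub>R T' h b)" for h x
  proof -
    have "((\<lambda>z. \<Sum>b\<in>B. r b x *\<^sub>R T z b) has_derivative (\<lambda>h. \<Sum>b\<in>B. r b x *\<^sub>R T' h b)) (at z0)"
      by (intro has_derivative_sum has_derivative_scaleR_right T)
    then have "((\<lambda>z. T z x) has_derivative (\<lambda>h. \<Sum>b\<in>B. r b x *\<^sub>R T' h b)) (at z0)"
      using U by (rule has_derivative_transform_within_open) (use T_sum in auto)
    then show ?thesis using has_derivative_unique[OF T] by metis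
  qed
  have ry: "((\<lambda>z. r b (y z)) has_derivative (\<lambda>h. r b (y' h))) (at z0)" if "b \<in> B" for b
    using B(2)[OF that] y by (rule bounded_linear.has_derivative)
  have "((\<lambda>z. \<Sum>b\<in>B. r b (y z) *\<^sub>R T z b) has_derivative
      (\<lambda>h. \<Sum>b\<in>B. r b (y z0) *\<^sub>R T' h b + r b (y' h) *\<^sub>R T z0 b)) (at z0)"
    by (intro has_derivative_sum has_derivative_scaleR ry T)
  then have "((\<lambda>z. T z (y z)) has_derivative
      (\<lambda>h. \<Sum>b\<in>B. r b (y z0) *\<^sub>R T' h b + r b (y' h) *\<^sub>R T z0 b)) (at z0)"
    using U by (rule has_derivative_transform_within_open) (use T_sum in auto)
  then show ?thesis
    by (simp add: T'_sum[of _ "y z0"] T_sum[OF U(2), of "y' _"] sum.distrib)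
qed

text \<open>The map \<open>y(z) = T(z)\<^sup>-\<^sup>1a\<close> is differentiable, with derivative
  \<open>h \<mapsto> - T(z0)\<^sup>-\<^sup>1(T'(h) y(z0))\<close>; no continuity of \<open>y\<close> is presupposed.\<close>

lemma has_derivative_inverse_family:
  fixes T :: "'c::real_normed_vector \<Rightarrow> 'a::real_normed_vector \<Rightarrow> 'b::real_normed_vector"
  assumes fd: "finite_dim TYPE('a)" and fd': "finite_dim TYPE('b)"
    and U: "open U" "z0 \<in> U" and lin: "\<And>z. z \<in> U \<Longrightarrow> linear (T z)" and bij: "bij (T z0)"
    and T: "\<And>x. ((\<lambda>z. T z x) has_derivative (\<lambda>h. T' h x)) (at z0)"
    and y: "\<And>z. z \<in> U \<Longrightarrow> T z (y z) = a"
  obtains y' where "(y has_derivative y') (at z0)" "\<And>h. T z0 (y' h) = - T' h (y z0)"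
proof -
  obtain B :: "'a set" and r where B: "finite B" "\<And>b. b \<in> B \<Longrightarrow> bounded_linear (r b)"
    "\<And>x. (\<Sum>b\<in>B. r b x *\<^sub>R b) = x"
    using finite_dim_coordinates[OF fd] by metis
  have T_sum: "T z x = (\<Sum>b\<in>B. r b x *\<^sub>R T z b)" if "z \<in> U" for z x
    using linear_sum[OF lin[OF that], of "\<lambda>b. r b x *\<^sub>R b" B]
    by (simp add: B(3) linear_scale[OF lin[OF that]])
  obtain S where S: "linear S" "S \<circ> T z0 = id"
    using linear_injective_left_inverse[OF lin[OF U(2)] bij_is_inj[OF bij]] by blast
  have S_bl: "bounded_linear S" by (rule finite_dim_linear_bounded[OF fd' S(1)])
  have ST: "S (T z0 x) = x" for x using S(2) by (metis comp_apply id_apply)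
  \<comment> \<open>\<open>e(z)\<close> dominates the operator norm of \<open>S(T(z) - T(z0))\<close> and tends to \<open>0\<close> as \<open>z\<close>
    tends to \<open>z0\<close>, since \<open>z \<mapsto> T z b\<close> is continuous at \<open>z0\<close> for each basis vector \<open>b\<close>.\<close>
  define e where "e z = (\<Sum>b\<in>B. onorm (r b) * norm (S (T z b - T z0 b)))" for z
  have e_bound: "norm (S (T z x - T z0 x)) \<le> e z * norm x" if "z \<in> U" for z x
  proof -
    have "T z x - T z0 x = (\<Sum>b\<in>B. r b x *\<^sub>R (T z b - T z0 b))"
      by (simp add: T_sum[OF that, of x] T_sum[OF U(2), of x] sum_subtractf scaleR_right_diff_distrib)
    then have "S (T z x - T z0 x) = (\<Sum>b\<in>B. r b x *\<^sub>R S (T z b - T z0 b))"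
      by (simp add: linear_sum[OF S(1)] linear_scale[OF S(1)])
    also have "norm \<dots> \<le> (\<Sum>b\<in>B. norm (r b x *\<^sub>R S (T z b - T z0 b)))" by (rule norm_sum)
    also have "\<dots> \<le> (\<Sum>b\<in>B. onorm (r b) * norm (S (T z b - T z0 b)) * norm x)"
    proof (rule sum_mono)
      fix b assume "b \<in> B"
      then have "norm (r b x) \<le> onorm (r b) * norm x" using onorm[OF B(2)] by blast
      then show "norm (r b x *\<^sub>R S (T z b - T z0 b)) \<le> onorm (r b) * norm (S (T z b - T z0 b)) * norm x"
        using mult_right_mono[of "norm (r b x)" "onorm (r b) * norm x" "norm (S (T z b - T z0 b))"]
        by (simp add: mult.assoc mult.commute mult.left_commute)
    qed
    finally show ?thesis by (simp add: e_def sum_distrib_right)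
  qed
  have T_cont: "((\<lambda>z. T z x) \<longlongrightarrow> T z0 x) (at z0)" for x
    using has_derivative_continuous[OF T] by (simp add: continuous_at)
  have "(e \<longlongrightarrow> (\<Sum>b\<in>B. onorm (r b) * norm (S (T z0 b - T z0 b)))) (at z0)"
    unfolding e_def
    by (intro tendsto_intros T_cont bounded_linear.tendsto[OF S_bl])
  then have e0: "(e \<longlongrightarrow> 0) (at z0)" by (simp add: linear_0[OF S(1)])
  have key: "y z - y z0 = - S (T z (y z0) - T z0 (y z0)) - S (T z (y z - y z0) - T z0 (y z - y z0))"
    if "z \<in> U" for z
  proof -
    have "- (T z (y z0) - T z0 (y z0)) - (T z (y z - y z0) - T z0 (y z - y z0)) = T z0 (y z - y z0)"
      using y[OF that] y[OF U(2)] by (simp add: linear_diff[OF lin[OF that]])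
    then have "S (- (T z (y z0) - T z0 (y z0)) - (T z (y z - y z0) - T z0 (y z - y z0))) = y z - y z0"
      by (simp add: ST)
    then show ?thesis by (simp only: linear_diff[OF S(1)] linear_neg[OF S(1)])
  qed
  define D where "D z = norm (S (T z (y z0) - T z0 (y z0)))" for z
  have small: "\<forall>\<^sub>F z in at z0. z \<in> U \<and> e z < 1/2"
    using eventually_conj[OF eventually_at_in_open'[OF U] order_tendstoD(2)[OF e0, of "1/2"]] by simp
  have yD: "norm (y z - y z0) \<le> 2 * D z" if "z \<in> U" "e z < 1/2" for z
  proof -
    have "norm (y z - y z0) \<le> D z + e z * norm (y z - y z0)"
      using norm_triangle_ineq4[of "- S (T z (y z0) - T z0 (y z0))"
          "S (T z (y z - y z0) - T z0 (y z - y z0))"]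
        key[OF that(1)] e_bound[OF that(1), of "y z - y z0"] by (simp add: D_def)
    moreover have "e z * norm (y z - y z0) \<le> 1/2 * norm (y z - y z0)"
      using that(2) by (intro mult_right_mono) auto
    ultimately show ?thesis by simp
  qed
  define T1 where "T1 h = S (T' h (y z0))" for h
  have T1: "((\<lambda>z. S (T z (y z0))) has_derivative T1) (at z0)"
    unfolding T1_def using S_bl T by (rule bounded_linear.has_derivative)
  then have T1_bl: "bounded_linear T1" by (rule has_derivative_bounded_linear)
  define R where "R z = norm (S (T z (y z0)) - S (T z0 (y z0)) - T1 (z - z0)) / norm (z - z0)" for z
  have R0: "(R \<longlongrightarrow> 0) (at z0)"
    using T1 unfolding R_def by (simp add: has_derivative_iff_norm)
  have "(y has_derivative (\<lambda>h. - T1 h)) (at z0)"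
    unfolding has_derivative_iff_norm
  proof
    show "bounded_linear (\<lambda>h. - T1 h)" using T1_bl by (rule bounded_linear_minus)
    let ?F = "\<lambda>z. R z + e z * (2 * (R z + onorm T1))"
    show "((\<lambda>z. norm (y z - y z0 - - T1 (z - z0)) / norm (z - z0)) \<longlongrightarrow> 0) (at z0)"
    proof (rule Lim_null_comparison)
      have "(?F \<longlongrightarrow> 0 + 0 * (2 * (0 + onorm T1))) (at z0)"
        by (intro tendsto_intros R0 e0)
      then show "(?F \<longlongrightarrow> 0) (at z0)" by simp
      have "\<forall>\<^sub>F z in at z0. z \<noteq> z0" by (simp add: eventually_at_filter)
      with small show "\<forall>\<^sub>F z in at z0. norm (norm (y z - y z0 - - T1 (z - z0)) / norm (z - z0)) \<le> ?F z"
      proof eventually_elim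
        case (elim z)
        then have z: "z \<in> U" "e z < 1/2" and n: "norm (z - z0) > 0" by auto
        have SD: "S (T z (y z0) - T z0 (y z0)) = S (T z (y z0)) - S (T z0 (y z0))"
          by (rule linear_diff[OF S(1)])
        have Rn: "norm (S (T z (y z0)) - S (T z0 (y z0)) - T1 (z - z0)) = R z * norm (z - z0)"
          using n by (simp add: R_def)
        have "D z \<le> R z * norm (z - z0) + onorm T1 * norm (z - z0)"
          unfolding D_def SD using Rn onorm[OF T1_bl, of "z - z0"]
            norm_triangle_sub[of "S (T z (y z0)) - S (T z0 (y z0))" "T1 (z - z0)"] by linarith
        then have "norm (y z - y z0) \<le> 2 * (R z + onorm T1) * norm (z - z0)"
          using yD[OF z] by (simp add: algebra_simps)
        moreover have "e z \<ge> 0"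
          unfolding e_def by (intro sum_nonneg mult_nonneg_nonneg onorm_pos_le B(2)) auto
        ultimately have 1: "e z * norm (y z - y z0) \<le> e z * (2 * (R z + onorm T1) * norm (z - z0))"
          by (intro mult_left_mono)
        have "y z - y z0 - - T1 (z - z0) = - (S (T z (y z0)) - S (T z0 (y z0)) - T1 (z - z0)) -
            S (T z (y z - y z0) - T z0 (y z - y z0))"
          by (subst key[OF z(1)]) (simp add: SD)
        then have "norm (y z - y z0 - - T1 (z - z0)) \<le> R z * norm (z - z0) + e z * norm (y z - y z0)"
          using Rn e_bound[OF z(1), of "y z - y z0"]
            norm_triangle_ineq4[of "- (S (T z (y z0)) - S (T z0 (y z0)) - T1 (z - z0))"
              "S (T z (y z - y z0) - T z0 (y z - y z0))"] by (simp only: norm_minus_cancel)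
        also have "\<dots> \<le> ?F z * norm (z - z0)" using 1 by (simp add: algebra_simps)
        finally show ?case using n by (simp add: field_simps)
      qed
    qed
  qed
  moreover have "T z0 (- T1 h) = - T' h (y z0)" for h
  proof -
    obtain x where "T' h (y z0) = T z0 x" using bij by (metis bij_pointE)
    then show ?thesis by (simp add: T1_def ST linear_neg[OF lin[OF U(2)]])
  qed
  ultimately show thesis by (rule that)
qed

section \<open>Symmetry of second derivatives\<close>

text \<open>The second difference is \<open>t\<^sup>2 D w + o(t\<^sup>2)\<close>, where \<open>D\<close> is the derivative of \<open>x \<mapsto> f'(x)v\<close>. As it
  is symmetric in \<open>v\<close> and \<open>w\<close>, so is the second derivative. The estimate is the mean value inequality
  for \<open>s \<mapsto> f(z + sv + tw) - f(z + sv) - s t D w\<close> on \<open>{0..t}\<close>.\<close>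

lemma second_difference_bound:
  fixes f :: "'a::real_normed_vector \<Rightarrow> 'b::real_normed_vector"
  assumes U: "open U" "z \<in> U" and f: "\<And>x. x \<in> U \<Longrightarrow> (f has_derivative f' x) (at x)"
    and D: "((\<lambda>x. f' x v) has_derivative D) (at z)" and e: "e > 0"
  shows "\<exists>d>0. \<forall>t. 0 < t \<and> t < d \<longrightarrow>
    norm (f (z + t *\<^sub>R v + t *\<^sub>R w) - f (z + t *\<^sub>R w) - f (z + t *\<^sub>R v) + f z - t\<^sup>2 *\<^sub>R D w) \<le> e * t\<^sup>2"
proof -
  define M where "M = norm v + norm w + 1"
  have M: "M > 0" by (simp add: M_def add_nonneg_pos)
  have linD: "linear D" using D by (rule has_derivative_linear)
  define e' where "e' = e / (2 * M)"
  have "e' > 0" using e M by (simp add: e'_def)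
  then obtain d1 where d1: "d1 > 0"
    "\<And>y. norm (y - z) < d1 \<Longrightarrow> norm (f' y v - f' z v - D (y - z)) \<le> e' * norm (y - z)"
    using D unfolding has_derivative_at_alt by blast
  obtain d2 where d2: "d2 > 0" "ball z d2 \<subseteq> U" using U open_contains_ball by blast
  define d where "d = min d1 d2 / M"
  have "norm (f (z + t *\<^sub>R v + t *\<^sub>R w) - f (z + t *\<^sub>R w) - f (z + t *\<^sub>R v) + f z - t\<^sup>2 *\<^sub>R D w) \<le> e * t\<^sup>2"
    if t: "0 < t" "t < d" for t
  proof -
    have tM: "t * M < d1" "t * M < d2" using t M by (auto simp: d_def field_simps)
    have small: "norm (s *\<^sub>R v + r *\<^sub>R w) \<le> t * M" if "s \<in> {0..t}" "r \<in> {0..t}" for s r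
    proof -
      have "norm (s *\<^sub>R v + r *\<^sub>R w) \<le> s * norm v + r * norm w"
        using that norm_triangle_ineq[of "s *\<^sub>R v" "r *\<^sub>R w"] by simp
      also have "\<dots> \<le> t * norm v + t * norm w"
        using that by (intro add_mono mult_right_mono) auto
      also have "\<dots> \<le> t * M" using t by (simp add: M_def algebra_simps)
      finally show ?thesis .
    qed
    have inU: "z + s *\<^sub>R v + r *\<^sub>R w \<in> U" if "s \<in> {0..t}" "r \<in> {0..t}" for s r
    proof -
      have "norm (z - (z + s *\<^sub>R v + r *\<^sub>R w)) = norm (s *\<^sub>R v + r *\<^sub>R w)"
        using norm_minus_commute[of z "z + s *\<^sub>R v + r *\<^sub>R w"] by (simp add: add.assoc)
      then show ?thesis
        using small[OF that] tM d2(2) by (auto simp: dist_norm subset_eq)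
    qed
    have est: "norm (f' (z + s *\<^sub>R v + r *\<^sub>R w) v - f' z v - D (s *\<^sub>R v + r *\<^sub>R w)) \<le> e' * (t * M)"
      if "s \<in> {0..t}" "r \<in> {0..t}" for s r
    proof -
      have "norm (f' (z + s *\<^sub>R v + r *\<^sub>R w) v - f' z v - D (s *\<^sub>R v + r *\<^sub>R w)) \<le> e' * norm (s *\<^sub>R v + r *\<^sub>R w)"
        using d1(2)[of "z + s *\<^sub>R v + r *\<^sub>R w"] small[OF that] tM by (simp add: add.assoc)
      also have "\<dots> \<le> e' * (t * M)" using small[OF that] \<open>e' > 0\<close> by (intro mult_left_mono) auto
      finally show ?thesis .
    qed
    define g where "g s = f (z + s *\<^sub>R v + t *\<^sub>R w) - f (z + s *\<^sub>R v) - (s * t) *\<^sub>R D w" for s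
    define g' where "g' s = f' (z + s *\<^sub>R v + t *\<^sub>R w) v - f' (z + s *\<^sub>R v) v - t *\<^sub>R D w" for s
    have path: "((\<lambda>s. f (z + s *\<^sub>R v + r *\<^sub>R w)) has_derivative (\<lambda>h. h *\<^sub>R f' (z + s *\<^sub>R v + r *\<^sub>R w) v)) (at s within {0..t})"
      if "s \<in> {0..t}" "r \<in> {0..t}" for s r
    proof -
      have "((\<lambda>s. z + s *\<^sub>R v + r *\<^sub>R w) has_derivative (\<lambda>h. h *\<^sub>R v)) (at s within {0..t})"
        by (auto intro!: derivative_eq_intros)
      from has_derivative_compose[OF this f[OF inU[OF that]]]
      show ?thesis
        using has_derivative_linear[OF f[OF inU[OF that]]] by (simp add: linear_scale)
    qed
    have "(g has_derivative (\<lambda>h. h *\<^sub>R g' s)) (at s within {0..t})" if "s \<in> {0..t}" for s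
      unfolding g_def g'_def using path[OF that, of t] path[OF that, of 0] t
      by (auto intro!: derivative_eq_intros simp: algebra_simps)
    moreover have "onorm (\<lambda>h. h *\<^sub>R g' s) \<le> 2 * (e' * (t * M))" if s: "s \<in> {0..t}" for s
    proof (rule onorm_le)
      have "g' s = (f' (z + s *\<^sub>R v + t *\<^sub>R w) v - f' z v - D (s *\<^sub>R v + t *\<^sub>R w)) -
          (f' (z + s *\<^sub>R v + 0 *\<^sub>R w) v - f' z v - D (s *\<^sub>R v + 0 *\<^sub>R w))"
        by (simp add: g'_def linear_add[OF linD] linear_scale[OF linD])
      then have "norm (g' s) \<le> 2 * (e' * (t * M))"
        using est[OF s, of t] est[OF s, of 0] t
        by (smt (verit, best) atLeastAtMost_iff norm_triangle_ineq4)
      then show "norm (h *\<^sub>R g' s) \<le> 2 * (e' * (t * M)) * norm h" for h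
        using mult_left_mono[of "norm (g' s)" "2 * (e' * (t * M))" "\<bar>h\<bar>"] by (simp add: mult.commute)
    qed
    ultimately have "norm (g t - g 0) \<le> 2 * (e' * (t * M)) * norm (t - 0)"
      using t by (intro differentiable_bound[where S = "{0..t}" and f' = "\<lambda>s h. h *\<^sub>R g' s"]) auto
    also have "\<dots> = e * t\<^sup>2" using t M by (simp add: e'_def power2_eq_square)
    also have "g t - g 0 = f (z + t *\<^sub>R v + t *\<^sub>R w) - f (z + t *\<^sub>R w) - f (z + t *\<^sub>R v) + f z - t\<^sup>2 *\<^sub>R D w"
      by (simp add: g_def power2_eq_square algebra_simps)
    finally show ?thesis .
  qed
  moreover have "d > 0" using d1 d2 M by (simp add: d_def)
  ultimately show ?thesis by blast
qed

lemma symmetric_second_derivative: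
  fixes f :: "'a::real_normed_vector \<Rightarrow> 'b::real_normed_vector"
  assumes U: "open U" "z \<in> U" and f: "\<And>x. x \<in> U \<Longrightarrow> (f has_derivative f' x) (at x)"
    and D: "((\<lambda>x. f' x v) has_derivative D) (at z)" and E: "((\<lambda>x. f' x w) has_derivative E) (at z)"
  shows "D w = E v"
proof -
  have "norm (D w - E v) \<le> e" if "e > 0" for e
  proof -
    from that have e: "e / 2 > 0" by simp
    obtain d1 where d1: "d1 > 0" "\<And>t. 0 < t \<Longrightarrow> t < d1 \<Longrightarrow>
      norm (f (z + t *\<^sub>R v + t *\<^sub>R w) - f (z + t *\<^sub>R w) - f (z + t *\<^sub>R v) + f z - t\<^sup>2 *\<^sub>R D w) \<le> e / 2 * t\<^sup>2"
      using second_difference_bound[OF U f D e, of w] by blast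
    obtain d2 where d2: "d2 > 0" "\<And>t. 0 < t \<Longrightarrow> t < d2 \<Longrightarrow>
      norm (f (z + t *\<^sub>R w + t *\<^sub>R v) - f (z + t *\<^sub>R v) - f (z + t *\<^sub>R w) + f z - t\<^sup>2 *\<^sub>R E v) \<le> e / 2 * t\<^sup>2"
      using second_difference_bound[OF U f E e, of v] by blast
    define t where "t = min d1 d2 / 2"
    have t: "0 < t" "t < d1" "t < d2" using d1(1) d2(1) by (auto simp: t_def)
    define A where "A = f (z + t *\<^sub>R v + t *\<^sub>R w) - f (z + t *\<^sub>R w) - f (z + t *\<^sub>R v) + f z"
    have A_swap: "A = f (z + t *\<^sub>R w + t *\<^sub>R v) - f (z + t *\<^sub>R v) - f (z + t *\<^sub>R w) + f z"
      by (simp add: A_def add_ac)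
    then have 1: "norm (A - t\<^sup>2 *\<^sub>R D w) \<le> e / 2 * t\<^sup>2" "norm (A - t\<^sup>2 *\<^sub>R E v) \<le> e / 2 * t\<^sup>2"
      using d1(2)[OF t(1,2)] d2(2)[OF t(1,3)] unfolding A_def[symmetric] A_swap[symmetric] by auto
    have "t\<^sup>2 * norm (D w - E v) = norm (t\<^sup>2 *\<^sub>R (D w - E v))" by simp
    also have "\<dots> = norm ((A - t\<^sup>2 *\<^sub>R E v) - (A - t\<^sup>2 *\<^sub>R D w))" by (simp add: scaleR_diff_right)
    also have "\<dots> \<le> e * t\<^sup>2" using 1 norm_triangle_ineq4[of "A - t\<^sup>2 *\<^sub>R E v" "A - t\<^sup>2 *\<^sub>R D w"] by simp
    finally show ?thesis using t by (simp add: mult.commute)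
  qed
  then show ?thesis using field_le_epsilon[of "norm (D w - E v)" 0] by auto
qed

section \<open>One-forms with values in a Lie algebra\<close>

text \<open>A one-form on an open subset of a normed space is given by \<open>W z x\<close>, its value at the point \<open>z\<close> on
  the vector \<open>x\<close>. The exterior derivative is evaluated on constant vector fields.\<close>

definition exterior_derivative ::
  "('e::real_normed_vector \<Rightarrow> 'e \<Rightarrow> 'g::real_normed_vector) \<Rightarrow> 'e \<Rightarrow> 'e \<Rightarrow> 'e \<Rightarrow> 'g" where
  "exterior_derivative W z x y =
     frechet_derivative (\<lambda>z. W z y) (at z) x - frechet_derivative (\<lambda>z. W z x) (at z) y"

lemma exterior_derivative_eq:
  assumes "\<And>x. ((\<lambda>z. W z x) has_derivative (\<lambda>h. W' h x)) (at z)"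
  shows "exterior_derivative W z x y = W' x y - W' y x"
  by (simp add: exterior_derivative_def frechet_derivative_at[OF assms, symmetric])

lemma derivative_linear_family_linear:
  fixes W :: "'e::real_normed_vector \<Rightarrow> 'a::real_vector \<Rightarrow> 'g::real_normed_vector"
  assumes U: "open U" "z0 \<in> U" and lin: "\<And>z. z \<in> U \<Longrightarrow> linear (W z)"
    and W: "\<And>x. ((\<lambda>z. W z x) has_derivative (\<lambda>h. W' h x)) (at z0)"
  shows "linear (W' h)"
proof (rule linearI)
  fix x y :: 'a and r :: real
  have "((\<lambda>z. W z x + W z y) has_derivative (\<lambda>h. W' h x + W' h y)) (at z0)"
    by (intro has_derivative_add W)
  then have "((\<lambda>z. W z (x + y)) has_derivative (\<lambda>h. W' h x + W' h y)) (at z0)"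
    using U by (rule has_derivative_transform_within_open) (simp add: linear_add[OF lin])
  from has_derivative_unique[OF W this] show "W' h (x + y) = W' h x + W' h y" by (rule fun_cong)
  have "((\<lambda>z. r *\<^sub>R W z x) has_derivative (\<lambda>h. r *\<^sub>R W' h x)) (at z0)"
    by (intro has_derivative_scaleR_right W)
  then have "((\<lambda>z. W z (r *\<^sub>R x)) has_derivative (\<lambda>h. r *\<^sub>R W' h x)) (at z0)"
    using U by (rule has_derivative_transform_within_open) (simp add: linear_scale[OF lin])
  from has_derivative_unique[OF W this] show "W' h (r *\<^sub>R x) = r *\<^sub>R W' h x" by (rule fun_cong)
qed

lemma exterior_derivative_pullback:
  fixes \<phi> :: "'d::real_normed_vector \<Rightarrow> 'e::real_normed_vector"
    and W' :: "'e \<Rightarrow> 'e \<Rightarrow> 'g::real_normed_vector"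
  assumes fd: "finite_dim TYPE('e)"
    and U: "open U" "z0 \<in> U" and V: "open V" "\<phi> z0 \<in> V"
    and \<phi>: "\<And>z. z \<in> U \<Longrightarrow> (\<phi> has_derivative D\<phi> z) (at z)"
    and D\<phi>: "\<And>x. ((\<lambda>z. D\<phi> z x) has_derivative D2 x) (at z0)"
    and lin: "\<And>z. z \<in> V \<Longrightarrow> linear (W' z)"
    and W': "\<And>x. ((\<lambda>z. W' z x) has_derivative (\<lambda>h. DW' h x)) (at (\<phi> z0))"
    and eq: "\<And>z x. z \<in> U \<Longrightarrow> W z x = W' (\<phi> z) (D\<phi> z x)"
  shows "exterior_derivative W z0 x y = exterior_derivative W' (\<phi> z0) (D\<phi> z0 x) (D\<phi> z0 y)"
proof -
  have sym: "D2 x y = D2 y x" for x y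
    using symmetric_second_derivative[OF U \<phi> D\<phi> D\<phi>] by blast
  define U' where "U' = U \<inter> \<phi> -` V"
  have "continuous_on U \<phi>"
    using \<phi> by (meson continuous_at_imp_continuous_on has_derivative_continuous)
  then have U': "open U'" "z0 \<in> U'"
    using continuous_open_preimage[OF _ U(1) V(1)] U V by (auto simp: U'_def)
  have W: "((\<lambda>z. W z x) has_derivative (\<lambda>h. DW' (D\<phi> z0 h) (D\<phi> z0 x) + W' (\<phi> z0) (D2 x h))) (at z0)" for x
  proof -
    have "((\<lambda>z. W' (\<phi> z) (D\<phi> z x)) has_derivative
        (\<lambda>h. DW' (D\<phi> z0 h) (D\<phi> z0 x) + W' (\<phi> z0) (D2 x h))) (at z0)"
    proof (rule has_derivative_linear_family[OF fd U'])
      show "linear (W' (\<phi> z))" if "z \<in> U'" for z using that lin by (simp add: U'_def)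
      show "((\<lambda>z. W' (\<phi> z) v) has_derivative (\<lambda>h. DW' (D\<phi> z0 h) v)) (at z0)" for v
        using has_derivative_compose[OF \<phi>[OF U(2)] W'] .
    qed (rule D\<phi>)
    then show ?thesis
      using U by (rule has_derivative_transform_within_open) (simp add: eq)
  qed
  show ?thesis
    by (simp add: exterior_derivative_eq[OF W] exterior_derivative_eq[OF W'] sym[of x y])
qed

lemma lie_algebra_anti:
  assumes "lie_algebra lb" shows "lb x y = - lb y x"
proof -
  have bil: "bilinear lb" and alt: "\<And>x. lb x x = 0" using assms by (auto simp: lie_algebra_def)
  have "lb (x + y) (x + y) = lb x x + lb y x + (lb x y + lb y y)"
    by (simp only: bilinear_ladd[OF bil] bilinear_radd[OF bil])
  then have "lb x y + lb y x = 0" by (simp add: alt add.commute)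
  then show ?thesis by (simp only: eq_neg_iff_add_eq_0)
qed

text \<open>The curvature \<open>dW(x, y) + [W(x), W(y)]\<close> of a one-form with values in a Lie algebra with
  bracket \<open>lb\<close>.\<close>

definition local_curvature ::
  "('g \<Rightarrow> 'g \<Rightarrow> 'g) \<Rightarrow> ('e::real_normed_vector \<Rightarrow> 'e \<Rightarrow> 'g::real_normed_vector) \<Rightarrow> 'e \<Rightarrow> 'e \<Rightarrow> 'e \<Rightarrow> 'g" where
  "local_curvature lb W z x y = exterior_derivative W z x y + lb (W z x) (W z y)"

lemma local_curvature_anti:
  assumes "lie_algebra lb"
  shows "local_curvature lb W z x y = - local_curvature lb W z y x"
  using lie_algebra_anti[OF assms, of "W z x"] by (simp add: local_curvature_def exterior_derivative_def)

lemma local_curvature_linear: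
  assumes lie: "lie_algebra lb" and U: "open U" "z \<in> U" and lin: "\<And>y. y \<in> U \<Longrightarrow> linear (W y)"
    and W: "\<And>x. ((\<lambda>y. W y x) has_derivative (\<lambda>h. W' h x)) (at z)"
  shows "linear (local_curvature lb W z x)"
proof -
  have linW': "linear (W' h)" for h by (rule derivative_linear_family_linear[OF U lin W])
  have linW'1: "linear (\<lambda>h. W' h x)" for x using has_derivative_linear[OF W] .
  have lin2: "linear (lb A)" for A using lie by (auto simp: lie_algebra_def bilinear_def)
  show ?thesis
    by (rule linearI)
      (simp_all add: local_curvature_def exterior_derivative_eq[OF W] linear_add[OF linW']
        linear_add[OF linW'1] linear_add[OF lin[OF U(2)]] linear_add[OF lin2] linear_scale[OF linW']
        linear_scale[OF linW'1] linear_scale[OF lin[OF U(2)]] linear_scale[OF lin2] algebra_simps)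
qed

lemma linear_inv_into:
  fixes f :: "'a::real_vector \<Rightarrow> 'b::real_vector"
  assumes lin: "linear f" and bij: "bij f"
  shows "linear (inv_into UNIV f)"
proof (rule linearI)
  have f_inv: "f (inv_into UNIV f b) = b" for b using bij by (simp add: bij_is_surj surj_f_inv_f)
  have inv_f: "inv_into UNIV f (f a) = a" for a using bij by (simp add: bij_is_inj)
  show "inv_into UNIV f (a + b) = inv_into UNIV f a + inv_into UNIV f b" for a b
    using inv_f[of "inv_into UNIV f a + inv_into UNIV f b"] by (simp add: linear_add[OF lin] f_inv)
  show "inv_into UNIV f (r *\<^sub>R a) = r *\<^sub>R inv_into UNIV f a" for r a
    using inv_f[of "r *\<^sub>R inv_into UNIV f a"] by (simp add: linear_scale[OF lin] f_inv)
qed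

text \<open>
  The Bianchi identity for an absolute parallelism \<open>W\<close>, with \<open>\<kappa> z A B\<close> the curvature evaluated on
  the \<open>W\<close>-constant vector fields \<open>z \<mapsto> W(z)\<^sup>-\<^sup>1A\<close> and \<open>z \<mapsto> W(z)\<^sup>-\<^sup>1B\<close>. The full identity also contains
  the cyclic sum of the derivatives of \<open>z \<mapsto> \<kappa> z B C\<close> in the direction \<open>W(z)\<^sup>-\<^sup>1A\<close>. If these functions take
  values in a subspace \<open>S\<close>, then so do their derivatives, and these terms disappear modulo \<open>S\<close>.
\<close>

lemma bianchi_modulo_subspace:
  fixes W :: "'e::real_normed_vector \<Rightarrow> 'e \<Rightarrow> 'g::real_normed_vector" and lb :: "'g \<Rightarrow> 'g \<Rightarrow> 'g"
  assumes fde: "finite_dim TYPE('e)" and lie: "lie_algebra lb"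
    and U: "open U" "z0 \<in> U"
    and lin: "\<And>z. z \<in> U \<Longrightarrow> linear (W z)" and bij: "\<And>z. z \<in> U \<Longrightarrow> bij (W z)"
    and W: "\<And>z x. z \<in> U \<Longrightarrow> ((\<lambda>z. W z x) has_derivative (\<lambda>h. DW z h x)) (at z)"
    and DW: "\<And>v x. ((\<lambda>z. DW z v x) has_derivative (\<lambda>h. D2 h v x)) (at z0)"
  defines "K \<equiv> local_curvature lb W"
  defines "\<kappa> \<equiv> \<lambda>z A B. K z (inv_into UNIV (W z) A) (inv_into UNIV (W z) B)"
  assumes S: "subspace S"
    and in_S: "\<And>z. z \<in> U \<Longrightarrow> \<kappa> z A1 A2 \<in> S" "\<And>z. z \<in> U \<Longrightarrow> \<kappa> z A2 A3 \<in> S"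
      "\<And>z. z \<in> U \<Longrightarrow> \<kappa> z A3 A1 \<in> S"
  shows "lb A1 (\<kappa> z0 A2 A3) + lb A2 (\<kappa> z0 A3 A1) + lb A3 (\<kappa> z0 A1 A2)
     - \<kappa> z0 (lb A1 A2) A3 - \<kappa> z0 (lb A2 A3) A1 - \<kappa> z0 (lb A3 A1) A2
     + \<kappa> z0 (\<kappa> z0 A1 A2) A3 + \<kappa> z0 (\<kappa> z0 A2 A3) A1 + \<kappa> z0 (\<kappa> z0 A3 A1) A2 \<in> S"
proof -
  have fdg: "finite_dim TYPE('g)" and bil: "bilinear lb" and alt: "\<And>x. lb x x = 0"
    and jac: "\<And>x y z. lb x (lb y z) + lb y (lb z x) + lb z (lb x y) = 0"
    using lie by (auto simp: lie_algebra_def)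
  have lin1: "linear (\<lambda>x. lb x y)" and lin2: "linear (lb x)" for x y
    using bil by (auto simp: bilinear_def)
  note anti = lie_algebra_anti[OF lie]
  have br_deriv: "((\<lambda>z. lb (f z) (g z)) has_derivative (\<lambda>h. lb (f' h) (g z0) + lb (f z0) (g' h))) (at z0)"
    if "(f has_derivative f') (at z0)" "(g has_derivative g') (at z0)" for f f' g g' and z0 :: 'e
    by (rule has_derivative_linear_family[OF fdg open_UNIV UNIV_I _ _ that(2)])
      (auto intro: lin2 bounded_linear.has_derivative[OF finite_dim_linear_bounded[OF fdg lin1] that(1)])
  have K_eq: "K z x y = DW z x y - DW z y x + lb (W z x) (W z y)" if "z \<in> U" for z x y
    by (simp add: K_def local_curvature_def exterior_derivative_eq[OF W[OF that]])
  have K_lin2: "linear (K z x)" if "z \<in> U" for z x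
    unfolding K_def by (rule local_curvature_linear[OF lie U(1) that lin W[OF that]])
  have K_anti: "K z x y = - K z y x" for z x y
    unfolding K_def by (rule local_curvature_anti[OF lie])
  have K_lin1: "linear (\<lambda>x. K z x y)" if "z \<in> U" for z y
    using linear_compose_neg[OF K_lin2[OF that, of y]] by (subst K_anti)
  define DK where "DK h x y = D2 h x y - D2 h y x + (lb (DW z0 h x) (W z0 y) + lb (W z0 x) (DW z0 h y))"
    for h x y
  have K_deriv: "((\<lambda>z. K z x y) has_derivative (\<lambda>h. DK h x y)) (at z0)" for x y
  proof -
    have "((\<lambda>z. DW z x y - DW z y x + lb (W z x) (W z y)) has_derivative (\<lambda>h. DK h x y)) (at z0)"
      unfolding DK_def
      by (intro has_derivative_add has_derivative_diff DW br_deriv W U)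
    then show ?thesis
      using U by (rule has_derivative_transform_within_open) (simp add: K_eq)
  qed
  have sym: "D2 h v x = D2 v h x" for h v x
    using symmetric_second_derivative[OF U W DW DW] by blast
  define y where "y A z = inv_into UNIV (W z) A" for A z
  have Wy: "W z (y A z) = A" if "z \<in> U" for z A
    unfolding y_def using bij[OF that] by (metis bij_inv_eq_iff)
  have "\<exists>y'. (y A has_derivative y') (at z0) \<and> (\<forall>h. W z0 (y' h) = - DW z0 h (y A z0))" for A
    by (rule has_derivative_inverse_family[OF fde fdg U lin bij[OF U(2)] W[OF U(2)], of "y A" A])
      (use Wy in auto)
  then obtain y' where y': "\<And>A. (y A has_derivative y' A) (at z0)"
    "\<And>A h. W z0 (y' A h) = - DW z0 h (y A z0)" by metis
  \<comment> \<open>the derivative of \<open>z \<mapsto> \<kappa> z A B\<close> lies in \<open>S\<close>; it is computed by the product rule, applied twice\<close>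
  have inS': "DK h (y A z0) (y B z0) + K z0 (y' A h) (y B z0) + K z0 (y A z0) (y' B h) \<in> S"
    if "\<And>z. z \<in> U \<Longrightarrow> \<kappa> z A B \<in> S" for A B h
  proof -
    have 1: "((\<lambda>z. K z (y A z) x) has_derivative (\<lambda>h. DK h (y A z0) x + K z0 (y' A h) x)) (at z0)" for x
      by (rule has_derivative_linear_family[OF fde U K_lin1 K_deriv y'(1)])
    have "((\<lambda>z. K z (y A z) (y B z)) has_derivative
        (\<lambda>h. (DK h (y A z0) (y B z0) + K z0 (y' A h) (y B z0)) + K z0 (y A z0) (y' B h))) (at z0)"
      by (rule has_derivative_linear_family[OF fde U K_lin2 1 y'(1)])
    then show ?thesis
      by (rule has_derivative_in_subspace[OF fdg S _ U]) (use that in \<open>simp add: \<kappa>_def y_def\<close>)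
  qed
  have y0: "y (W z0 x) z0 = x" for x
    unfolding y_def using bij[OF U(2)] by (simp add: bij_is_inj inv_f_f)
  have \<kappa>_y: "K z0 v (y B z0) = \<kappa> z0 (W z0 v) B" "K z0 (y B z0) v = \<kappa> z0 B (W z0 v)" for v B
    using y0 by (simp_all add: \<kappa>_def y_def)
  have "linear (inv_into UNIV (W z0))" by (rule linear_inv_into[OF lin[OF U(2)] bij[OF U(2)]])
  then have \<kappa>_lin: "linear (\<lambda>A. \<kappa> z0 A B)" for B
    unfolding \<kappa>_def using linear_compose[OF _ K_lin1[OF U(2)]] by (simp add: comp_def)
  have \<kappa>_anti: "\<kappa> z0 A B = - \<kappa> z0 B A" for A B
    unfolding \<kappa>_def by (rule K_anti)
  let ?x1 = "y A1 z0" and ?x2 = "y A2 z0" and ?x3 = "y A3 z0"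
  have step: "DK h (y A z0) (y B z0) - \<kappa> z0 (DW z0 h (y A z0)) B + \<kappa> z0 (DW z0 h (y B z0)) A \<in> S"
    if "\<And>z. z \<in> U \<Longrightarrow> \<kappa> z A B \<in> S" for A B h
    using inS'[OF that, of h] \<kappa>_anti[of A "- DW z0 h (y B z0)"]
    by (simp add: \<kappa>_y y'(2) linear_neg[OF \<kappa>_lin])
  have dW: "DW z0 (y A z0) (y B z0) - DW z0 (y B z0) (y A z0) = \<kappa> z0 A B - lb A B" for A B
    using K_eq[OF U(2), of "y A z0" "y B z0"] by (simp add: \<kappa>_y Wy[OF U(2)])
  have \<kappa>dW: "\<kappa> z0 (DW z0 (y A z0) (y B z0)) C - \<kappa> z0 (DW z0 (y B z0) (y A z0)) C
      = \<kappa> z0 (\<kappa> z0 A B) C - \<kappa> z0 (lb A B) C" for A B C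
    unfolding linear_diff[OF \<kappa>_lin, symmetric] dW ..
  have brdW: "lb (DW z0 (y A z0) (y B z0)) C - lb (DW z0 (y B z0) (y A z0)) C
      = lb (\<kappa> z0 A B) C - lb (lb A B) C" for A B C
    unfolding linear_diff[OF lin1, symmetric] dW ..
  \<comment> \<open>\<open>d\<^sup>2W = 0\<close> together with the Jacobi identity\<close>
  have DK_sum: "DK ?x1 ?x2 ?x3 + DK ?x2 ?x3 ?x1 + DK ?x3 ?x1 ?x2 =
      - (lb A1 (\<kappa> z0 A2 A3) + lb A2 (\<kappa> z0 A3 A1) + lb A3 (\<kappa> z0 A1 A2))"
  proof -
    have "DK ?x1 ?x2 ?x3 + DK ?x2 ?x3 ?x1 + DK ?x3 ?x1 ?x2 =
        (lb (DW z0 ?x1 ?x2) A3 - lb (DW z0 ?x2 ?x1) A3) +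
        (lb (DW z0 ?x2 ?x3) A1 - lb (DW z0 ?x3 ?x2) A1) +
        (lb (DW z0 ?x3 ?x1) A2 - lb (DW z0 ?x1 ?x3) A2)"
      by (simp add: DK_def Wy[OF U(2)] sym[of ?x2 ?x1] sym[of ?x3 ?x2] sym[of ?x3 ?x1]
          anti[of A1 "DW z0 _ _"] anti[of A2 "DW z0 _ _"] anti[of A3 "DW z0 _ _"])
    also have "\<dots> = (lb (\<kappa> z0 A1 A2) A3 - lb (lb A1 A2) A3) +
        (lb (\<kappa> z0 A2 A3) A1 - lb (lb A2 A3) A1) + (lb (\<kappa> z0 A3 A1) A2 - lb (lb A3 A1) A2)"
      by (simp only: brdW)
    also have "\<dots> = (lb A1 (lb A2 A3) + lb A2 (lb A3 A1) + lb A3 (lb A1 A2))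
        - (lb A1 (\<kappa> z0 A2 A3) + lb A2 (\<kappa> z0 A3 A1) + lb A3 (\<kappa> z0 A1 A2))"
      by (simp add: anti[of "\<kappa> z0 _ _"] anti[of "lb _ _"])
    finally show ?thesis by (simp only: jac diff_0)
  qed
  have "(DK ?x1 ?x2 ?x3 - \<kappa> z0 (DW z0 ?x1 ?x2) A3 + \<kappa> z0 (DW z0 ?x1 ?x3) A2) +
      (DK ?x2 ?x3 ?x1 - \<kappa> z0 (DW z0 ?x2 ?x3) A1 + \<kappa> z0 (DW z0 ?x2 ?x1) A3) +
      (DK ?x3 ?x1 ?x2 - \<kappa> z0 (DW z0 ?x3 ?x1) A2 + \<kappa> z0 (DW z0 ?x3 ?x2) A1) \<in> S" (is "?L \<in> S")
    by (intro subspace_add[OF S] step in_S)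
  moreover have "?L = - (lb A1 (\<kappa> z0 A2 A3) + lb A2 (\<kappa> z0 A3 A1) + lb A3 (\<kappa> z0 A1 A2)
     - \<kappa> z0 (lb A1 A2) A3 - \<kappa> z0 (lb A2 A3) A1 - \<kappa> z0 (lb A3 A1) A2
     + \<kappa> z0 (\<kappa> z0 A1 A2) A3 + \<kappa> z0 (\<kappa> z0 A2 A3) A1 + \<kappa> z0 (\<kappa> z0 A3 A1) A2)"
  proof -
    have "?L = (DK ?x1 ?x2 ?x3 + DK ?x2 ?x3 ?x1 + DK ?x3 ?x1 ?x2)
        - (\<kappa> z0 (DW z0 ?x1 ?x2) A3 - \<kappa> z0 (DW z0 ?x2 ?x1) A3)
        - (\<kappa> z0 (DW z0 ?x2 ?x3) A1 - \<kappa> z0 (DW z0 ?x3 ?x2) A1)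
        - (\<kappa> z0 (DW z0 ?x3 ?x1) A2 - \<kappa> z0 (DW z0 ?x1 ?x3) A2)" by simp
    also have "\<dots> = - (lb A1 (\<kappa> z0 A2 A3) + lb A2 (\<kappa> z0 A3 A1) + lb A3 (\<kappa> z0 A1 A2))
        - (\<kappa> z0 (\<kappa> z0 A1 A2) A3 - \<kappa> z0 (lb A1 A2) A3)
        - (\<kappa> z0 (\<kappa> z0 A2 A3) A1 - \<kappa> z0 (lb A2 A3) A1)
        - (\<kappa> z0 (\<kappa> z0 A3 A1) A2 - \<kappa> z0 (lb A3 A1) A2)" by (simp only: \<kappa>dW DK_sum)
    finally show ?thesis by simp
  qed
  ultimately show ?thesis using subspace_neg[OF S] by (metis minus_minus)
qed

section \<open>Tangent vectors and one-forms in charts\<close>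

lemma smooth_on_has_derivative:
  assumes "smooth_on S f" "x \<in> S"
  shows "(f has_derivative frechet_derivative f (at x)) (at x)"
proof -
  have "Ck_on (Suc 0) S f" using assms(1) unfolding smooth_on_def by blast
  then show ?thesis using assms(2) by (simp add: frechet_derivative_works)
qed

lemma smooth_on_has_second_derivative:
  assumes "smooth_on S f" "x \<in> S"
  shows "((\<lambda>x. frechet_derivative f (at x) v) has_derivative
    frechet_derivative (\<lambda>x. frechet_derivative f (at x) v) (at x)) (at x)"
proof -
  have "Ck_on (Suc (Suc 0)) S f" using assms(1) unfolding smooth_on_def by blast
  then show ?thesis using assms(2) by (simp add: frechet_derivative_works)
qed

lemma chart_in_manifold:
  assumes "smooth_manifold A" "c \<in> A"
  shows chart_open: "open (cdom c)" "open (cmap c ` cdom c)"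
    and chart_continuous: "continuous_on (cdom c) (cmap c)" "continuous_on (cmap c ` cdom c) (cinv c)"
    and cinv_cmap: "\<And>u. u \<in> cdom c \<Longrightarrow> cinv c (cmap c u) = u"
    and cmap_cinv: "\<And>z. z \<in> cmap c ` cdom c \<Longrightarrow> cmap c (cinv c z) = z"
    and cinv_in: "\<And>z. z \<in> cmap c ` cdom c \<Longrightarrow> cinv c z \<in> cdom c"
proof -
  have *: "open (cdom c)" "open (cmap c ` cdom c)"
    "homeomorphism (cdom c) (cmap c ` cdom c) (cmap c) (cinv c)"
    using assms unfolding smooth_manifold_def by auto
  then show "open (cdom c)" "open (cmap c ` cdom c)"
    "continuous_on (cdom c) (cmap c)" "continuous_on (cmap c ` cdom c) (cinv c)"
    "\<And>u. u \<in> cdom c \<Longrightarrow> cinv c (cmap c u) = u"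
    "\<And>z. z \<in> cmap c ` cdom c \<Longrightarrow> cmap c (cinv c z) = z"
    "\<And>z. z \<in> cmap c ` cdom c \<Longrightarrow> cinv c z \<in> cdom c"
    by (auto simp: homeomorphism_def inv_into_into)
qed

lemma some_chart_in:
  assumes "smooth_manifold A"
  shows "some_chart A u \<in> charts_at A u"
proof -
  have "u \<in> (\<Union>c\<in>A. cdom c)" using assms by (simp add: smooth_manifold_def)
  then have "\<exists>c. c \<in> charts_at A u" by (auto simp: charts_at_def)
  then show ?thesis unfolding some_chart_def by (rule someI_ex)
qed

lemma chart_image_open:
  assumes "smooth_manifold A" "c \<in> A" "open S"
  shows "open (cmap c ` (cdom c \<inter> S))"
proof -
  have "cmap c ` (cdom c \<inter> S) = cmap c ` cdom c \<inter> cinv c -` S"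
    using cinv_cmap[OF assms(1,2)] by force
  then show ?thesis
    using continuous_open_preimage[OF chart_continuous(2)[OF assms(1,2)] chart_open(2)[OF assms(1,2)] assms(3)]
    by simp
qed

lemma transition_smooth:
  assumes "smooth_manifold A" "c \<in> A" "d \<in> A"
  shows "smooth_on (cmap c ` (cdom c \<inter> cdom d)) (cmap d \<circ> cinv c)"
  using assms by (auto simp: smooth_manifold_def)

lemma transition_has_derivative:
  assumes "smooth_manifold A" "c \<in> charts_at A u" "d \<in> charts_at A u"
  shows "((cmap d \<circ> cinv c) has_derivative frechet_derivative (cmap d \<circ> cinv c) (at (cmap c u))) (at (cmap c u))"
  using assms by (intro smooth_on_has_derivative[OF transition_smooth]) (auto simp: charts_at_def)

text \<open>The families of coordinates by which tangent maps are defined are tangent vectors, so that they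
  are determined by the entry in a single chart. By the chain rule, this holds for every map \<open>q\<close> from
  an open subset of a normed space to the manifold.\<close>

lemma tangent_family_eq_tvec_of:
  assumes M: "smooth_manifold A" and c: "c \<in> A"
    and V: "open V" "z \<in> V" "\<And>x. x \<in> V \<Longrightarrow> q x \<in> cdom c"
    and q': "((cmap c \<circ> q) has_derivative q') (at z)"
  shows "(\<lambda>d. if d \<in> charts_at A (q z) then frechet_derivative (cmap d \<circ> q) (at z) h else 0) =
    tvec_of A (q z) c (q' h)"
proof
  fix d
  show "(if d \<in> charts_at A (q z) then frechet_derivative (cmap d \<circ> q) (at z) h else 0) =
    tvec_of A (q z) c (q' h) d"
  proof (cases "d \<in> charts_at A (q z)")
    case True
    have c': "c \<in> charts_at A (q z)" using c V by (simp add: charts_at_def)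
    let ?D = "frechet_derivative (cmap d \<circ> cinv c) (at (cmap c (q z)))"
    have "((cmap d \<circ> cinv c) has_derivative ?D) (at ((cmap c \<circ> q) z))"
      using transition_has_derivative[OF M c' True] by simp
    from diff_chain_at[OF q' this]
    have "((cmap d \<circ> cinv c) \<circ> (cmap c \<circ> q) has_derivative ?D \<circ> q') (at z)" .
    then have "(cmap d \<circ> q has_derivative ?D \<circ> q') (at z)"
      using V(1,2) by (rule has_derivative_transform_within_open) (use V(3) cinv_cmap[OF M c] in auto)
    then show ?thesis
      using True by (simp add: frechet_derivative_at[symmetric] tvec_of_def)
  qed (simp add: tvec_of_def)
qed

lemma tvec_of_change:
  assumes M: "smooth_manifold A" and c: "c \<in> charts_at A u" and d: "d \<in> charts_at A u"
  shows "tvec_of A u d (frechet_derivative (cmap d \<circ> cinv c) (at (cmap c u)) x) = tvec_of A u c x"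
proof -
  have cd: "c \<in> A" "d \<in> A" "u \<in> cdom c" "u \<in> cdom d" using c d by (auto simp: charts_at_def)
  note u = cinv_cmap[OF M cd(1)]
  have "tvec_of A (cinv c (cmap c u)) d (frechet_derivative (cmap d \<circ> cinv c) (at (cmap c u)) x) =
    (\<lambda>e. if e \<in> charts_at A (cinv c (cmap c u)) then frechet_derivative (cmap e \<circ> cinv c) (at (cmap c u)) x else 0)"
  proof (rule tangent_family_eq_tvec_of[OF M cd(2), symmetric])
    show "open (cmap c ` (cdom c \<inter> cdom d))"
      by (rule chart_image_open[OF M cd(1) chart_open(1)[OF M cd(2)]])
    show "cmap c u \<in> cmap c ` (cdom c \<inter> cdom d)" using cd by blast
    show "\<And>x. x \<in> cmap c ` (cdom c \<inter> cdom d) \<Longrightarrow> cinv c x \<in> cdom d" using u by auto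
  qed (rule transition_has_derivative[OF M c d])
  then show ?thesis by (simp add: u cd tvec_of_def)
qed

lemma tvec_of_same:
  assumes M: "smooth_manifold A" and c: "c \<in> charts_at A u"
  shows "tvec_of A u c x c = x"
proof -
  have cA: "c \<in> A" "u \<in> cdom c" using c by (auto simp: charts_at_def)
  have "((\<lambda>z. z) has_derivative (\<lambda>z. z)) (at (cmap c u))" by (rule has_derivative_ident)
  then have "((cmap c \<circ> cinv c) has_derivative (\<lambda>z. z)) (at (cmap c u))"
    by (rule has_derivative_transform_within_open[OF _ chart_open(2)[OF M cA(1)]])
      (use cA cmap_cinv[OF M cA(1)] in auto)
  then show ?thesis using c by (simp add: tvec_of_def frechet_derivative_at[symmetric])
qed

lemma in_tangent_space_iff:
  "v \<in> vcarrier (tangent_space A u) \<longleftrightarrow> (\<forall>c. c \<notin> charts_at A u \<longrightarrow> v c = 0) \<and>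
    (\<forall>c\<in>charts_at A u. \<forall>d\<in>charts_at A u.
      v d = frechet_derivative (cmap d \<circ> cinv c) (at (cmap c u)) (v c))"
  by (simp only: tangent_space_def vsp.simps mem_Collect_eq)

lemma tvec_of_in:
  assumes M: "smooth_manifold A" and c: "c \<in> charts_at A u"
  shows "tvec_of A u c x \<in> vcarrier (tangent_space A u)"
proof -
  have "tvec_of A u c x e = frechet_derivative (cmap e \<circ> cinv d) (at (cmap d u)) (tvec_of A u c x d)"
    if "d \<in> charts_at A u" "e \<in> charts_at A u" for d e
    using fun_cong[OF tvec_of_change[OF M c that(1), of x], of e] that by (simp add: tvec_of_def)
  then show ?thesis
    unfolding in_tangent_space_iff by (intro conjI ballI allI impI) (simp add: tvec_of_def)
qed

lemma tvec_of_coordinate: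
  assumes "v \<in> vcarrier (tangent_space A u)" "c \<in> charts_at A u"
  shows "tvec_of A u c (v c) = v"
proof
  show "tvec_of A u c (v c) d = v d" for d
    using assms(1)[unfolded in_tangent_space_iff, THEN conjunct1, rule_format, of d]
      assms(1)[unfolded in_tangent_space_iff, THEN conjunct2, rule_format, OF assms(2), of d]
    unfolding tvec_of_def by presburger
qed

lemma tvec_of_linear:
  assumes M: "smooth_manifold A" and c: "c \<in> charts_at A u"
  shows "tvec_of A u c (x + y) = vadd (tangent_space A u) (tvec_of A u c x) (tvec_of A u c y)"
    and "tvec_of A u c (r *\<^sub>R x) = vscale (tangent_space A u) r (tvec_of A u c x)"
  using transition_has_derivative[OF M c, THEN has_derivative_linear]
  by (auto simp: tangent_space_def tvec_of_def fun_eq_iff linear_add linear_scale)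

context
  fixes A :: "('m::{t2_space,second_countable_topology}, 'e::real_normed_vector) chart set"
    and \<omega> :: "'m \<Rightarrow> ('m, 'e) tvec \<Rightarrow> 'g::real_normed_vector"
  assumes M: "smooth_manifold A" and \<omega>: "smooth_one_form A \<omega>"
begin

lemma local_form_linear:
  assumes "c \<in> A" "z \<in> cmap c ` cdom c"
  shows "linear (local_form A \<omega> c z)"
proof -
  have c: "c \<in> charts_at A (cinv c z)"
    using assms cinv_in[OF M] by (auto simp: charts_at_def)
  have "vlinear (tangent_space A (cinv c z)) (lin UNIV) (\<omega> (cinv c z))"
    using \<omega> by (simp add: smooth_one_form_def)
  then show ?thesis
    using tvec_of_in[OF M c]
    by (intro linearI) (simp_all add: local_form_def tvec_of_linear[OF M c] vlinear_def lin_def)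
qed

lemma local_form_bij:
  assumes "c \<in> A" "z \<in> cmap c ` cdom c"
    and bij: "bij_betw (\<omega> (cinv c z)) (vcarrier (tangent_space A (cinv c z))) UNIV"
  shows "bij (local_form A \<omega> c z)"
proof -
  have c: "c \<in> charts_at A (cinv c z)"
    using assms cinv_in[OF M] by (auto simp: charts_at_def)
  have "bij_betw (tvec_of A (cinv c z) c) UNIV (vcarrier (tangent_space A (cinv c z)))"
    using tvec_of_same[OF M c] tvec_of_coordinate[OF _ c] tvec_of_in[OF M c]
    by (intro bij_betw_byWitness[where f' = "\<lambda>v. v c"]) auto
  from bij_betw_trans[OF this bij] show ?thesis by (simp add: local_form_def[abs_def] comp_def)
qed

lemma local_form_smooth:
  assumes "c \<in> A"
  shows "smooth_on (cmap c ` cdom c) (\<lambda>z. local_form A \<omega> c z x)"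
  using \<omega> assms by (auto simp: smooth_one_form_def)

lemma local_form_cmap:
  assumes "c \<in> charts_at A u"
  shows "local_form A \<omega> c (cmap c u) x = \<omega> u (tvec_of A u c x)"
  using assms by (simp add: local_form_def charts_at_def cinv_cmap[OF M])

lemma local_form_coordinate:
  assumes "c \<in> charts_at A u" "\<xi> \<in> vcarrier (tangent_space A u)"
  shows "local_form A \<omega> c (cmap c u) (\<xi> c) = \<omega> u \<xi>"
  using assms by (simp add: local_form_cmap tvec_of_coordinate)

lemma local_form_change:
  assumes c: "c \<in> A" and d: "d \<in> A" and z: "z \<in> cmap c ` (cdom c \<inter> cdom d)"
  shows "local_form A \<omega> c z x =
    local_form A \<omega> d ((cmap d \<circ> cinv c) z) (frechet_derivative (cmap d \<circ> cinv c) (at z) x)"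
proof -
  obtain u where u: "z = cmap c u" "u \<in> cdom c" "u \<in> cdom d" using z by auto
  then have cd: "c \<in> charts_at A u" "d \<in> charts_at A u" using c d by (auto simp: charts_at_def)
  show ?thesis
    unfolding u(1) comp_apply cinv_cmap[OF M c u(2)] local_form_cmap[OF cd(1)] local_form_cmap[OF cd(2)]
    using tvec_of_change[OF M cd] by (simp add: comp_def)
qed

text \<open>\<open>ext_deriv\<close> is defined by means of a chart that varies with the point; to differentiate the
  curvature, a fixed chart is needed.\<close>

lemma ext_deriv_in_chart:
  assumes d: "d \<in> charts_at A u"
    and \<xi>: "\<xi> \<in> vcarrier (tangent_space A u)" and \<eta>: "\<eta> \<in> vcarrier (tangent_space A u)"
  shows "ext_deriv A \<omega> u \<xi> \<eta> = exterior_derivative (local_form A \<omega> d) (cmap d u) (\<xi> d) (\<eta> d)"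
proof -
  define c where "c = some_chart A u"
  have c: "c \<in> charts_at A u" unfolding c_def by (rule some_chart_in[OF M])
  have cd: "c \<in> A" "d \<in> A" "u \<in> cdom c" "u \<in> cdom d" using c d by (auto simp: charts_at_def)
  let ?\<phi> = "cmap d \<circ> cinv c" and ?U = "cmap c ` (cdom c \<inter> cdom d)"
  have U: "open ?U" "cmap c u \<in> ?U"
    using chart_image_open[OF M cd(1) chart_open(1)[OF M cd(2)]] cd by auto
  have \<phi>u: "?\<phi> (cmap c u) = cmap d u" by (simp add: cinv_cmap[OF M cd(1)] cd)
  have fd: "finite_dim TYPE('e)" using M by (simp add: smooth_manifold_def)
  have "exterior_derivative (local_form A \<omega> c) (cmap c u) x y =
    exterior_derivative (local_form A \<omega> d) (?\<phi> (cmap c u))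
      (frechet_derivative ?\<phi> (at (cmap c u)) x) (frechet_derivative ?\<phi> (at (cmap c u)) y)" for x y
  proof (rule exterior_derivative_pullback[OF fd U chart_open(2)[OF M cd(2)]])
    show "?\<phi> (cmap c u) \<in> cmap d ` cdom d" using cd \<phi>u by simp
    show "(?\<phi> has_derivative frechet_derivative ?\<phi> (at z)) (at z)" if "z \<in> ?U" for z
      using smooth_on_has_derivative[OF transition_smooth[OF M cd(1,2)] that] .
    show "((\<lambda>z. frechet_derivative ?\<phi> (at z) x) has_derivative
        frechet_derivative (\<lambda>z. frechet_derivative ?\<phi> (at z) x) (at (cmap c u))) (at (cmap c u))" for x
      using smooth_on_has_second_derivative[OF transition_smooth[OF M cd(1,2)] U(2)] .
    show "linear (local_form A \<omega> d z)" if "z \<in> cmap d ` cdom d" for z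
      using local_form_linear[OF cd(2) that] .
    show "((\<lambda>z. local_form A \<omega> d z x) has_derivative
        (\<lambda>h. frechet_derivative (\<lambda>z. local_form A \<omega> d z x) (at (?\<phi> (cmap c u))) h)) (at (?\<phi> (cmap c u)))" for x
      using smooth_on_has_derivative[OF local_form_smooth[OF cd(2)]] cd \<phi>u by simp
  qed (rule local_form_change[OF cd(1,2)])
  moreover have "frechet_derivative ?\<phi> (at (cmap c u)) (v c) = v d"
    if "v \<in> vcarrier (tangent_space A u)" for v
    using that[unfolded in_tangent_space_iff, THEN conjunct2, rule_format, OF c d] by (rule sym)
  ultimately show ?thesis
    using \<xi> \<eta> \<phi>u by (simp add: ext_deriv_def exterior_derivative_def Let_def c_def)
qed

end

section \<open>The associated graded algebra by means of lifts\<close>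

lemma coset_eq_iff:
  fixes a b :: "'v::real_vector"
  assumes "subspace W"
  shows "(+) a ` W = (+) b ` W \<longleftrightarrow> a - b \<in> W"
proof
  assume "(+) a ` W = (+) b ` W"
  moreover have "a \<in> (+) a ` W" using subspace_0[OF assms] by force
  ultimately obtain w where "w \<in> W" "a = b + w" by auto
  then show "a - b \<in> W" by simp
next
  have sub: "(+) a ` W \<subseteq> (+) b ` W" if "a - b \<in> W" for a b
  proof
    fix x assume "x \<in> (+) a ` W"
    then obtain w where w: "w \<in> W" "x = a + w" by auto
    then have "x = b + ((a - b) + w)" "(a - b) + w \<in> W" using that subspace_add[OF assms] by auto
    then show "x \<in> (+) b ` W" by blast
  qed
  assume ab: "a - b \<in> W"
  then have "b - a \<in> W" using subspace_neg[OF assms] by fastforce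
  with ab sub show "(+) a ` W = (+) b ` W" by blast
qed

lemma coset_add:
  fixes a b :: "'v::real_vector"
  assumes "subspace W"
  shows "{x + y | x y. x \<in> (+) a ` W \<and> y \<in> (+) b ` W} = (+) (a + b) ` W" (is "?L = ?R")
proof
  show "?L \<subseteq> ?R"
  proof
    fix z assume "z \<in> ?L"
    then obtain v w where vw: "v \<in> W" "w \<in> W" "z = (a + v) + (b + w)" by auto
    then have "z = (a + b) + (v + w)" "v + w \<in> W" using subspace_add[OF assms] by (auto simp: add_ac)
    then show "z \<in> ?R" by blast
  qed
  show "?R \<subseteq> ?L"
  proof
    fix z assume "z \<in> ?R"
    then obtain w where w: "w \<in> W" "z = a + b + w" by auto
    then have "z = (a + 0) + (b + w)" by simp
    moreover have "a + 0 \<in> (+) a ` W" "b + w \<in> (+) b ` W"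
      using w(1) subspace_0[OF assms] by (blast intro: imageI)+
    ultimately show "z \<in> ?L" by blast
  qed
qed

lemma coset_scale:
  fixes a :: "'v::real_vector"
  assumes "subspace W"
  shows "{r *\<^sub>R x + w | x w. x \<in> (+) a ` W \<and> w \<in> W} = (+) (r *\<^sub>R a) ` W" (is "?L = ?R")
proof
  show "?L \<subseteq> ?R"
  proof
    fix z assume "z \<in> ?L"
    then obtain v w where vw: "v \<in> W" "w \<in> W" "z = r *\<^sub>R (a + v) + w" by auto
    then have "z = r *\<^sub>R a + (r *\<^sub>R v + w)" "r *\<^sub>R v + w \<in> W"
      using subspace_add[OF assms] subspace_scale[OF assms] by (auto simp: scaleR_add_right)
    then show "z \<in> ?R" by blast
  qed
  show "?R \<subseteq> ?L"
  proof
    fix z assume "z \<in> ?R"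
    then obtain w where w: "w \<in> W" "z = r *\<^sub>R (a + 0) + w" by auto
    moreover have "a + 0 \<in> (+) a ` W" using subspace_0[OF assms] by (blast intro: imageI)
    ultimately show "z \<in> ?L" by blast
  qed
qed

locale filtered_pair =
  fixes \<P> :: "('g::real_normed_vector, 'p, 'h) pair"
  assumes flt: "filtered_lie_algebra \<P>"
begin

lemma filt_subspace: "subspace (filt \<P> i)"
  and filt_low: "i \<le> - int (depth \<P>) \<Longrightarrow> filt \<P> i = UNIV"
  and filt_high: "i > int (height \<P>) \<Longrightarrow> filt \<P> i = {0}"
  and filt_br: "x \<in> filt \<P> i \<Longrightarrow> y \<in> filt \<P> j \<Longrightarrow> br \<P> x y \<in> filt \<P> (i + j)"
  and br_bilinear: "bilinear (br \<P>)"
  using flt by (auto simp: filtered_lie_algebra_def lie_algebra_def)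

lemma filt_mono:
  assumes "i \<le> j" "x \<in> filt \<P> j" shows "x \<in> filt \<P> i"
proof -
  have "x \<in> filt \<P> j \<longrightarrow> x \<in> filt \<P> i"
    using assms(1)
  proof (induction j rule: int_ge_induct)
    case (step j)
    then show ?case using flt unfolding filtered_lie_algebra_def by blast
  qed simp
  with assms(2) show ?thesis by simp
qed

lemmas filt_0 = subspace_0[OF filt_subspace]
  and filt_add = subspace_add[OF filt_subspace]
  and filt_diff = subspace_diff[OF filt_subspace]
  and filt_neg = subspace_neg[OF filt_subspace]
  and filt_scale = subspace_scale[OF filt_subspace]

lemma filt_sum: "(\<And>i. i \<in> I \<Longrightarrow> f i \<in> filt \<P> n) \<Longrightarrow> sum f I \<in> filt \<P> n"
  by (rule subspace_sum[OF filt_subspace])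

text \<open>An element \<open>x\<close> of the associated graded algebra is a family of cosets. A lift of \<open>x\<close> chooses a
  representative in each degree. Lifts are unique up to elements of one filtration degree higher, and
  all operations of the graded algebra have obvious counterparts on lifts; an identity in the graded
  algebra is proved by comparing lifts.\<close>

definition lift :: "(int \<Rightarrow> 'g set) \<Rightarrow> (int \<Rightarrow> 'g) \<Rightarrow> bool" where
  "lift x a \<longleftrightarrow> (\<forall>i. a i \<in> filt \<P> i \<and> x i = (+) (a i) ` filt \<P> (i + 1))"

lemma lift_filt: "lift x a \<Longrightarrow> a i \<in> filt \<P> i"
  by (simp add: lift_def)

lemma vcarrier_gr_iff: "x \<in> vcarrier (gr \<P>) \<longleftrightarrow> (\<exists>a. lift x a)"
proof -
  have "x \<in> vcarrier (gr \<P>) \<longleftrightarrow> (\<forall>i. \<exists>a. a \<in> filt \<P> i \<and> x i = (+) a ` filt \<P> (i + 1))"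
    by (simp add: gr_def vprod_def gr_comp_def vquot_def vcoset_def lin_def image_iff Bex_def)
  then show ?thesis unfolding lift_def choice_iff .
qed

lemma vzero_gr: "vzero (gr \<P>) = (\<lambda>i. filt \<P> (i + 1))"
  by (simp add: gr_def vprod_def gr_comp_def vquot_def)

lemma lift_zero: "lift (vzero (gr \<P>)) (\<lambda>i. 0)"
  by (simp add: lift_def vzero_gr filt_0)

lemma lift_add:
  assumes "lift x a" "lift y b" shows "lift (vadd (gr \<P>) x y) (\<lambda>i. a i + b i)"
  using assms coset_add[OF filt_subspace]
  by (simp add: lift_def gr_def vprod_def gr_comp_def vquot_def lin_def filt_add)

lemma lift_scale:
  assumes "lift x a" shows "lift (vscale (gr \<P>) r x) (\<lambda>i. r *\<^sub>R a i)"
  using assms coset_scale[OF filt_subspace]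
  by (simp add: lift_def gr_def vprod_def gr_comp_def vquot_def lin_def filt_scale)

lemma lift_eqI:
  assumes "lift x a" "lift y b" "\<And>i. a i - b i \<in> filt \<P> (i + 1)" shows "x = y"
  using assms coset_eq_iff[OF filt_subspace] by (auto simp: lift_def fun_eq_iff)

lemma lift_diff:
  assumes "lift x a" "lift x b" shows "a i - b i \<in> filt \<P> (i + 1)"
  using assms coset_eq_iff[OF filt_subspace] unfolding lift_def by metis

lemma lift_cong:
  assumes "lift x a" "\<And>i. b i - a i \<in> filt \<P> (i + 1)" shows "lift x b"
proof -
  have "b i \<in> filt \<P> i" for i
    using filt_add[OF filt_mono[OF _ assms(2)] lift_filt[OF assms(1)], of i i] by simp
  moreover have "(+) (b i) ` filt \<P> (i + 1) = (+) (a i) ` filt \<P> (i + 1)" for i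
    using coset_eq_iff[OF filt_subspace] assms(2) by blast
  ultimately show ?thesis using assms(1) by (simp add: lift_def)
qed

lemma lift_gr_class:
  assumes "X \<in> filt \<P> i" shows "lift (gr_class \<P> i X) (\<lambda>j. if j = i then X else 0)"
  using assms by (auto simp: lift_def gr_class_def vzero_gr vcoset_def lin_def filt_0)

abbreviation degs :: "int set" where "degs \<equiv> {- int (depth \<P>)..int (height \<P>)}"
abbreviation neg_degs :: "int set" where "neg_degs \<equiv> {- int (depth \<P>)..-1}"

lemma lift_bracket:
  assumes x: "lift x a" and y: "lift y b"
  shows "lift (gr_bracket \<P> x y) (\<lambda>n. \<Sum>i\<in>degs. br \<P> (a i) (b (n - i)))"
  unfolding lift_def
proof (intro allI conjI)
  fix n
  have mem: "br \<P> (a i) (b (n - i)) \<in> filt \<P> n" for i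
    using filt_br[OF lift_filt[OF x] lift_filt[OF y], of i "n - i"] by simp
  show "(\<Sum>i\<in>degs. br \<P> (a i) (b (n - i))) \<in> filt \<P> n" by (intro filt_sum mem)
  show "gr_bracket \<P> x y n = (+) (\<Sum>i\<in>degs. br \<P> (a i) (b (n - i))) ` filt \<P> (n + 1)" (is "?L = ?R")
  proof
    show "?R \<subseteq> ?L"
    proof
      fix z assume "z \<in> ?R"
      moreover have "a i \<in> x i" "b i \<in> y i" for i
        using x y filt_0 by (force simp: lift_def)+
      ultimately show "z \<in> ?L" unfolding gr_bracket_def by blast
    qed
    show "?L \<subseteq> ?R"
    proof
      fix z assume "z \<in> ?L"
      then obtain a' b' w where z: "z = (\<Sum>i\<in>degs. br \<P> (a' i) (b' (n - i))) + w" "w \<in> filt \<P> (n + 1)"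
        and a': "\<And>i. a' i \<in> x i" and b': "\<And>i. b' i \<in> y i" unfolding gr_bracket_def by blast
      have da: "a' i - a i \<in> filt \<P> (i + 1)" for i using a'[of i] x by (auto simp: lift_def)
      have db: "b' i - b i \<in> filt \<P> (i + 1)" for i using b'[of i] y by (auto simp: lift_def)
      have b'f: "b' i \<in> filt \<P> i" for i
        using filt_add[OF filt_mono[OF _ db] lift_filt[OF y], of i i] by simp
      have "br \<P> (a' i) (b' (n - i)) - br \<P> (a i) (b (n - i)) \<in> filt \<P> (n + 1)" for i
      proof -
        have "br \<P> (a' i) (b' (n - i)) - br \<P> (a i) (b (n - i)) =
            br \<P> (a' i - a i) (b' (n - i)) + br \<P> (a i) (b' (n - i) - b (n - i))"
          by (simp add: bilinear_lsub[OF br_bilinear] bilinear_rsub[OF br_bilinear])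
        also have "\<dots> \<in> filt \<P> (n + 1)"
        proof (rule filt_add)
          show "br \<P> (a' i - a i) (b' (n - i)) \<in> filt \<P> (n + 1)"
            using filt_br[OF da b'f, of i "n - i"] by (simp add: add_ac)
          show "br \<P> (a i) (b' (n - i) - b (n - i)) \<in> filt \<P> (n + 1)"
            using filt_br[OF lift_filt[OF x] db, of i "n - i"] by (simp add: add_ac)
        qed
        finally show ?thesis .
      qed
      then have "(\<Sum>i\<in>degs. br \<P> (a' i) (b' (n - i)) - br \<P> (a i) (b (n - i))) + w \<in> filt \<P> (n + 1)"
        by (intro filt_add filt_sum z(2))
      moreover have "z = (\<Sum>i\<in>degs. br \<P> (a i) (b (n - i))) +
          ((\<Sum>i\<in>degs. br \<P> (a' i) (b' (n - i)) - br \<P> (a i) (b (n - i))) + w)"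
        by (simp add: z(1) sum_subtractf)
      ultimately show "z \<in> ?R" by blast
    qed
  qed
qed

lemma neg_part_iff:
  "x \<in> vcarrier (neg_part \<P>) \<longleftrightarrow> (\<exists>a. lift x a \<and> (\<forall>i. i \<notin> neg_degs \<longrightarrow> a i = 0))"
proof
  assume "x \<in> vcarrier (neg_part \<P>)"
  then have "x \<in> vcarrier (gr \<P>)" and x0: "\<And>i. i \<ge> 0 \<Longrightarrow> x i = filt \<P> (i + 1)"
    by (auto simp: neg_part_def gr_comp_def vquot_def)
  then obtain a where a: "lift x a" by (auto simp: vcarrier_gr_iff)
  have "a i \<in> filt \<P> (i + 1)" if "i \<notin> neg_degs" for i
  proof (cases "i \<ge> 0")
    case True
    then have "(+) (a i) ` filt \<P> (i + 1) = (+) 0 ` filt \<P> (i + 1)" using x0 a by (simp add: lift_def)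
    then show ?thesis using coset_eq_iff[OF filt_subspace, of "a i" "i + 1" 0] by simp
  next
    case False
    then show ?thesis using that by (simp add: filt_low)
  qed
  then have "lift x (\<lambda>i. if i \<in> neg_degs then a i else 0)"
    by (intro lift_cong[OF a]) (simp add: filt_0 filt_neg)
  then show "\<exists>a. lift x a \<and> (\<forall>i. i \<notin> neg_degs \<longrightarrow> a i = 0)" by (intro exI conjI) auto
next
  assume "\<exists>a. lift x a \<and> (\<forall>i. i \<notin> neg_degs \<longrightarrow> a i = 0)"
  then obtain a where a: "lift x a" "\<And>i. i \<notin> neg_degs \<Longrightarrow> a i = 0" by blast
  then have "x i = filt \<P> (i + 1)" if "i \<ge> 0" for i
    using that by (simp add: lift_def)
  with a(1) show "x \<in> vcarrier (neg_part \<P>)"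
    by (auto simp: neg_part_def vcarrier_gr_iff gr_comp_def vquot_def)
qed

lemma neg_part_liftI:
  assumes "lift x a" "\<And>i. i \<ge> 0 \<Longrightarrow> a i = 0" shows "x \<in> vcarrier (neg_part \<P>)"
  using assms by (auto simp: neg_part_def vcarrier_gr_iff gr_comp_def vquot_def lift_def)

lemma neg_part_lift: "x \<in> vcarrier (neg_part \<P>) \<Longrightarrow> \<exists>a. lift x a"
  using neg_part_iff by blast

lemma gr_class_neg:
  assumes "i < 0" "X \<in> filt \<P> i" shows "gr_class \<P> i X \<in> vcarrier (neg_part \<P>)"
  by (rule neg_part_liftI[OF lift_gr_class[OF assms(2)]]) (use assms in simp)

lemma neg_part_ops: "vadd (neg_part \<P>) = vadd (gr \<P>)" "vscale (neg_part \<P>) = vscale (gr \<P>)"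
  by (simp_all add: neg_part_def)

lemma neg_part_add:
  assumes "x \<in> vcarrier (neg_part \<P>)" "y \<in> vcarrier (neg_part \<P>)"
  shows "vadd (gr \<P>) x y \<in> vcarrier (neg_part \<P>)"
proof -
  obtain a b where "lift x a" "\<forall>i. i \<notin> neg_degs \<longrightarrow> a i = 0" "lift y b" "\<forall>i. i \<notin> neg_degs \<longrightarrow> b i = 0"
    using assms unfolding neg_part_iff by blast
  then show ?thesis
    unfolding neg_part_iff by (intro exI[of _ "\<lambda>i. a i + b i"] conjI lift_add) auto
qed

lemma neg_part_scale:
  assumes "x \<in> vcarrier (neg_part \<P>)" shows "vscale (gr \<P>) r x \<in> vcarrier (neg_part \<P>)"
proof -
  obtain a where "lift x a" "\<forall>i. i \<notin> neg_degs \<longrightarrow> a i = 0" using assms unfolding neg_part_iff by blast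
  then show ?thesis
    unfolding neg_part_iff by (intro exI[of _ "\<lambda>i. r *\<^sub>R a i"] conjI lift_scale) auto
qed

lemma neg_part_bracket:
  assumes "x \<in> vcarrier (neg_part \<P>)" "y \<in> vcarrier (neg_part \<P>)"
  shows "gr_bracket \<P> x y \<in> vcarrier (neg_part \<P>)"
proof -
  obtain a b where a: "lift x a" "\<And>i. i \<notin> neg_degs \<Longrightarrow> a i = 0"
    and b: "lift y b" "\<And>i. i \<notin> neg_degs \<Longrightarrow> b i = 0" using assms unfolding neg_part_iff by blast
  show ?thesis
  proof (rule neg_part_liftI[OF lift_bracket[OF a(1) b(1)]])
    fix n :: int assume n: "n \<ge> 0"
    have "br \<P> (a i) (b (n - i)) = 0" for i
      using n a(2)[of i] b(2)[of "n - i"]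
      by (cases "i \<ge> 0") (auto simp: bilinear_lzero[OF br_bilinear] bilinear_rzero[OF br_bilinear])
    then show "(\<Sum>i\<in>degs. br \<P> (a i) (b (n - i))) = 0" by simp
  qed
qed

lemma neg_part_induct [consumes 1]:
  assumes x: "x \<in> vcarrier (neg_part \<P>)"
    and hom: "\<And>i X. i < 0 \<Longrightarrow> X \<in> filt \<P> i \<Longrightarrow> Q (gr_class \<P> i X)"
    and add: "\<And>x y. x \<in> vcarrier (neg_part \<P>) \<Longrightarrow> y \<in> vcarrier (neg_part \<P>) \<Longrightarrow> Q x \<Longrightarrow> Q y \<Longrightarrow>
      Q (vadd (gr \<P>) x y)"
  shows "Q x"
proof -
  obtain a where a: "lift x a" "\<And>i. i \<notin> neg_degs \<Longrightarrow> a i = 0" using x unfolding neg_part_iff by blast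
  have *: "Q y" if "finite T" "T \<subseteq> neg_degs" "lift y (\<lambda>i. if i \<in> T then a i else 0)" for T y
    using that
  proof (induction T arbitrary: y rule: finite_induct)
    case empty
    have "y = gr_class \<P> (-1) 0"
      by (rule lift_eqI[OF empty(2) lift_gr_class[OF filt_0]]) (simp add: filt_0)
    then show ?case using hom[of "-1" 0] filt_0 by simp
  next
    case (insert t T)
    define y' where "y' i = (+) (if i \<in> T then a i else 0) ` filt \<P> (i + 1)" for i
    have y': "lift y' (\<lambda>i. if i \<in> T then a i else 0)"
      using lift_filt[OF a(1)] by (auto simp: lift_def y'_def filt_0)
    have t: "a t \<in> filt \<P> t" "t < 0" using lift_filt[OF a(1)] insert.prems(1) by auto
    have y'_neg: "y' \<in> vcarrier (neg_part \<P>)"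
      by (rule neg_part_liftI[OF y']) (use insert.prems(1) in auto)
    have "y = vadd (gr \<P>) (gr_class \<P> t (a t)) y'"
      by (rule lift_eqI[OF insert.prems(2) lift_add[OF lift_gr_class[OF t(1)] y']])
        (use insert.hyps in \<open>auto simp: filt_0\<close>)
    then show ?case
      using add[OF gr_class_neg[OF t(2,1)] y'_neg hom[OF t(2,1)] insert.IH[OF _ y']] insert.prems(1)
      by simp
  qed
  have "(\<lambda>i. if i \<in> neg_degs then a i else 0) = a" using a(2) by fastforce
  then show ?thesis using *[of neg_degs x] a(1) by simp
qed

end

text \<open>
  An alternating bilinear map \<open>\<beta>\<close> on \<open>\<gg>\<close> of filtration degree \<open>l\<close> induces the cochain \<open>graded_map\<close> of
  degree \<open>l\<close>. The degree condition includes degree \<open>0\<close>, because changing a lift in degree \<open>-1\<close> adds an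
  element of \<open>\<gg>\<^sup>0\<close>. For the curvature this case is trivial, as it vanishes if one argument is in \<open>\<gg>\<^sup>0\<close>.
\<close>

locale graded_cochain = filtered_pair \<P>
  for \<P> :: "('g::real_normed_vector, 'p, 'h) pair" +
  fixes \<beta> :: "'g \<Rightarrow> 'g \<Rightarrow> 'g" and l :: int
  assumes bil: "bilinear \<beta>" and alt: "\<And>X. \<beta> X X = 0"
    and deg: "\<And>i j X Y. i \<le> 0 \<Longrightarrow> j \<le> 0 \<Longrightarrow> X \<in> filt \<P> i \<Longrightarrow> Y \<in> filt \<P> j \<Longrightarrow> \<beta> X Y \<in> filt \<P> (i + j + l)"
begin

text \<open>The effect of the cochain on lifts; only the components of degrees \<open>-\<mu>, \<dots>, -1\<close> contribute.\<close>

definition lift_map :: "(int \<Rightarrow> 'g) \<Rightarrow> (int \<Rightarrow> 'g) \<Rightarrow> int \<Rightarrow> 'g" where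
  "lift_map a b n = (\<Sum>i\<in>neg_degs. \<Sum>j\<in>neg_degs. if i + j + l = n then \<beta> (a i) (b j) else 0)"

text \<open>The cochain is defined through arbitrarily chosen lifts; by \<open>lift_map_cong\<close> the choice is
  immaterial.\<close>

definition graded_map :: "(int \<Rightarrow> 'g set) list \<Rightarrow> int \<Rightarrow> 'g set" where
  "graded_map = restrict (\<lambda>xs n. (+) (lift_map (SOME a. lift (xs ! 0) a) (SOME b. lift (xs ! 1) b) n)
     ` filt \<P> (n + 1)) (tuples 2 (neg_part \<P>))"

lemma beta_anti: "\<beta> X Y = - \<beta> Y X"
proof -
  have "\<beta> (X + Y) (X + Y) = \<beta> X X + \<beta> Y X + (\<beta> X Y + \<beta> Y Y)"
    by (simp only: bilinear_ladd[OF bil] bilinear_radd[OF bil])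
  then have "\<beta> X Y + \<beta> Y X = 0" by (simp add: alt add.commute)
  then show ?thesis by (simp only: eq_neg_iff_add_eq_0)
qed

lemma lift_map_filt:
  assumes "\<And>i. a i \<in> filt \<P> i" "\<And>i. b i \<in> filt \<P> i" shows "lift_map a b n \<in> filt \<P> n"
  unfolding lift_map_def using deg[OF _ _ assms]
  by (intro filt_sum) (auto simp: filt_0)

lemma lift_map_cong:
  assumes x: "lift x a" "lift x a'" and y: "lift y b" "lift y b'"
  shows "lift_map a b n - lift_map a' b' n \<in> filt \<P> (n + 1)"
proof -
  have "(if i + j + l = n then \<beta> (a i) (b j) else 0) - (if i + j + l = n then \<beta> (a' i) (b' j) else 0) \<in> filt \<P> (n + 1)"
    if "i \<in> neg_degs" "j \<in> neg_degs" for i j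
  proof (cases "i + j + l = n")
    case True
    have ij: "i + 1 \<le> 0" "j + 1 \<le> 0" "i \<le> 0" "j \<le> 0" using that by auto
    have "\<beta> (a i) (b j) - \<beta> (a' i) (b' j) = \<beta> (a i - a' i) (b j) + \<beta> (a' i) (b j - b' j)"
      by (simp add: bilinear_lsub[OF bil] bilinear_rsub[OF bil])
    also have "\<dots> \<in> filt \<P> (n + 1)"
    proof (rule filt_add)
      show "\<beta> (a i - a' i) (b j) \<in> filt \<P> (n + 1)"
        using deg[OF ij(1,4) lift_diff[OF x] lift_filt[OF y(1)]] True by (simp add: algebra_simps)
      show "\<beta> (a' i) (b j - b' j) \<in> filt \<P> (n + 1)"
        using deg[OF ij(3,2) lift_filt[OF x(2)] lift_diff[OF y]] True by (simp add: algebra_simps)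
    qed
    finally show ?thesis using True by simp
  qed (simp add: filt_0)
  then show ?thesis
    unfolding lift_map_def sum_subtractf[symmetric] by (intro filt_sum)
qed

lemma tuples_2: "[x, y] \<in> tuples 2 V \<longleftrightarrow> x \<in> vcarrier V \<and> y \<in> vcarrier V"
  by (simp add: tuples_def)

lemma tuples_2E:
  assumes "xs \<in> tuples 2 V" obtains x y where "xs = [x, y]" "x \<in> vcarrier V" "y \<in> vcarrier V"
proof -
  have "length xs = Suc (Suc 0)" using assms by (simp add: tuples_def)
  then obtain x y where "xs = [x, y]" by (auto simp: length_Suc_conv)
  with assms show thesis by (intro that[of x y]) (auto simp: tuples_def)
qed

lemma lift_graded_map:
  assumes "x \<in> vcarrier (neg_part \<P>)" "y \<in> vcarrier (neg_part \<P>)" and a: "lift x a" and b: "lift y b"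
  shows "lift (graded_map [x, y]) (lift_map a b)"
proof -
  define a' where "a' = (SOME a. lift x a)"
  define b' where "b' = (SOME b. lift y b)"
  have a': "lift x a'" unfolding a'_def by (rule someI[of "lift x", OF a])
  have b': "lift y b'" unfolding b'_def by (rule someI[of "lift y", OF b])
  have "lift (graded_map [x, y]) (lift_map a' b')"
    using assms(1,2) lift_map_filt[OF lift_filt[OF a'] lift_filt[OF b']]
    by (simp add: lift_def graded_map_def tuples_2 a'_def b'_def)
  then show ?thesis by (rule lift_cong) (rule lift_map_cong[OF a a' b b'])
qed

lemma lift_map_linear:
  "lift_map (\<lambda>i. a i + a' i) b n = lift_map a b n + lift_map a' b n"
  "lift_map a (\<lambda>i. b i + b' i) n = lift_map a b n + lift_map a b' n"
  "lift_map (\<lambda>i. r *\<^sub>R a i) b n = r *\<^sub>R lift_map a b n"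
  "lift_map a (\<lambda>i. r *\<^sub>R b i) n = r *\<^sub>R lift_map a b n"
  by (auto simp: lift_map_def bilinear_ladd[OF bil] bilinear_radd[OF bil] bilinear_lmul[OF bil]
      bilinear_rmul[OF bil] sum.distrib[symmetric] scaleR_sum_right intro!: sum.cong)

lemma lift_map_same: "lift_map a a n = 0"
proof -
  have "lift_map a a n = (\<Sum>j\<in>neg_degs. \<Sum>i\<in>neg_degs. if i + j + l = n then \<beta> (a i) (a j) else 0)"
    unfolding lift_map_def by (rule sum.swap)
  also have "\<dots> = - lift_map a a n"
    unfolding lift_map_def sum_negf[symmetric]
    by (intro sum.cong refl) (simp add: add.commute beta_anti[symmetric])
  finally have "2 *\<^sub>R lift_map a a n = 0" by (simp add: scaleR_2 eq_neg_iff_add_eq_0)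
  then show ?thesis by simp
qed

lemma graded_map_add1:
  assumes "x \<in> vcarrier (neg_part \<P>)" "x' \<in> vcarrier (neg_part \<P>)" "y \<in> vcarrier (neg_part \<P>)"
  shows "graded_map [vadd (gr \<P>) x x', y] = vadd (gr \<P>) (graded_map [x, y]) (graded_map [x', y])"
proof -
  obtain a a' b where L: "lift x a" "lift x' a'" "lift y b" using assms neg_part_lift by meson
  show ?thesis
    by (rule lift_eqI[OF lift_graded_map[OF neg_part_add[OF assms(1,2)] assms(3) lift_add[OF L(1,2)] L(3)]
          lift_add[OF lift_graded_map[OF assms(1,3) L(1,3)] lift_graded_map[OF assms(2,3) L(2,3)]]])
      (simp add: lift_map_linear filt_0)
qed

lemma graded_map_add2:
  assumes "x \<in> vcarrier (neg_part \<P>)" "y \<in> vcarrier (neg_part \<P>)" "y' \<in> vcarrier (neg_part \<P>)"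
  shows "graded_map [x, vadd (gr \<P>) y y'] = vadd (gr \<P>) (graded_map [x, y]) (graded_map [x, y'])"
proof -
  obtain a b b' where L: "lift x a" "lift y b" "lift y' b'" using assms neg_part_lift by meson
  show ?thesis
    by (rule lift_eqI[OF lift_graded_map[OF assms(1) neg_part_add[OF assms(2,3)] L(1) lift_add[OF L(2,3)]]
          lift_add[OF lift_graded_map[OF assms(1,2) L(1,2)] lift_graded_map[OF assms(1,3) L(1,3)]]])
      (simp add: lift_map_linear filt_0)
qed

lemma graded_map_scale:
  assumes "x \<in> vcarrier (neg_part \<P>)" "y \<in> vcarrier (neg_part \<P>)"
  shows "graded_map [vscale (gr \<P>) r x, y] = vscale (gr \<P>) r (graded_map [x, y])"
    and "graded_map [x, vscale (gr \<P>) r y] = vscale (gr \<P>) r (graded_map [x, y])"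
proof -
  obtain a b where L: "lift x a" "lift y b" using assms neg_part_lift by meson
  show "graded_map [vscale (gr \<P>) r x, y] = vscale (gr \<P>) r (graded_map [x, y])"
    by (rule lift_eqI[OF lift_graded_map[OF neg_part_scale[OF assms(1)] assms(2) lift_scale[OF L(1)] L(2)]
          lift_scale[OF lift_graded_map[OF assms L]]]) (simp add: lift_map_linear filt_0)
  show "graded_map [x, vscale (gr \<P>) r y] = vscale (gr \<P>) r (graded_map [x, y])"
    by (rule lift_eqI[OF lift_graded_map[OF assms(1) neg_part_scale[OF assms(2)] L(1) lift_scale[OF L(2)]]
          lift_scale[OF lift_graded_map[OF assms L]]]) (simp add: lift_map_linear filt_0)
qed

lemma graded_map_in_gr:
  assumes "x \<in> vcarrier (neg_part \<P>)" "y \<in> vcarrier (neg_part \<P>)"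
  shows "graded_map [x, y] \<in> vcarrier (gr \<P>)"
  using lift_graded_map[OF assms] neg_part_lift assms unfolding vcarrier_gr_iff by meson

lemma graded_map_gr_class:
  assumes "i < 0" "j < 0" "X \<in> filt \<P> i" "Y \<in> filt \<P> j"
  shows "graded_map [gr_class \<P> i X, gr_class \<P> j Y] = gr_class \<P> (i + j + l) (\<beta> X Y)"
proof -
  have ij: "i \<le> 0" "j \<le> 0" using assms by auto
  let ?a = "\<lambda>m. if m = i then X else 0" and ?b = "\<lambda>m. if m = j then Y else 0"
  have "lift_map ?a ?b n = (\<Sum>p\<in>neg_degs. if p = i then (\<Sum>q\<in>neg_degs. if q = j then
      (if i + j + l = n then \<beta> X Y else 0) else 0) else 0)" for n
    unfolding lift_map_def
    by (intro sum.cong refl) (auto simp: bilinear_lzero[OF bil] bilinear_rzero[OF bil] intro!: sum.cong sum.neutral)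
  then have L: "lift_map ?a ?b n = (if i \<in> neg_degs \<and> j \<in> neg_degs \<and> i + j + l = n then \<beta> X Y else 0)" for n
    by (simp add: sum.delta)
  \<comment> \<open>a class of degree below \<open>-\<mu>\<close> is zero, and so is the class of \<open>\<beta> X Y\<close> then\<close>
  have low: "\<beta> X Y \<in> filt \<P> (i + j + l + 1)" if "i \<notin> neg_degs \<or> j \<notin> neg_degs"
  proof (cases "i \<in> neg_degs")
    case False
    then have "X \<in> filt \<P> (i + 1)" using assms(1) by (simp add: filt_low)
    then show ?thesis using deg[of "i + 1" j X Y] assms by (simp add: algebra_simps)
  next
    case True
    then have "Y \<in> filt \<P> (j + 1)" using assms(2) that by (simp add: filt_low)
    then show ?thesis using deg[of i "j + 1" X Y] assms by (simp add: algebra_simps)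
  qed
  show ?thesis
    by (rule lift_eqI[OF lift_graded_map[OF gr_class_neg gr_class_neg lift_gr_class lift_gr_class]
          lift_gr_class[OF deg[OF ij assms(3,4)]]])
      (use assms low in \<open>auto simp: L filt_0 filt_neg simp del: atLeastAtMost_iff\<close>)
qed

lemma graded_map_cochain: "graded_map \<in> vcarrier (cochains \<P> 2)"
proof -
  have "vlinear (neg_part \<P>) (gr \<P>) (\<lambda>x. graded_map (xs[j := x]))"
    if xs: "xs \<in> tuples 2 (neg_part \<P>)" and j: "j < 2" for xs j
  proof -
    obtain x y where xy: "xs = [x, y]" "x \<in> vcarrier (neg_part \<P>)" "y \<in> vcarrier (neg_part \<P>)"
      using tuples_2E[OF xs] .
    have "j = 0 \<or> j = 1" using j by auto
    then show ?thesis
      using xy graded_map_in_gr graded_map_add1 graded_map_add2 graded_map_scale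
      by (auto simp: vlinear_def neg_part_ops)
  qed
  moreover have "graded_map xs \<in> vcarrier (gr \<P>) \<and> (\<not> distinct xs \<longrightarrow> graded_map xs = vzero (gr \<P>))"
    if xs: "xs \<in> tuples 2 (neg_part \<P>)" for xs
  proof -
    obtain x y where xy: "xs = [x, y]" "x \<in> vcarrier (neg_part \<P>)" "y \<in> vcarrier (neg_part \<P>)"
      using tuples_2E[OF xs] .
    obtain a where a: "lift x a" using neg_part_lift[OF xy(2)] ..
    have "graded_map [x, x] = vzero (gr \<P>)"
      by (rule lift_eqI[OF lift_graded_map[OF xy(2,2) a a] lift_zero]) (simp add: lift_map_same filt_0)
    then show ?thesis using xy graded_map_in_gr by auto
  qed
  ultimately show ?thesis by (simp add: cochains_def alt_maps_def graded_map_def)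
qed

lemma graded_map_cochains_deg: "graded_map \<in> vcarrier (cochains_deg \<P> 2 l)"
proof -
  have "graded_map xs \<in> gr_homog \<P> (sum_list is + l)"
    if H: "length is = 2" "length xs = 2" "\<forall>j<2. is ! j < 0 \<and> xs ! j \<in> gr_homog \<P> (is ! j)" for "is" xs
  proof -
    obtain i j where ij: "is = [i, j]" using H(1) by (auto simp: length_Suc_conv numeral_2_eq_2)
    obtain x y where xy: "xs = [x, y]" using H(2) by (auto simp: length_Suc_conv numeral_2_eq_2)
    have neg: "i < 0" "j < 0" and "x \<in> gr_homog \<P> i" "y \<in> gr_homog \<P> j"
      using H(3)[rule_format, of 0] H(3)[rule_format, of 1] by (auto simp: ij xy)
    then obtain X Y where XY: "x = gr_class \<P> i X" "X \<in> filt \<P> i" "y = gr_class \<P> j Y" "Y \<in> filt \<P> j"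
      by (auto simp: gr_homog_def)
    have "graded_map xs = gr_class \<P> (i + j + l) (\<beta> X Y)"
      unfolding xy XY(1,3) by (rule graded_map_gr_class[OF neg XY(2,4)])
    moreover have "\<beta> X Y \<in> filt \<P> (i + j + l)" using deg[of i j X Y] neg XY by simp
    ultimately show ?thesis by (simp add: gr_homog_def ij)
  qed
  with graded_map_cochain show ?thesis by (simp add: cochains_deg_def)
qed

lemma graded_map_unique:
  assumes \<phi>: "\<phi> \<in> vcarrier (cochains \<P> 2)"
    and eq: "\<And>i j X Y. i < 0 \<Longrightarrow> j < 0 \<Longrightarrow> X \<in> filt \<P> i \<Longrightarrow> Y \<in> filt \<P> j \<Longrightarrow>
      \<phi> [gr_class \<P> i X, gr_class \<P> j Y] = gr_class \<P> (i + j + l) (\<beta> X Y)"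
  shows "\<phi> = graded_map"
proof -
  let ?N = "vcarrier (neg_part \<P>)"
  have lin: "vlinear (neg_part \<P>) (gr \<P>) (\<lambda>x. \<phi> (xs[j := x]))"
    if "xs \<in> tuples 2 (neg_part \<P>)" "j < 2" for xs j
    using \<phi> that by (simp add: cochains_def alt_maps_def)
  have add1: "\<phi> [vadd (gr \<P>) x x', y] = vadd (gr \<P>) (\<phi> [x, y]) (\<phi> [x', y])"
    if "x \<in> ?N" "x' \<in> ?N" "y \<in> ?N" for x x' y
    using lin[of "[x, y]" 0] that by (simp add: vlinear_def tuples_2 neg_part_ops)
  have add2: "\<phi> [x, vadd (gr \<P>) y y'] = vadd (gr \<P>) (\<phi> [x, y]) (\<phi> [x, y'])"
    if "x \<in> ?N" "y \<in> ?N" "y' \<in> ?N" for x y y'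
    using lin[of "[x, y]" 1] that by (simp add: vlinear_def tuples_2 neg_part_ops)
  have "\<phi> [x, y] = graded_map [x, y]" if x: "x \<in> ?N" and y: "y \<in> ?N" for x y
    using x
  proof (induction x rule: neg_part_induct)
    case (1 i X)
    note iX = 1
    show ?case
      using y
    proof (induction y rule: neg_part_induct)
      case (1 j Y)
      then show ?case using eq graded_map_gr_class iX by simp
    next
      case (2 y y')
      then show ?case using add2 graded_map_add2 gr_class_neg[OF iX] by simp
    qed
  next
    case (2 x x')
    then show ?case using add1 graded_map_add1 y by simp
  qed
  then have eq': "\<phi> xs = graded_map xs" if "xs \<in> tuples 2 (neg_part \<P>)" for xs
    using tuples_2E[OF that] by metis
  show ?thesis
  proof (rule extensionalityI)
    show "\<phi> \<in> extensional (tuples 2 (neg_part \<P>))"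
      using \<phi> by (simp add: cochains_def alt_maps_def)
    show "graded_map \<in> extensional (tuples 2 (neg_part \<P>))" by (simp add: graded_map_def)
  qed (rule eq')
qed

text \<open>\<open>gr_map\<close> is a definite description. Its existence part is \<open>graded_map\<close>; uniqueness holds because
  classes of homogeneous elements generate the negative part.\<close>

lemma gr_map_eq_graded_map:
  assumes \<alpha>: "\<And>X Y. \<alpha> [pcoset \<P> X, pcoset \<P> Y] = \<beta> X Y"
  shows "gr_map \<P> 2 l \<alpha> = graded_map"
  unfolding gr_map_def
proof (rule the_equality, intro conjI allI impI graded_map_cochains_deg)
  fix "is" :: "int list" and Xs :: "'g list"
  assume H: "length is = 2 \<and> length Xs = 2 \<and> (\<forall>j<2. is ! j < 0 \<and> Xs ! j \<in> filt \<P> (is ! j))"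
  obtain i j where ij: "is = [i, j]" using H by (auto simp: length_Suc_conv numeral_2_eq_2)
  obtain X Y where XY: "Xs = [X, Y]" using H by (auto simp: length_Suc_conv numeral_2_eq_2)
  have "i < 0" "j < 0" "X \<in> filt \<P> i" "Y \<in> filt \<P> j"
    using H[THEN conjunct2, THEN conjunct2, rule_format, of 0]
      H[THEN conjunct2, THEN conjunct2, rule_format, of 1] by (auto simp: ij XY)
  then show "graded_map (map2 (gr_class \<P>) is Xs) = gr_class \<P> (sum_list is + l) (\<alpha> (map (pcoset \<P>) Xs))"
    by (simp add: ij XY \<alpha> graded_map_gr_class)
next
  fix \<phi>
  assume \<phi>: "\<phi> \<in> vcarrier (cochains_deg \<P> 2 l) \<and> (\<forall>is Xs. length is = 2 \<and> length Xs = 2 \<and>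
      (\<forall>j<2. is ! j < 0 \<and> Xs ! j \<in> filt \<P> (is ! j)) \<longrightarrow>
      \<phi> (map2 (gr_class \<P>) is Xs) = gr_class \<P> (sum_list is + l) (\<alpha> (map (pcoset \<P>) Xs)))"
  show "\<phi> = graded_map"
  proof (rule graded_map_unique)
    show "\<phi> \<in> vcarrier (cochains \<P> 2)" using \<phi> by (simp add: cochains_deg_def)
    show "\<phi> [gr_class \<P> i X, gr_class \<P> j Y] = gr_class \<P> (i + j + l) (\<beta> X Y)"
      if "i < 0" "j < 0" "X \<in> filt \<P> i" "Y \<in> filt \<P> j" for i j X Y
      using \<phi>[THEN conjunct2, rule_format, of "[i, j]" "[X, Y]"] that
      by (simp add: \<alpha> nth_Cons' less_2_cases_iff)
  qed
qed

end

section \<open>Cocycles of degree two\<close>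

context graded_cochain
begin

lemma codiff_2:
  assumes "x \<in> vcarrier (neg_part \<P>)" "y \<in> vcarrier (neg_part \<P>)" "z \<in> vcarrier (neg_part \<P>)"
  shows "codiff \<P> 2 \<phi> [x, y, z] = vadd (gr \<P>)
    (vsum (gr \<P>) [vscale (gr \<P>) 1 (gr_bracket \<P> x (\<phi> [y, z])),
      vscale (gr \<P>) (- 1) (gr_bracket \<P> y (\<phi> [x, z])),
      vscale (gr \<P>) 1 (gr_bracket \<P> z (\<phi> [x, y]))])
    (vsum (gr \<P>) [vscale (gr \<P>) (- 1) (\<phi> [gr_bracket \<P> x y, z]),
      vscale (gr \<P>) 1 (\<phi> [gr_bracket \<P> x z, y]),
      vscale (gr \<P>) (- 1) (\<phi> [gr_bracket \<P> y z, x])])"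
proof -
  have mem: "[x, y, z] \<in> tuples (Suc 2) (neg_part \<P>)" using assms by (simp add: tuples_def)
  have upt: "[0..<Suc 2] = [0, 1, 2]" "[0..<2] = [0, Suc 0]" by (simp_all add: upt_rec)
  show ?thesis using mem unfolding codiff_def upt
    by (simp add: upt nths_Cons Collect_conv_if numeral_2_eq_2)
qed

lemma sum_swap_innermost:
  "(\<Sum>m\<in>A. \<Sum>k\<in>B. \<Sum>i\<in>C. \<Sum>j\<in>D. h m k i j) = (\<Sum>k\<in>B. \<Sum>i\<in>C. \<Sum>j\<in>D. \<Sum>m\<in>A. h m k i j :: 'g)"
  by (simp only: sum.swap[where A = A])

lemma sum_degs_supported:
  assumes "\<And>i. i \<notin> neg_degs \<Longrightarrow> f i = 0" shows "(\<Sum>i\<in>degs. f i) = (\<Sum>i\<in>neg_degs. f i :: 'g)"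
  by (rule sum.mono_neutral_right) (use assms in auto)

text \<open>The degree \<open>n\<close> component of a trilinear expression of degree \<open>l\<close> in three lifts.\<close>

definition triple_sum :: "(int \<Rightarrow> int \<Rightarrow> int \<Rightarrow> 'g) \<Rightarrow> int \<Rightarrow> 'g" where
  "triple_sum g n = (\<Sum>i\<in>neg_degs. \<Sum>j\<in>neg_degs. \<Sum>k\<in>neg_degs. if i + j + k + l = n then g i j k else 0)"

lemma triple_sum_swap12: "triple_sum g n = triple_sum (\<lambda>j i k. g i j k) n"
  unfolding triple_sum_def by (subst sum.swap) (simp add: add_ac)

lemma triple_sum_swap23: "triple_sum g n = triple_sum (\<lambda>i k j. g i j k) n"
  unfolding triple_sum_def by (rule sum.cong[OF refl]) (subst sum.swap, simp add: add_ac)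

lemma triple_sum_linear:
  "triple_sum g n + triple_sum h n = triple_sum (\<lambda>i j k. g i j k + h i j k) n"
  "triple_sum g n - triple_sum h n = triple_sum (\<lambda>i j k. g i j k - h i j k) n"
  unfolding triple_sum_def
  by (auto simp: sum.distrib[symmetric] sum_subtractf[symmetric] intro!: sum.cong)

lemma triple_sum_filt:
  assumes "\<And>i j k. i < 0 \<Longrightarrow> j < 0 \<Longrightarrow> k < 0 \<Longrightarrow> g i j k \<in> filt \<P> (i + j + k + l + 1)"
  shows "triple_sum g n \<in> filt \<P> (n + 1)"
  unfolding triple_sum_def by (intro filt_sum) (use assms in \<open>auto simp: filt_0\<close>)

lemma bracket_lift_map:
  assumes "\<And>i. i \<notin> neg_degs \<Longrightarrow> a i = 0"
  shows "(\<Sum>i\<in>degs. br \<P> (a i) (lift_map b c (n - i))) = triple_sum (\<lambda>i j k. br \<P> (a i) (\<beta> (b j) (c k))) n"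
proof -
  have lin: "linear (br \<P> A)" for A using br_bilinear by (simp add: bilinear_def)
  have "(\<Sum>i\<in>degs. br \<P> (a i) (lift_map b c (n - i))) = (\<Sum>i\<in>neg_degs. br \<P> (a i) (lift_map b c (n - i)))"
    by (rule sum_degs_supported) (simp add: assms bilinear_lzero[OF br_bilinear])
  also have "\<dots> = triple_sum (\<lambda>i j k. br \<P> (a i) (\<beta> (b j) (c k))) n"
    unfolding lift_map_def triple_sum_def linear_sum[OF lin]
    by (intro sum.cong refl) (auto simp: bilinear_rzero[OF br_bilinear])
  finally show ?thesis .
qed

text \<open>The bracket of two negative elements may have lift components of degree below \<open>-\<mu>\<close>, which
  \<open>lift_map\<close> ignores; hence the two sides agree only modulo the next filtration step.\<close>

lemma lift_map_bracket:
  assumes a: "\<And>i. i \<notin> neg_degs \<Longrightarrow> a i = 0" and b: "\<And>i. i \<notin> neg_degs \<Longrightarrow> b i = 0"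
    and c: "\<And>i. c i \<in> filt \<P> i"
  shows "lift_map (\<lambda>m. \<Sum>i\<in>degs. br \<P> (a i) (b (m - i))) c n
    - triple_sum (\<lambda>i j k. \<beta> (br \<P> (a i) (b j)) (c k)) n \<in> filt \<P> (n + 1)"
proof -
  let ?g = "\<lambda>i j k. \<beta> (br \<P> (a i) (b j)) (c k)"
  have lin: "linear (\<lambda>A. \<beta> A C)" for C using bil by (simp add: bilinear_def)
  have bracket: "(\<Sum>i\<in>degs. br \<P> (a i) (b (m - i))) =
      (\<Sum>i\<in>neg_degs. \<Sum>j\<in>neg_degs. if m = i + j then br \<P> (a i) (b j) else 0)" for m
  proof -
    have "(\<Sum>j\<in>neg_degs. if m = i + j then br \<P> (a i) (b j) else 0) = br \<P> (a i) (b (m - i))" for i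
    proof -
      have "(\<Sum>j\<in>neg_degs. if m = i + j then br \<P> (a i) (b j) else 0) =
          (\<Sum>j\<in>neg_degs. if j = m - i then br \<P> (a i) (b (m - i)) else 0)"
        by (intro sum.cong refl) auto
      also have "\<dots> = br \<P> (a i) (b (m - i))"
        using b[of "m - i"] by (subst sum.delta) (auto simp: bilinear_rzero[OF br_bilinear])
      finally show ?thesis .
    qed
    then show ?thesis
      by (simp only:) (rule sum_degs_supported, simp add: a bilinear_lzero[OF br_bilinear])
  qed
  have "lift_map (\<lambda>m. \<Sum>i\<in>degs. br \<P> (a i) (b (m - i))) c n =
      (\<Sum>m\<in>neg_degs. \<Sum>k\<in>neg_degs. \<Sum>i\<in>neg_degs. \<Sum>j\<in>neg_degs.
        if m = i + j then (if i + j + k + l = n then ?g i j k else 0) else 0)"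
    unfolding lift_map_def bracket linear_sum[OF lin]
    by (intro sum.cong refl) (auto simp: bilinear_lzero[OF bil] intro!: sum.cong sum.neutral)
  also have "\<dots> = (\<Sum>k\<in>neg_degs. \<Sum>i\<in>neg_degs. \<Sum>j\<in>neg_degs. \<Sum>m\<in>neg_degs.
        if m = i + j then (if i + j + k + l = n then ?g i j k else 0) else 0)"
    by (rule sum_swap_innermost)
  also have "\<dots> = (\<Sum>k\<in>neg_degs. \<Sum>i\<in>neg_degs. \<Sum>j\<in>neg_degs.
        if i + j \<in> neg_degs then (if i + j + k + l = n then ?g i j k else 0) else 0)"
    by (simp only: sum.delta finite_atLeastAtMost_int)
  also have "\<dots> = triple_sum (\<lambda>k i j. if i + j \<in> neg_degs then ?g i j k else 0) n"
    unfolding triple_sum_def by (intro sum.cong refl) (simp add: add_ac)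
  also have "\<dots> = triple_sum (\<lambda>i j k. if i + j \<in> neg_degs then ?g i j k else 0) n"
    by (subst triple_sum_swap12, subst triple_sum_swap23) simp
  finally have eq: "lift_map (\<lambda>m. \<Sum>i\<in>degs. br \<P> (a i) (b (m - i))) c n - triple_sum ?g n =
      triple_sum (\<lambda>i j k. (if i + j \<in> neg_degs then ?g i j k else 0) - ?g i j k) n"
    by (simp only: triple_sum_linear)
  show ?thesis
    unfolding eq
  proof (rule triple_sum_filt)
    fix i j k :: int assume neg: "i < 0" "j < 0" "k < 0"
    \<comment> \<open>brackets of degree below \<open>-\<mu>\<close> vanish in the graded algebra\<close>
    have "?g i j k \<in> filt \<P> (i + j + k + l + 1)" if "i + j \<notin> neg_degs"
    proof -
      have "br \<P> (a i) (b j) \<in> filt \<P> (i + j + 1)" using that neg by (simp add: filt_low)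
      then show ?thesis using deg[of "i + j + 1" k _ "c k"] c neg by (simp add: algebra_simps)
    qed
    then show "(if i + j \<in> neg_degs then ?g i j k else 0) - ?g i j k \<in> filt \<P> (i + j + k + l + 1)"
      by (simp add: filt_0 filt_neg del: atLeastAtMost_iff)
  qed
qed

text \<open>A condition on \<open>\<beta>\<close> itself that makes the induced cochain a cocycle.\<close>

lemma codiff_graded_map_eq_zero:
  assumes cocycle: "\<And>i j k A B C. i < 0 \<Longrightarrow> j < 0 \<Longrightarrow> k < 0 \<Longrightarrow>
      A \<in> filt \<P> i \<Longrightarrow> B \<in> filt \<P> j \<Longrightarrow> C \<in> filt \<P> k \<Longrightarrow>
      br \<P> A (\<beta> B C) + br \<P> B (\<beta> C A) + br \<P> C (\<beta> A B)
        - \<beta> (br \<P> A B) C - \<beta> (br \<P> B C) A - \<beta> (br \<P> C A) B \<in> filt \<P> (i + j + k + l + 1)"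
  shows "codiff \<P> 2 graded_map = vzero (cochains \<P> 3)"
proof -
  let ?N = "vcarrier (neg_part \<P>)"
  have anti: "br \<P> X Y = - br \<P> Y X" for X Y
    using flt lie_algebra_anti by (auto simp: filtered_lie_algebra_def)
  have zero: "codiff \<P> 2 graded_map [x, y, z] = vzero (gr \<P>)" if xyz: "x \<in> ?N" "y \<in> ?N" "z \<in> ?N" for x y z
  proof -
    obtain a b c where a: "lift x a" "\<And>i. i \<notin> neg_degs \<Longrightarrow> a i = 0"
      and b: "lift y b" "\<And>i. i \<notin> neg_degs \<Longrightarrow> b i = 0"
      and c: "lift z c" "\<And>i. i \<notin> neg_degs \<Longrightarrow> c i = 0"
      using xyz unfolding neg_part_iff by blast
    define brl where "brl a b = (\<lambda>n. \<Sum>i\<in>degs. br \<P> (a i) (b (n - i)))" for a b :: "int \<Rightarrow> 'g"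
    note L = lift_bracket[folded brl_def]
    define d where "d n = (1 *\<^sub>R brl a (lift_map b c) n + ((- 1) *\<^sub>R brl b (lift_map a c) n +
          (1 *\<^sub>R brl c (lift_map a b) n + 0))) +
        ((- 1) *\<^sub>R lift_map (brl a b) c n + (1 *\<^sub>R lift_map (brl a c) b n +
          ((- 1) *\<^sub>R lift_map (brl b c) a n + 0)))" for n
    have "lift (codiff \<P> 2 graded_map [x, y, z]) d"
      unfolding codiff_2[OF xyz] vsum_def foldr.simps o_apply id_apply d_def
      by (intro lift_add lift_scale lift_zero L lift_graded_map neg_part_bracket xyz a(1) b(1) c(1))
    then show ?thesis
    proof (rule lift_eqI[OF _ lift_zero])
      fix n
      let ?t = "\<lambda>g. triple_sum g n"
      let ?g4 = "\<lambda>i j k. \<beta> (br \<P> (a i) (b j)) (c k)" and ?g5 = "\<lambda>i k j. \<beta> (br \<P> (a i) (c k)) (b j)"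
        and ?g6 = "\<lambda>j k i. \<beta> (br \<P> (b j) (c k)) (a i)"
      let ?d4 = "lift_map (brl a b) c n - ?t ?g4" and ?d5 = "lift_map (brl a c) b n - ?t ?g5"
        and ?d6 = "lift_map (brl b c) a n - ?t ?g6"
      have d4: "?d4 \<in> filt \<P> (n + 1)"
        unfolding brl_def by (rule lift_map_bracket[OF a(2) b(2) lift_filt[OF c(1)]])
      have d5: "?d5 \<in> filt \<P> (n + 1)"
        unfolding brl_def by (rule lift_map_bracket[OF a(2) c(2) lift_filt[OF b(1)]])
      have d6: "?d6 \<in> filt \<P> (n + 1)"
        unfolding brl_def by (rule lift_map_bracket[OF b(2) c(2) lift_filt[OF a(1)]])
      have t1: "brl a (lift_map b c) n = ?t (\<lambda>i j k. br \<P> (a i) (\<beta> (b j) (c k)))"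
        unfolding brl_def by (rule bracket_lift_map[OF a(2)])
      have t2: "brl b (lift_map a c) n = ?t (\<lambda>i j k. br \<P> (b j) (\<beta> (a i) (c k)))"
        unfolding brl_def by (rule trans[OF bracket_lift_map[OF b(2)] triple_sum_swap12])
      have t3: "brl c (lift_map a b) n = ?t (\<lambda>i j k. br \<P> (c k) (\<beta> (a i) (b j)))"
        unfolding brl_def
        by (rule trans[OF bracket_lift_map[OF c(2)] trans[OF triple_sum_swap12 triple_sum_swap23]])
      have t5: "?t ?g5 = ?t (\<lambda>i j k. \<beta> (br \<P> (a i) (c k)) (b j))" by (rule triple_sum_swap23)
      have t6: "?t ?g6 = ?t (\<lambda>i j k. \<beta> (br \<P> (b j) (c k)) (a i))"
        by (rule trans[OF triple_sum_swap23 triple_sum_swap12])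
      have "d n = (brl a (lift_map b c) n - brl b (lift_map a c) n + brl c (lift_map a b) n
          - ?t ?g4 + ?t ?g5 - ?t ?g6) + (- ?d4 + ?d5 - ?d6)"
        by (simp add: d_def)
      also have "\<dots> = ?t (\<lambda>i j k. br \<P> (a i) (\<beta> (b j) (c k)) - br \<P> (b j) (\<beta> (a i) (c k))
          + br \<P> (c k) (\<beta> (a i) (b j)) - ?g4 i j k + ?g5 i k j - ?g6 j k i) + (- ?d4 + ?d5 - ?d6)"
        unfolding t1 t2 t3 t5 t6 triple_sum_linear ..
      also have "\<dots> \<in> filt \<P> (n + 1)"
      proof (rule filt_add)
        show "- ?d4 + ?d5 - ?d6 \<in> filt \<P> (n + 1)" by (intro filt_diff filt_add filt_neg d4 d5 d6)
        show "?t (\<lambda>i j k. br \<P> (a i) (\<beta> (b j) (c k)) - br \<P> (b j) (\<beta> (a i) (c k))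
          + br \<P> (c k) (\<beta> (a i) (b j)) - ?g4 i j k + ?g5 i k j - ?g6 j k i) \<in> filt \<P> (n + 1)"
        proof (rule triple_sum_filt)
          fix i j k :: int assume neg: "i < 0" "j < 0" "k < 0"
          have s2: "br \<P> (b j) (\<beta> (c k) (a i)) = - br \<P> (b j) (\<beta> (a i) (c k))"
            by (subst beta_anti) (rule bilinear_rneg[OF br_bilinear])
          have s5: "\<beta> (br \<P> (c k) (a i)) (b j) = - \<beta> (br \<P> (a i) (c k)) (b j)"
            by (subst anti) (rule bilinear_lneg[OF bil])
          show "br \<P> (a i) (\<beta> (b j) (c k)) - br \<P> (b j) (\<beta> (a i) (c k))
              + br \<P> (c k) (\<beta> (a i) (b j)) - ?g4 i j k + ?g5 i k j - ?g6 j k i \<in> filt \<P> (i + j + k + l + 1)"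
            using cocycle[OF neg lift_filt[OF a(1)] lift_filt[OF b(1)] lift_filt[OF c(1)]]
            unfolding s2 s5 by (simp add: algebra_simps)
        qed
      qed
      finally show "d n - 0 \<in> filt \<P> (n + 1)" by simp
    qed
  qed
  show ?thesis
  proof
    fix xs
    show "codiff \<P> 2 graded_map xs = vzero (cochains \<P> 3) xs"
    proof (cases "xs \<in> tuples 3 (neg_part \<P>)")
      case True
      then have "length xs = Suc (Suc (Suc 0))" by (simp add: tuples_def)
      then obtain x y z where xs: "xs = [x, y, z]" by (auto simp: length_Suc_conv)
      with True have "x \<in> ?N" "y \<in> ?N" "z \<in> ?N" by (auto simp: tuples_def)
      from zero[OF this] True show ?thesis by (simp add: xs cochains_def alt_maps_def)
    next
      case False
      then show ?thesis by (simp add: codiff_def cochains_def alt_maps_def eval_nat_numeral)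
    qed
  qed
qed

end

section \<open>Horizontality of the curvature and the Bianchi identity\<close>

locale admissible_cartan_geometry =
  fixes \<P> :: "('g::real_normed_vector, 'p::{t2_space,second_countable_topology},
                'h::real_normed_vector) pair"
    and \<G> :: "('u::{t2_space,second_countable_topology}, 'e::real_normed_vector,
                'm::{t2_space,second_countable_topology}, 'f::real_normed_vector, 'g, 'p) geometry"
  assumes adm: "admissible_pair \<P>" and cg: "cartan_geometry \<P> \<G>"
begin

lemma tot_manifold: "smooth_manifold (tot_atlas \<G>)"
  and conn_form: "smooth_one_form (tot_atlas \<G>) (conn \<G>)"
  and conn_bij: "bij_betw (conn \<G> u) (vcarrier (tangent_space (tot_atlas \<G>) u)) UNIV"
  using cg by (auto simp: cartan_geometry_def principal_bundle_def)

lemma grp_manifold: "smooth_manifold (grp_atlas \<P>)" and grp_group: "group (grp \<P>)"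
  and grp_carrier: "carrier (grp \<P>) = UNIV"
  using adm unfolding admissible_pair_def lie_group_def by blast+

lemma pair_filtered: "filtered_lie_algebra \<P>"
  using adm unfolding admissible_pair_def by (rule conjunct1)

lemma pair_lie_algebra: "lie_algebra (br \<P>)"
  using pair_filtered unfolding filtered_lie_algebra_def by (rule conjunct1)

sublocale filtered_pair \<P>
  by unfold_locales (rule pair_filtered)

lemma curvature_in_chart:
  assumes c: "c \<in> charts_at (tot_atlas \<G>) u"
    and \<xi>: "\<xi> \<in> vcarrier (tangent_space (tot_atlas \<G>) u)"
    and \<eta>: "\<eta> \<in> vcarrier (tangent_space (tot_atlas \<G>) u)"
  defines "W \<equiv> local_form (tot_atlas \<G>) (conn \<G>) c"
  shows "curvature \<P> \<G> u \<xi> \<eta> = exterior_derivative W (cmap c u) (\<xi> c) (\<eta> c)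
    + br \<P> (W (cmap c u) (\<xi> c)) (W (cmap c u) (\<eta> c))"
  unfolding curvature_def W_def ext_deriv_in_chart[OF tot_manifold conn_form c \<xi> \<eta>]
    local_form_coordinate[OF tot_manifold conn_form c \<xi>]
    local_form_coordinate[OF tot_manifold conn_form c \<eta>] ..

lemma Ad_facts:
  shows Ad_Aut: "Ad \<P> g \<in> Aut_f \<P>"
    and Ad_mult: "Ad \<P> (g \<otimes>\<^bsub>grp \<P>\<^esub> h) = Ad \<P> g \<circ> Ad \<P> h"
    and Ad_smooth: "smooth_map_on UNIV (grp_atlas \<P>) {vec_chart} (\<lambda>g. Ad \<P> g Z)"
    and Ad_tangent: "X \<in> filt \<P> 0 \<Longrightarrow>
      tangent_map (grp_atlas \<P>) {vec_chart} (\<lambda>g. Ad \<P> g Z) \<one>\<^bsub>grp \<P>\<^esub> (lie_id \<P> X) vec_chart = br \<P> X Z"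
  using adm unfolding admissible_pair_def by blast+

lemma Ad_one: "Ad \<P> \<one>\<^bsub>grp \<P>\<^esub> X = X"
proof -
  interpret group "grp \<P>" by (rule grp_group)
  have "bij (Ad \<P> \<one>\<^bsub>grp \<P>\<^esub>)" using Ad_Aut by (simp add: Aut_f_def)
  with Ad_mult[of "\<one>\<^bsub>grp \<P>\<^esub>" "\<one>\<^bsub>grp \<P>\<^esub>"] show ?thesis
    by (metis bij_is_inj comp_apply injD l_one one_closed)
qed

lemma Ad_inv: "Ad \<P> g (Ad \<P> (m_inv (grp \<P>) g) X) = X"
proof -
  interpret group "grp \<P>" by (rule grp_group)
  have "g \<otimes>\<^bsub>grp \<P>\<^esub> m_inv (grp \<P>) g = \<one>\<^bsub>grp \<P>\<^esub>" by (rule r_inv) (simp add: grp_carrier)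
  then show ?thesis using Ad_mult[of g "m_inv (grp \<P>) g"] by (metis Ad_one comp_apply)
qed

lemma Ad_linear: "linear (Ad \<P> g)"
  using Ad_Aut by (simp add: Aut_f_def)

lemma Ad_has_derivative:
  fixes k defines "k \<equiv> some_chart (grp_atlas \<P>) \<one>\<^bsub>grp \<P>\<^esub>"
  obtains a where "\<And>Z. ((\<lambda>y. Ad \<P> (cinv k y) Z) has_derivative a Z) (at (cmap k \<one>\<^bsub>grp \<P>\<^esub>))"
    "\<And>X Z. X \<in> filt \<P> 0 \<Longrightarrow> a Z (lie_id \<P> X k) = br \<P> X Z"
proof -
  have k: "k \<in> charts_at (grp_atlas \<P>) \<one>\<^bsub>grp \<P>\<^esub>"
    unfolding k_def by (rule some_chart_in[OF grp_manifold])
  then have kA: "k \<in> grp_atlas \<P>" "\<one>\<^bsub>grp \<P>\<^esub> \<in> cdom k" by (auto simp: charts_at_def)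
  define a where "a Z = frechet_derivative (\<lambda>y. Ad \<P> (cinv k y) Z) (at (cmap k \<one>\<^bsub>grp \<P>\<^esub>))" for Z
  have vec: "cmap vec_chart \<circ> (\<lambda>g. Ad \<P> g Z) \<circ> cinv k = (\<lambda>y. Ad \<P> (cinv k y) Z)" for Z
    by (simp add: vec_chart_def comp_def)
  have "smooth_on (cmap k ` (UNIV \<inter> cdom k \<inter> (\<lambda>g. Ad \<P> g Z) -` cdom vec_chart)) (\<lambda>y. Ad \<P> (cinv k y) Z)" for Z
    using kA(1) Ad_smooth[of Z] unfolding smooth_map_on_def vec[symmetric] by blast
  then have 1: "((\<lambda>y. Ad \<P> (cinv k y) Z) has_derivative a Z) (at (cmap k \<one>\<^bsub>grp \<P>\<^esub>))" for Z
    unfolding a_def by (rule smooth_on_has_derivative) (use kA in \<open>auto simp: vec_chart_def\<close>)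
  have 2: "a Z (lie_id \<P> X k) = br \<P> X Z" if "X \<in> filt \<P> 0" for X Z
  proof -
    show ?thesis
      using Ad_tangent[OF that, of Z] unfolding tangent_map_def k_def[symmetric] vec a_def by (simp add: charts_at_def vec_chart_def)
  qed
  from 1 2 show thesis by (rule that)
qed

text \<open>
  The curvature is horizontal. Let \<open>F(z, y)\<close> be the principal right action in coordinates, with \<open>z\<close> on
  the total space and \<open>y\<close> on the group, and let \<open>\<xi>\<close> be the coordinate vector of \<open>X\<close>. Two relations are
  differentiated: \<open>W(z)(D\<^sub>2F(z, e)\<xi>) = X\<close> in \<open>z\<close>, and the equivariance relation
  \<open>Ad(g)(W(F(z0, y))(D\<^sub>1F(z0, y)x)) = W(z0)x\<close> in \<open>y\<close> in the direction \<open>\<xi>\<close>. The mixed second derivatives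
  of \<open>F\<close> cancel in the difference, which is \<open>dW(\<zeta>, x) + [X, W(z0)x] = 0\<close> for the vertical vector \<open>\<zeta>\<close>
  generated by \<open>X\<close>.
\<close>

lemma curvature_vertical:
  assumes X: "X \<in> filt \<P> 0" and \<eta>: "\<eta> \<in> vcarrier (tangent_space (tot_atlas \<G>) u)"
    and \<zeta>: "\<zeta> \<in> vcarrier (tangent_space (tot_atlas \<G>) u)" and \<zeta>X: "conn \<G> u \<zeta> = X"
  shows "curvature \<P> \<G> u \<zeta> \<eta> = 0"
proof -
  let ?A = "tot_atlas \<G>"
  note M = tot_manifold
  define c where "c = some_chart ?A u"
  define k where "k = some_chart (grp_atlas \<P>) \<one>\<^bsub>grp \<P>\<^esub>"
  define W where "W = local_form ?A (conn \<G>) c"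
  define R where "R p = (case p of (v, g) \<Rightarrow> ract \<G> v g)" for p
  have c: "c \<in> charts_at ?A u" unfolding c_def by (rule some_chart_in[OF M])
  then have cA: "c \<in> ?A" "u \<in> cdom c" by (auto simp: charts_at_def)
  have "k \<in> charts_at (grp_atlas \<P>) \<one>\<^bsub>grp \<P>\<^esub>" unfolding k_def by (rule some_chart_in[OF grp_manifold])
  then have kA: "k \<in> grp_atlas \<P>" "\<one>\<^bsub>grp \<P>\<^esub> \<in> cdom k" by (auto simp: charts_at_def)
  define z0 where "z0 = cmap c u"
  define y0 where "y0 = cmap k \<one>\<^bsub>grp \<P>\<^esub>"
  define \<xi> where "\<xi> = lie_id \<P> X k"
  have cu: "cinv c z0 = u" and k1: "cinv k y0 = \<one>\<^bsub>grp \<P>\<^esub>"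
    using cinv_cmap[OF M cA] cinv_cmap[OF grp_manifold kA] by (simp_all add: z0_def y0_def)
  have z0_in: "z0 \<in> cmap c ` cdom c" and y0_in: "y0 \<in> cmap k ` cdom k"
    using cA kA by (auto simp: z0_def y0_def)
  have R1: "ract \<G> v \<one>\<^bsub>grp \<P>\<^esub> = v" for v
    using cg by (simp add: cartan_geometry_def principal_bundle_def)
  \<comment> \<open>the action in coordinates\<close>
  define pc where "pc = (cdom c \<times> cdom k, map_prod (cmap c) (cmap k))"
  have inj: "inj_on (map_prod (cmap c) (cmap k)) (cdom c \<times> cdom k)"
    using cinv_cmap[OF M cA(1)] cinv_cmap[OF grp_manifold kA(1)]
    by (intro map_prod_inj_on inj_on_inverseI) 
  have cinv_pc: "cinv pc (z, y) = (cinv c z, cinv k y)" if "z \<in> cmap c ` cdom c" "y \<in> cmap k ` cdom k" for z y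
    unfolding pc_def fst_conv snd_conv
    by (rule inv_into_f_eq[OF inj])
      (use that cmap_cinv[OF M cA(1)] cinv_in[OF M cA(1)] cmap_cinv[OF grp_manifold kA(1)]
        cinv_in[OF grp_manifold kA(1)] in auto)
  define F where "F = cmap c \<circ> R \<circ> cinv pc"
  define Dom where "Dom = cmap pc ` (UNIV \<inter> cdom pc \<inter> R -` cdom c)"
  have R_smooth: "smooth_map_on UNIV (prod_atlas ?A (grp_atlas \<P>)) ?A R"
    using cg unfolding cartan_geometry_def principal_bundle_def R_def by (simp add: case_prod_unfold)
  have "pc \<in> prod_atlas ?A (grp_atlas \<P>)" 
    unfolding prod_atlas_def pc_def by (intro CollectI exI[of _ c] exI[of _ k]) (simp add: cA kA)
  then have F_smooth: "smooth_on Dom F"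
    using R_smooth cA(1) unfolding smooth_map_on_def F_def Dom_def by blast
  have Dom_iff: "(z, y) \<in> Dom \<longleftrightarrow> z \<in> cmap c ` cdom c \<and> y \<in> cmap k ` cdom k \<and>
      ract \<G> (cinv c z) (cinv k y) \<in> cdom c" for z y
  proof
    show "z \<in> cmap c ` cdom c \<and> y \<in> cmap k ` cdom k \<and> ract \<G> (cinv c z) (cinv k y) \<in> cdom c"
      if "(z, y) \<in> Dom"
      using that cinv_cmap[OF M cA(1)] cinv_cmap[OF grp_manifold kA(1)]
      by (auto simp: Dom_def pc_def R_def)
    show "(z, y) \<in> Dom"
      if "z \<in> cmap c ` cdom c \<and> y \<in> cmap k ` cdom k \<and> ract \<G> (cinv c z) (cinv k y) \<in> cdom c"
      unfolding Dom_def
      by (rule image_eqI[of _ _ "(cinv c z, cinv k y)"])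
        (use that cmap_cinv[OF M cA(1)] cinv_in[OF M cA(1)] cmap_cinv[OF grp_manifold kA(1)]
          cinv_in[OF grp_manifold kA(1)] in \<open>auto simp: pc_def R_def\<close>)
  qed
  have F_eq: "F (z, y) = cmap c (ract \<G> (cinv c z) (cinv k y))" if "(z, y) \<in> Dom" for z y
    using that by (simp add: Dom_iff F_def cinv_pc R_def)
  have Dom_open: "open Dom"
  proof -
    let ?I = "cmap c ` cdom c \<times> cmap k ` cdom k"
    have cont: "continuous_on ?I (\<lambda>p. R (cinv c (fst p), cinv k (snd p)))"
    proof (rule continuous_on_compose2[of UNIV R])
      show "continuous_on UNIV R" using R_smooth by (simp add: smooth_map_on_def)
      show "continuous_on ?I (\<lambda>p. (cinv c (fst p), cinv k (snd p)))"
        by (intro continuous_on_Pair continuous_on_compose2[OF chart_continuous(2)[OF M cA(1)]]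
            continuous_on_compose2[OF chart_continuous(2)[OF grp_manifold kA(1)]] continuous_intros) auto
    qed auto
    have I: "open ?I" by (intro open_Times chart_open[OF M cA(1)] chart_open[OF grp_manifold kA(1)])
    have "Dom = ?I \<inter> (\<lambda>p. R (cinv c (fst p), cinv k (snd p))) -` cdom c"
      by (auto simp: Dom_iff R_def)
    then show ?thesis using continuous_open_preimage[OF cont I chart_open(1)[OF M cA(1)]] by simp
  qed
  have p0: "(z0, y0) \<in> Dom" using z0_in y0_in cA by (simp add: Dom_iff cu k1 R1)
  define DF where "DF p v = frechet_derivative F (at p) v" for p v
  define D2F where "D2F v h = frechet_derivative (\<lambda>p. DF p v) (at (z0, y0)) h" for v h
  have F': "(F has_derivative DF p) (at p)" if "p \<in> Dom" for p
    unfolding DF_def using smooth_on_has_derivative[OF F_smooth that] .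
  have F'': "((\<lambda>p. DF p v) has_derivative D2F v) (at (z0, y0))" for v
    using smooth_on_has_second_derivative[OF F_smooth p0] by (simp add: DF_def D2F_def[abs_def])
  have D2F_sym: "D2F v w = D2F w v" for v w
    by (rule symmetric_second_derivative[OF Dom_open p0 F' F'' F''])
  have slice1: "((\<lambda>z. (z, y)) has_derivative (\<lambda>h. (h, 0))) (at z)" for z :: 'e and y :: 'h
    by (auto intro!: derivative_eq_intros)
  have slice2: "((\<lambda>y. (z, y)) has_derivative (\<lambda>h. (0, h))) (at y)" for z :: 'e and y :: 'h
    by (auto intro!: derivative_eq_intros)
  have slice1_open: "open {z. (z, y) \<in> Dom}" for y
    using open_vimage[OF Dom_open, of "\<lambda>z. (z, y)"] by (simp add: vimage_def continuous_on_Pair)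
  have slice2_open: "open {y. (z, y) \<in> Dom}" for z
    using open_vimage[OF Dom_open, of "\<lambda>y. (z, y)"] by (simp add: vimage_def continuous_on_Pair)
  have F1: "((\<lambda>z. F (z, y)) has_derivative (\<lambda>h. DF (z, y) (h, 0))) (at z)" if "(z, y) \<in> Dom" for z y
    using has_derivative_compose[OF slice1 F'[OF that]] .
  have F2: "((\<lambda>y. F (z, y)) has_derivative (\<lambda>h. DF (z, y) (0, h))) (at y)" if "(z, y) \<in> Dom" for z y
    using has_derivative_compose[OF slice2 F'[OF that]] .
  have Fz: "F (z, y0) = z" if "(z, y0) \<in> Dom" for z
    using that F_eq[OF that] cmap_cinv[OF M cA(1)] by (simp add: Dom_iff k1 R1)
  have DF_x: "DF (z0, y0) (x, 0) = x" for x
  proof -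
    have "((\<lambda>z. z) has_derivative (\<lambda>h. h)) (at z0)" by (rule has_derivative_ident)
    then have "((\<lambda>z. F (z, y0)) has_derivative (\<lambda>h. h)) (at z0)"
      by (rule has_derivative_transform_within_open[OF _ slice1_open[of y0]]) (use p0 Fz in auto)
    from has_derivative_unique[OF F1[OF p0] this] show ?thesis by (rule fun_cong)
  qed
  have W_lin: "linear (W z)" if "z \<in> cmap c ` cdom c" for z
    unfolding W_def using local_form_linear[OF M conn_form cA(1) that] .
  define DW where "DW h x = frechet_derivative (\<lambda>z. W z x) (at z0) h" for h x
  have W': "((\<lambda>z. W z x) has_derivative (\<lambda>h. DW h x)) (at z0)" for x
    unfolding DW_def W_def using smooth_on_has_derivative[OF local_form_smooth[OF M conn_form cA(1)] z0_in] .
  have fde: "finite_dim TYPE('e)" using M by (simp add: smooth_manifold_def)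
  have fdg: "finite_dim TYPE('g)" using pair_lie_algebra by (simp add: lie_algebra_def)
  define \<zeta>0 where "\<zeta>0 = DF (z0, y0) (0, \<xi>)"
  \<comment> \<open>\<open>\<omega>\<close> reproduces the generators of fundamental vector fields\<close>
  have fund: "fundamental_field \<P> \<G> X v = tvec_of ?A v c (DF (z, y0) (0, \<xi>))"
    "W z (DF (z, y0) (0, \<xi>)) = X"
    if z: "(z, y0) \<in> Dom" and v: "v = cinv c z" for z v
  proof -
    define q where "q y = ract \<G> v (cinv k y)" for y
    have q0: "q y0 = v" by (simp add: q_def k1 R1)
    have comp_q: "cmap d \<circ> (\<lambda>g. ract \<G> v g) \<circ> cinv k = cmap d \<circ> q" for d :: "('u, 'e) chart"
      by (simp add: q_def fun_eq_iff)
    have family: "(\<lambda>d. if d \<in> charts_at ?A (q y0) then frechet_derivative (cmap d \<circ> q) (at y0) \<xi> else 0) =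
        tvec_of ?A (q y0) c (DF (z, y0) (0, \<xi>))"
    proof (rule tangent_family_eq_tvec_of[OF M cA(1) slice2_open[of z]])
      show "y0 \<in> {y. (z, y) \<in> Dom}" using z by simp
      show "q y \<in> cdom c" if "y \<in> {y. (z, y) \<in> Dom}" for y
        using that v by (simp add: Dom_iff q_def)
      show "((cmap c \<circ> q) has_derivative (\<lambda>h. DF (z, y0) (0, h))) (at y0)"
        using F2[OF z] slice2_open[of z]
        by (rule has_derivative_transform_within_open) (use z F_eq v in \<open>auto simp: q_def\<close>)
    qed
    show ff: "fundamental_field \<P> \<G> X v = tvec_of ?A v c (DF (z, y0) (0, \<xi>))"
      unfolding fundamental_field_def tangent_map_def k_def[symmetric] y0_def[symmetric]
        \<xi>_def[symmetric] R1 comp_q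
      by (rule family[unfolded q0])
    have "conn \<G> v (fundamental_field \<P> \<G> X v) = X" using cg X by (simp add: cartan_geometry_def)
    then show "W z (DF (z, y0) (0, \<xi>)) = X" by (simp add: ff W_def local_form_def v[symmetric])
  qed
  have rel1: "DW h \<zeta>0 + W z0 (D2F (0, \<xi>) (h, 0)) = 0" for h
  proof -
    have 1: "((\<lambda>z. DF (z, y0) (0, \<xi>)) has_derivative (\<lambda>h. D2F (0, \<xi>) (h, 0))) (at z0)"
      using has_derivative_compose[OF slice1 F''] .
    have "((\<lambda>z. W z (DF (z, y0) (0, \<xi>))) has_derivative
        (\<lambda>h. DW h \<zeta>0 + W z0 (D2F (0, \<xi>) (h, 0)))) (at z0)"
      unfolding \<zeta>0_def
      by (rule has_derivative_linear_family[OF fde chart_open(2)[OF M cA(1)] z0_in W_lin W' 1])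
    moreover have "((\<lambda>z. W z (DF (z, y0) (0, \<xi>))) has_derivative (\<lambda>h. 0)) (at z0)"
      using has_derivative_const[of X] slice1_open[of y0]
      by (rule has_derivative_transform_within_open) (use p0 fund(2) in auto)
    ultimately have "(\<lambda>h. DW h \<zeta>0 + W z0 (D2F (0, \<xi>) (h, 0))) = (\<lambda>h. 0)"
      by (rule has_derivative_unique)
    then show ?thesis by (rule fun_cong)
  qed
  \<comment> \<open>\<open>\<omega>\<close> is equivariant\<close>
  have equiv: "Ad \<P> (cinv k y) (W (F (z0, y)) (DF (z0, y) (x, 0))) = W z0 x" if y: "(z0, y) \<in> Dom" for x y
  proof -
    define g where "g = cinv k y"
    define q where "q z = ract \<G> (cinv c z) g" for z
    have qz0: "q z0 = ract \<G> u g" by (simp add: q_def cu)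
    have comp_q: "cmap d \<circ> (\<lambda>v. ract \<G> v g) \<circ> cinv c = cmap d \<circ> q" for d :: "('u, 'e) chart"
      by (simp add: q_def fun_eq_iff)
    have family: "(\<lambda>d. if d \<in> charts_at ?A (q z0) then frechet_derivative (cmap d \<circ> q) (at z0) x else 0) =
        tvec_of ?A (q z0) c (DF (z0, y) (x, 0))"
    proof (rule tangent_family_eq_tvec_of[OF M cA(1) slice1_open[of y]])
      show "z0 \<in> {z. (z, y) \<in> Dom}" using y by simp
      show "q z \<in> cdom c" if "z \<in> {z. (z, y) \<in> Dom}" for z
        using that by (simp add: Dom_iff q_def g_def)
      show "((cmap c \<circ> q) has_derivative (\<lambda>h. DF (z0, y) (h, 0))) (at z0)"
        using F1[OF y] slice1_open[of y]
        by (rule has_derivative_transform_within_open) (use y F_eq in \<open>auto simp: q_def g_def\<close>)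
    qed
    have tm: "tangent_map ?A ?A (\<lambda>v. ract \<G> v g) u (tvec_of ?A u c x) =
        tvec_of ?A (ract \<G> u g) c (DF (z0, y) (x, 0))"
      unfolding tangent_map_def c_def[symmetric] z0_def[symmetric] tvec_of_same[OF M c] comp_q
      by (rule family[unfolded qz0])
    have "ract \<G> u g \<in> cdom c" using y by (simp add: Dom_iff cu g_def)
    then have "W (F (z0, y)) (DF (z0, y) (x, 0)) = conn \<G> (ract \<G> u g) (tvec_of ?A (ract \<G> u g) c (DF (z0, y) (x, 0)))"
      using F_eq[OF y] cinv_cmap[OF M cA(1)] by (simp add: W_def local_form_def cu g_def)
    also have "\<dots> = Ad \<P> (m_inv (grp \<P>) g) (conn \<G> u (tvec_of ?A u c x))"
      unfolding tm[symmetric] using cg tvec_of_in[OF M c] by (simp add: cartan_geometry_def)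
    also have "conn \<G> u (tvec_of ?A u c x) = W z0 x" by (simp add: W_def local_form_def cu)
    finally show ?thesis by (simp add: Ad_inv g_def)
  qed
  obtain a where a: "\<And>Z. ((\<lambda>y. Ad \<P> (cinv k y) Z) has_derivative a Z) (at y0)"
    "\<And>X Z. X \<in> filt \<P> 0 \<Longrightarrow> a Z (lie_id \<P> X k) = br \<P> X Z"
    unfolding y0_def k_def using Ad_has_derivative by blast
  have rel2: "br \<P> X (W z0 x) + (DW \<zeta>0 x + W z0 (D2F (x, 0) (0, \<xi>))) = 0" for x
  proof -
    define Y where "Y = {y. (z0, y) \<in> Dom \<and> F (z0, y) \<in> cmap c ` cdom c}"
    have Y_eq: "Y = {y. (z0, y) \<in> Dom}" using F_eq by (auto simp: Y_def Dom_iff)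
    have Y: "open Y" "y0 \<in> Y" using slice2_open[of z0] p0 by (auto simp: Y_eq)
    have "((\<lambda>y. DF (z0, y) (x, 0)) has_derivative (\<lambda>h. D2F (x, 0) (0, h))) (at y0)"
      using has_derivative_compose[OF slice2 F''] .
    moreover have "((\<lambda>y. W (F (z0, y)) v) has_derivative (\<lambda>h. DW (DF (z0, y0) (0, h)) v)) (at y0)" for v
      using has_derivative_compose[OF F2[OF p0], of "\<lambda>z. W z v" "\<lambda>h. DW h v"] W'[of v] Fz[OF p0] by simp
    ultimately have "((\<lambda>y. W (F (z0, y)) (DF (z0, y) (x, 0))) has_derivative
        (\<lambda>h. DW (DF (z0, y0) (0, h)) (DF (z0, y0) (x, 0)) + W (F (z0, y0)) (D2F (x, 0) (0, h)))) (at y0)"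
      by (intro has_derivative_linear_family[OF fde Y]) (auto simp: Y_def W_lin)
    then have 1: "((\<lambda>y. W (F (z0, y)) (DF (z0, y) (x, 0))) has_derivative
        (\<lambda>h. DW (DF (z0, y0) (0, h)) x + W z0 (D2F (x, 0) (0, h)))) (at y0)"
      by (simp only: DF_x Fz[OF p0])
    have 2: "((\<lambda>y. Ad \<P> (cinv k y) (W (F (z0, y)) (DF (z0, y) (x, 0)))) has_derivative
        (\<lambda>h. a (W (F (z0, y0)) (DF (z0, y0) (x, 0))) h +
          Ad \<P> (cinv k y0) (DW (DF (z0, y0) (0, h)) x + W z0 (D2F (x, 0) (0, h))))) (at y0)"
      by (rule has_derivative_linear_family[OF fdg open_UNIV UNIV_I Ad_linear a(1) 1])
    moreover have "((\<lambda>y. Ad \<P> (cinv k y) (W (F (z0, y)) (DF (z0, y) (x, 0)))) has_derivative (\<lambda>h. 0)) (at y0)"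
      using has_derivative_const[of "W z0 x"] Y
      by (rule has_derivative_transform_within_open) (use equiv in \<open>auto simp: Y_def\<close>)
    ultimately have "(\<lambda>h. a (W (F (z0, y0)) (DF (z0, y0) (x, 0))) h +
          Ad \<P> (cinv k y0) (DW (DF (z0, y0) (0, h)) x + W z0 (D2F (x, 0) (0, h)))) = (\<lambda>h. 0)"
      by (rule has_derivative_unique)
    from fun_cong[OF this, of \<xi>] show ?thesis
      using a(2)[OF X] by (simp add: DF_x Fz[OF p0] k1 Ad_one \<xi>_def[symmetric] \<zeta>0_def[symmetric])
  qed
  have ff: "fundamental_field \<P> \<G> X u = tvec_of ?A u c \<zeta>0"
    unfolding \<zeta>0_def by (rule fund(1)[OF p0 cu[symmetric]])
  have "conn \<G> u (tvec_of ?A u c \<zeta>0) = X"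
    using cg X unfolding ff[symmetric] cartan_geometry_def by blast
  then have "\<zeta> = tvec_of ?A u c \<zeta>0"
    by (intro inj_onD[OF bij_betw_imp_inj_on[OF conn_bij[of u]]] \<zeta> tvec_of_in[OF M c]) (simp add: \<zeta>X)
  then have \<zeta>c: "\<zeta> c = \<zeta>0" using tvec_of_same[OF M c] by simp
  have "exterior_derivative W z0 \<zeta>0 (\<eta> c) = DW \<zeta>0 (\<eta> c) - DW (\<eta> c) \<zeta>0"
    by (rule exterior_derivative_eq[OF W'])
  moreover have "W z0 \<zeta>0 = X" using fund(2)[OF p0 refl] by (simp add: \<zeta>0_def)
  ultimately have "curvature \<P> \<G> u \<zeta> \<eta> = (DW \<zeta>0 (\<eta> c) - DW (\<eta> c) \<zeta>0) + br \<P> X (W z0 (\<eta> c))"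
    unfolding curvature_in_chart[OF c \<zeta> \<eta>] W_def[symmetric] z0_def[symmetric] \<zeta>c by simp
  also have "\<dots> = (br \<P> X (W z0 (\<eta> c)) + (DW \<zeta>0 (\<eta> c) + W z0 (D2F (\<eta> c, 0) (0, \<xi>)))) -
      (DW (\<eta> c) \<zeta>0 + W z0 (D2F (0, \<xi>) (\<eta> c, 0)))"
    using D2F_sym[of "(0, \<xi>)"] by simp
  also have "\<dots> = 0" by (simp only: rel1 rel2 diff_0_right)
  finally show ?thesis .
qed

text \<open>The curvature function on \<open>\<gg>\<close> instead of \<open>\<gg>/\<pp>\<close>.\<close>

definition curv :: "'u \<Rightarrow> 'g \<Rightarrow> 'g \<Rightarrow> 'g" where
  "curv u A B = curvature \<P> \<G> u (conn_inv \<G> u A) (conn_inv \<G> u B)"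

lemma conn_inv_in: "conn_inv \<G> u A \<in> vcarrier (tangent_space (tot_atlas \<G>) u)"
  and conn_conn_inv: "conn \<G> u (conn_inv \<G> u A) = A"
proof -
  have "conn \<G> u ` vcarrier (tangent_space (tot_atlas \<G>) u) = UNIV"
    using conn_bij[of u] by (simp add: bij_betw_def)
  then show "conn_inv \<G> u A \<in> vcarrier (tangent_space (tot_atlas \<G>) u)"
    and "conn \<G> u (conn_inv \<G> u A) = A"
    unfolding conn_inv_def by (simp_all add: inv_into_into f_inv_into_f)
qed

lemma curvature_eq_curv:
  assumes "\<xi> \<in> vcarrier (tangent_space (tot_atlas \<G>) u)" "\<eta> \<in> vcarrier (tangent_space (tot_atlas \<G>) u)"
  shows "curvature \<P> \<G> u \<xi> \<eta> = curv u (conn \<G> u \<xi>) (conn \<G> u \<eta>)"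
  using assms conn_bij[of u] by (simp add: curv_def conn_inv_def bij_betw_imp_inj_on inv_into_f_f)

lemma curv_in_chart:
  fixes c defines "W \<equiv> local_form (tot_atlas \<G>) (conn \<G>) c"
  assumes c: "c \<in> tot_atlas \<G>" and z: "z \<in> cmap c ` cdom c"
  shows "curv (cinv c z) A B = local_curvature (br \<P>) W z (inv_into UNIV (W z) A) (inv_into UNIV (W z) B)"
proof -
  note M = tot_manifold
  have cu: "c \<in> charts_at (tot_atlas \<G>) (cinv c z)"
    using c cinv_in[OF M c z] by (simp add: charts_at_def)
  have bij: "bij (W z)"
    unfolding W_def by (rule local_form_bij[OF M conn_form c z conn_bij])
  have "W z (conn_inv \<G> (cinv c z) A c) = A" for A
    using local_form_coordinate[OF M conn_form cu conn_inv_in] conn_conn_inv cmap_cinv[OF M c z]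
    by (simp add: W_def)
  then have "conn_inv \<G> (cinv c z) A c = inv_into UNIV (W z) A" for A
    using bij by (metis bij_inv_eq_iff)
  then show ?thesis
    unfolding curv_def curvature_in_chart[OF cu conn_inv_in conn_inv_in] local_curvature_def W_def[symmetric]
      cmap_cinv[OF M c z] by simp
qed

lemma chart_around:
  obtains c z where "c \<in> tot_atlas \<G>" "z \<in> cmap c ` cdom c" "cinv c z = u"
proof -
  have "some_chart (tot_atlas \<G>) u \<in> tot_atlas \<G>" "u \<in> cdom (some_chart (tot_atlas \<G>) u)"
    using some_chart_in[OF tot_manifold, of u] by (auto simp: charts_at_def)
  then show thesis using that cinv_cmap[OF tot_manifold] by blast
qed

lemma curv_bilinear: "bilinear (curv u)" and curv_anti: "curv u A B = - curv u B A"
proof -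
  obtain c z where c: "c \<in> tot_atlas \<G>" "z \<in> cmap c ` cdom c" "cinv c z = u" using chart_around .
  define W where "W = local_form (tot_atlas \<G>) (conn \<G>) c"
  have curv: "curv u A B = local_curvature (br \<P>) W z (inv_into UNIV (W z) A) (inv_into UNIV (W z) B)" for A B
    unfolding W_def c(3)[symmetric] by (rule curv_in_chart[OF c(1,2)])
  show anti: "curv u A B = - curv u B A" for A B
    unfolding curv by (rule local_curvature_anti[OF pair_lie_algebra])
  have lin: "linear (W y)" if "y \<in> cmap c ` cdom c" for y
    unfolding W_def by (rule local_form_linear[OF tot_manifold conn_form c(1) that])
  have bij: "bij (W z)"
    unfolding W_def by (rule local_form_bij[OF tot_manifold conn_form c(1,2) conn_bij])
  have W': "((\<lambda>y. W y x) has_derivative frechet_derivative (\<lambda>y. W y x) (at z)) (at z)" for x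
    unfolding W_def
    by (rule smooth_on_has_derivative[OF local_form_smooth[OF tot_manifold conn_form c(1)] c(2)])
  have "linear (local_curvature (br \<P>) W z x)" for x
    by (rule local_curvature_linear[OF pair_lie_algebra chart_open(2)[OF tot_manifold c(1)] c(2) lin W'])
  then have 2: "linear (curv u A)" for A
    unfolding curv
    using linear_compose[OF linear_inv_into[OF lin[OF c(2)] bij],
        of "local_curvature (br \<P>) W z (inv_into UNIV (W z) A)"] by (simp add: comp_def)
  have 1: "linear (\<lambda>A. curv u A B)" for B
    using linear_compose_neg[OF 2[of B]] by (subst anti)
  from 1 2 show "bilinear (curv u)" by (simp add: bilinear_def)
qed

lemma curv_horizontal:
  assumes "X \<in> filt \<P> 0" shows "curv u X B = 0"
  unfolding curv_def by (rule curvature_vertical[OF assms conn_inv_in conn_inv_in conn_conn_inv])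

lemma curv_bianchi:
  assumes S: "subspace S"
    and in_S: "\<And>v. curv v A1 A2 \<in> S" "\<And>v. curv v A2 A3 \<in> S" "\<And>v. curv v A3 A1 \<in> S"
  shows "br \<P> A1 (curv u A2 A3) + br \<P> A2 (curv u A3 A1) + br \<P> A3 (curv u A1 A2)
     - curv u (br \<P> A1 A2) A3 - curv u (br \<P> A2 A3) A1 - curv u (br \<P> A3 A1) A2
     + curv u (curv u A1 A2) A3 + curv u (curv u A2 A3) A1 + curv u (curv u A3 A1) A2 \<in> S"
proof -
  obtain c z0 where c: "c \<in> tot_atlas \<G>" "z0 \<in> cmap c ` cdom c" "cinv c z0 = u" using chart_around .
  define W where "W = local_form (tot_atlas \<G>) (conn \<G>) c"
  let ?U = "cmap c ` cdom c"
  have curv: "local_curvature (br \<P>) W z (inv_into UNIV (W z) A) (inv_into UNIV (W z) B) = curv (cinv c z) A B"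
    if "z \<in> ?U" for z A B
    unfolding W_def by (rule curv_in_chart[OF c(1) that, symmetric])
  have fde: "finite_dim TYPE('e)" using tot_manifold by (simp add: smooth_manifold_def)
  have lin: "linear (W y)" if "y \<in> ?U" for y
    unfolding W_def by (rule local_form_linear[OF tot_manifold conn_form c(1) that])
  have bij: "bij (W z)" if "z \<in> ?U" for z
    unfolding W_def by (rule local_form_bij[OF tot_manifold conn_form c(1) that conn_bij])
  note smooth = local_form_smooth[OF tot_manifold conn_form c(1)]
  have W': "((\<lambda>y. W y x) has_derivative frechet_derivative (\<lambda>y. W y x) (at z)) (at z)" if "z \<in> ?U" for x z
    unfolding W_def by (rule smooth_on_has_derivative[OF smooth that])
  have W'': "((\<lambda>z. frechet_derivative (\<lambda>y. W y x) (at z) v) has_derivative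
      frechet_derivative (\<lambda>z. frechet_derivative (\<lambda>y. W y x) (at z) v) (at z0)) (at z0)" for x v
    unfolding W_def by (rule smooth_on_has_second_derivative[OF smooth c(2)])
  note B = bianchi_modulo_subspace[where DW = "\<lambda>z v x. frechet_derivative (\<lambda>y. W y x) (at z) v"
      and ?D2.0 = "\<lambda>h v x. frechet_derivative (\<lambda>z. frechet_derivative (\<lambda>y. W y x) (at z) v) (at z0) h",
      OF fde pair_lie_algebra chart_open(2)[OF tot_manifold c(1)] c(2) lin bij W' W'' S]
  show ?thesis
    by (rule B[of A1 A2 A3, unfolded curv[OF c(2)] c(3)]) (simp_all only: curv in_S)
qed

text \<open>By horizontality, the representatives chosen in the definition of \<open>curvature_function\<close> do not
  matter.\<close>

lemma curvature_function_pcoset: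
  "curvature_function \<P> \<G> u [pcoset \<P> A, pcoset \<P> B] = curv u A B"
proof -
  have some: "\<exists>w\<in>filt \<P> 0. (SOME A'. A' \<in> pcoset \<P> A) = A + w" for A
  proof -
    have "A \<in> pcoset \<P> A"
      using filt_0 by (force simp: pcoset_def vcoset_def lin_def)
    then have "(SOME A'. A' \<in> pcoset \<P> A) \<in> pcoset \<P> A" by (rule someI)
    then show ?thesis by (auto simp: pcoset_def vcoset_def lin_def)
  qed
  obtain v w where vw: "v \<in> filt \<P> 0" "(SOME A'. A' \<in> pcoset \<P> A) = A + v"
    "w \<in> filt \<P> 0" "(SOME B'. B' \<in> pcoset \<P> B) = B + w"
    using some by meson
  have "[pcoset \<P> A, pcoset \<P> B] \<in> tuples 2 (gmodp \<P>)"
    by (auto simp: tuples_def gmodp_def vquot_def pcoset_def lin_def)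
  then have "curvature_function \<P> \<G> u [pcoset \<P> A, pcoset \<P> B] = curv u (A + v) (B + w)"
    by (simp add: curvature_function_def vw curv_def)
  also have "\<dots> = curv u A B"
    using curv_horizontal[OF vw(1)] curv_horizontal[OF vw(3)] curv_anti[of u A w]
    by (simp add: bilinear_ladd[OF curv_bilinear] bilinear_radd[OF curv_bilinear])
  finally show ?thesis .
qed

end

section \<open>Homogeneity of the curvature\<close>

context admissible_cartan_geometry
begin

lemma curv_same: "curv u A A = 0"
proof -
  have "2 *\<^sub>R curv u A A = 0" using curv_anti[of u A A] by (simp add: scaleR_2 eq_neg_iff_add_eq_0)
  then show ?thesis by simp
qed

text \<open>The curvature function has values in the maps of homogeneity at least \<open>l\<close>. The case of an
  argument in \<open>\<gg>\<^sup>0\<close> is included, as \<open>curv\<close> vanishes there.\<close>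

definition curv_degree :: "int \<Rightarrow> bool" where
  "curv_degree l \<longleftrightarrow> (\<forall>u i j X Y. i \<le> 0 \<longrightarrow> j \<le> 0 \<longrightarrow> X \<in> filt \<P> i \<longrightarrow> Y \<in> filt \<P> j \<longrightarrow>
     curv u X Y \<in> filt \<P> (i + j + l))"

text \<open>The lowest homogeneous component of the curvature is a cocycle. In the Bianchi identity the
  derivatives of the curvature function and the terms quadratic in the curvature are of higher
  homogeneity: the former since differentiating along a field of degree \<open>i < 0\<close> does not lower the
  filtration degree, the latter since \<open>l > 0\<close>.\<close>

lemma curv_cocycle:
  assumes deg: "curv_degree l" and l: "l > 0"
    and neg: "i < 0" "j < 0" "k < 0"
    and ABC: "A \<in> filt \<P> i" "B \<in> filt \<P> j" "C \<in> filt \<P> k"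
  shows "br \<P> A (curv u B C) + br \<P> B (curv u C A) + br \<P> C (curv u A B)
    - curv u (br \<P> A B) C - curv u (br \<P> B C) A - curv u (br \<P> C A) B \<in> filt \<P> (i + j + k + l + 1)"
proof -
  let ?S = "filt \<P> (i + j + k + l + 1)"
  have deg': "curv v X Y \<in> filt \<P> (a + b + l)" if "a < 0" "b < 0" "X \<in> filt \<P> a" "Y \<in> filt \<P> b" for v a b X Y
    using deg that by (simp add: curv_degree_def)
  have quad: "curv u (curv u X Y) Z \<in> ?S"
    if "a < 0" "b < 0" "c < 0" "a + b + c = i + j + k" "X \<in> filt \<P> a" "Y \<in> filt \<P> b" "Z \<in> filt \<P> c" for a b c X Y Z
  proof (cases "a + b + l \<ge> 0")
    case True
    then have "curv u X Y \<in> filt \<P> 0" using filt_mono deg'[OF that(1,2,5,6)] by blast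
    then show ?thesis by (simp add: curv_horizontal filt_0)
  next
    case False
    then have "curv u (curv u X Y) Z \<in> filt \<P> (a + b + l + c + l)"
      using deg'[OF _ that(3) deg'[OF that(1,2,5,6)] that(7)] by simp
    then show ?thesis by (rule filt_mono[rotated]) (use that l in simp)
  qed
  have lin: "curv v X Y \<in> ?S" if "a < 0" "b < 0" "a + b > i + j + k" "X \<in> filt \<P> a" "Y \<in> filt \<P> b" for v a b X Y
    using deg'[OF that(1,2,4,5)] by (rule filt_mono[rotated]) (use that in simp)
  have "br \<P> A (curv u B C) + br \<P> B (curv u C A) + br \<P> C (curv u A B)
     - curv u (br \<P> A B) C - curv u (br \<P> B C) A - curv u (br \<P> C A) B
     + curv u (curv u A B) C + curv u (curv u B C) A + curv u (curv u C A) B \<in> ?S" (is "?E + _ + _ + _ \<in> _")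
  proof (rule curv_bianchi[OF filt_subspace])
    show "curv v A B \<in> ?S" for v using lin[of i j A B] neg ABC by simp
    show "curv v B C \<in> ?S" for v using lin[of j k B C] neg ABC by simp
    show "curv v C A \<in> ?S" for v using lin[of k i C A] neg ABC by simp
  qed
  moreover have "curv u (curv u A B) C \<in> ?S" "curv u (curv u B C) A \<in> ?S" "curv u (curv u C A) B \<in> ?S"
    using quad[of i j k A B C] quad[of j k i B C A] quad[of k i j C A B] neg ABC by auto
  ultimately have "?E + curv u (curv u A B) C + curv u (curv u B C) A + curv u (curv u C A) B
      - curv u (curv u C A) B - curv u (curv u B C) A - curv u (curv u A B) C \<in> ?S"
    by (intro filt_diff)
  then show ?thesis by simp
qed

text \<open>The lowest homogeneous component is a cocycle in the graded of \<open>N'\<close>, hence it is zero.\<close>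

lemma curv_degree_Suc:
  assumes negl: "negligible_submodule \<P> N N'" and \<kappa>: "\<And>u. curvature_function \<P> \<G> u \<in> N'"
    and l: "l > 0" and degree_l: "curv_degree l"
  shows "curv_degree (l + 1)"
proof -
  have sub: "N' \<subseteq> vcarrier (alt_gp \<P> 2)"
    using negl by (auto simp: negligible_submodule_def P_submodule_def vsubspace_def)
  have neg_case: "curv u X Y \<in> filt \<P> (i + j + (l + 1))"
    if ij: "i < 0" "j < 0" and XY: "X \<in> filt \<P> i" "Y \<in> filt \<P> j" for u i j X Y
  proof -
    interpret graded_cochain \<P> "curv u" l
      by unfold_locales (use degree_l curv_bilinear curv_same in \<open>auto simp: curv_degree_def\<close>)
    let ?\<kappa> = "curvature_function \<P> \<G> u"
    have "?\<kappa> (map (pcoset \<P>) Xs) \<in> filt \<P> (sum_list is + l)"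
      if H: "length is = 2" "length Xs = 2" "\<forall>j<2. is ! j < 0 \<and> Xs ! j \<in> filt \<P> (is ! j)" for "is" Xs
    proof -
      obtain a b where ab: "is = [a, b]" using H(1) by (auto simp: length_Suc_conv numeral_2_eq_2)
      obtain A B where AB: "Xs = [A, B]" using H(2) by (auto simp: length_Suc_conv numeral_2_eq_2)
      have "a < 0" "b < 0" "A \<in> filt \<P> a" "B \<in> filt \<P> b"
        using H(3)[rule_format, of 0] H(3)[rule_format, of 1] by (auto simp: ab AB)
      then show ?thesis using degree_l by (simp add: ab AB curvature_function_pcoset curv_degree_def)
    qed
    then have "?\<kappa> \<in> alt_gp_ge \<P> 2 l" using \<kappa> sub by (auto simp: alt_gp_ge_def)
    moreover have "gr_map \<P> 2 l ?\<kappa> = graded_map"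
      by (rule gr_map_eq_graded_map) (rule curvature_function_pcoset)
    ultimately have "graded_map \<in> gr_sub \<P> 2 l N'" using \<kappa> unfolding gr_sub_def by (metis IntI imageI)
    moreover have "codiff \<P> 2 graded_map = vzero (cochains \<P> 3)"
      by (rule codiff_graded_map_eq_zero) (rule curv_cocycle[OF degree_l l])
    moreover have "gr_sub \<P> 2 l N' \<inter>
        {\<phi> \<in> vcarrier (cochains_deg \<P> 2 l). codiff \<P> 2 \<phi> = vzero (cochains \<P> 3)} =
        {vzero (cochains_deg \<P> 2 l)}"
      using negl l unfolding negligible_submodule_def by blast
    ultimately have "graded_map = vzero (cochains_deg \<P> 2 l)"
      using graded_map_cochains_deg by blast
    then have "graded_map [gr_class \<P> i X, gr_class \<P> j Y] = vzero (gr \<P>)"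
      using gr_class_neg[OF ij(1) XY(1)] gr_class_neg[OF ij(2) XY(2)]
      by (simp add: cochains_deg_def cochains_def alt_maps_def tuples_2)
    then have "gr_class \<P> (i + j + l) (curv u X Y) = vzero (gr \<P>)"
      by (simp add: graded_map_gr_class[OF ij XY])
    moreover have "curv u X Y \<in> filt \<P> (i + j + l)" using degree_l ij XY by (simp add: curv_degree_def)
    ultimately have "lift (vzero (gr \<P>)) (\<lambda>n. if n = i + j + l then curv u X Y else 0)"
      using lift_gr_class by metis
    from lift_diff[OF this lift_zero, of "i + j + l"] show ?thesis by (simp add: algebra_simps)
  qed
  show ?thesis
    unfolding curv_degree_def
  proof (intro allI impI)
    fix u i j X Y assume H: "i \<le> 0" "j \<le> 0" "X \<in> filt \<P> i" "Y \<in> filt \<P> j"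
    consider "i < 0 \<and> j < 0" | "i = 0" | "j = 0" using H by linarith
    then show "curv u X Y \<in> filt \<P> (i + j + (l + 1))"
    proof cases
      case 1
      then show ?thesis using neg_case H by blast
    next
      case 2
      then show ?thesis using H by (simp add: curv_horizontal filt_0)
    next
      case 3
      then show ?thesis using H curv_anti[of u X Y] by (simp add: curv_horizontal filt_0)
    qed
  qed
qed

lemma curv_eq_zero:
  assumes "negligible_submodule \<P> N N'" and "\<And>u. curvature_function \<P> \<G> u \<in> N'"
    and reg: "regular \<P> \<G>"
  shows "curv u X Y = 0"
proof -
  have deg: "curv_degree (int n + 1)" for n
  proof (induction n)
    case 0
    show ?case
      using reg conn_inv_in conn_conn_inv by (simp add: curv_degree_def regular_def curv_def)
  next
    case (Suc n)
    then show ?case using curv_degree_Suc[OF assms(1,2), of "int n + 1"] by (simp add: add_ac)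
  qed
  \<comment> \<open>all arguments are of degree \<open>-\<mu>\<close>, and \<open>- 2\<mu> + (n + 1) = \<nu> + 1\<close>\<close>
  define n where "n = height \<P> + 2 * depth \<P>"
  have "curv u X Y \<in> filt \<P> (- int (depth \<P>) + - int (depth \<P>) + (int n + 1))"
    using deg[of n] filt_low[of "- int (depth \<P>)"] unfolding curv_degree_def
    by (metis UNIV_I neg_le_0_iff_le of_nat_0_le_iff order_refl)
  then show ?thesis using filt_high[of "int (height \<P>) + 1"] by (simp add: n_def algebra_simps)
qed

end

theorem proposition4p6:
  fixes \<P> :: "('g::real_normed_vector, 'p::{t2_space,second_countable_topology},
                'h::real_normed_vector) pair"
    and N N' :: "('g set list \<Rightarrow> 'g) set"
    and \<G> :: "('u::{t2_space,second_countable_topology}, 'e::real_normed_vector,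
                'm::{t2_space,second_countable_topology}, 'f::real_normed_vector, 'g, 'p) geometry"
  assumes "admissible_pair \<P>"
    and "normalization_condition \<P> N"
    and "negligible_submodule \<P> N N'"
    and "cartan_geometry \<P> \<G>"
    and "regular \<P> \<G>"
    and "normal_geometry \<P> N \<G>"
  shows "(\<forall>u. essential_curvature \<P> N N' \<G> u = vzero (ess_target \<P> N N')) \<longleftrightarrow>
         (\<forall>u. \<forall>\<xi>\<in>vcarrier (tangent_space (tot_atlas \<G>) u).
              \<forall>\<eta>\<in>vcarrier (tangent_space (tot_atlas \<G>) u). curvature \<P> \<G> u \<xi> \<eta> = 0)"
proof -
  interpret admissible_cartan_geometry \<P> \<G>
    using assms(1,4) by (rule admissible_cartan_geometry.intro)
  let ?T = "tuples 2 (gmodp \<P>)" and ?\<kappa> = "curvature_function \<P> \<G>"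
  let ?add = "\<lambda>\<phi> \<psi>. restrict (\<lambda>xs. \<phi> xs + \<psi> xs) ?T"
  have N': "vsubspace (alt_gp \<P> 2) N'"
    using assms(3) by (auto simp: negligible_submodule_def P_submodule_def)
  have ext: "\<psi> \<in> extensional ?T" if "\<psi> \<in> N'" for \<psi>
    using N' that by (auto simp: vsubspace_def alt_gp_def alt_maps_def)
  have zero: "restrict (\<lambda>xs. 0) ?T \<in> N'"
    using N' by (simp add: vsubspace_def alt_gp_def alt_maps_def lin_def)
  have ess: "essential_curvature \<P> N N' \<G> u = ?add (?\<kappa> u) ` N'" for u
    by (simp add: essential_curvature_def vcoset_def alt_gp_def alt_maps_def lin_def)
  have target: "vzero (ess_target \<P> N N') = N'"
    by (simp add: ess_target_def vquot_def)
  show ?thesis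
    unfolding ess target
  proof
    assume H: "\<forall>u. ?add (?\<kappa> u) ` N' = N'"
    have "?\<kappa> u \<in> N'" for u
    proof -
      have "?add (?\<kappa> u) (restrict (\<lambda>xs. 0) ?T) \<in> N'" using H zero by blast
      moreover have "?add (?\<kappa> u) (restrict (\<lambda>xs. 0) ?T) = ?\<kappa> u"
        by (auto simp: curvature_function_def fun_eq_iff restrict_def)
      ultimately show ?thesis by simp
    qed
    then show "\<forall>u. \<forall>\<xi>\<in>vcarrier (tangent_space (tot_atlas \<G>) u).
        \<forall>\<eta>\<in>vcarrier (tangent_space (tot_atlas \<G>) u). curvature \<P> \<G> u \<xi> \<eta> = 0"
      using curv_eq_zero[OF assms(3) _ assms(5)] by (simp add: curvature_eq_curv)
  next
    assume H: "\<forall>u. \<forall>\<xi>\<in>vcarrier (tangent_space (tot_atlas \<G>) u).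
        \<forall>\<eta>\<in>vcarrier (tangent_space (tot_atlas \<G>) u). curvature \<P> \<G> u \<xi> \<eta> = 0"
    show "\<forall>u. ?add (?\<kappa> u) ` N' = N'"
    proof
      fix u
      have "?\<kappa> u xs = 0" if "xs \<in> ?T" for xs
        using that H conn_inv_in by (simp add: curvature_function_def)
      then have "?add (?\<kappa> u) \<psi> = \<psi>" if "\<psi> \<in> N'" for \<psi>
        using ext[OF that] by (auto simp: fun_eq_iff restrict_def extensional_def)
      then show "?add (?\<kappa> u) ` N' = N'" by simp
    qed
  qed
qed

end
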